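(* Let $N\in\{3,4\}$, let $\Omega\subset\mathbb{R}^N$ be a bounded regular domain, let $m$ be a positive integer, and let $\mu_i\neq 0$ and $\beta_{ij}=\beta_{ji}\neq 0$ ($i,j\in\{1,\dots,m\}$, $i\ne j$) be real numbers. Then the set of nontrivial bifurcation points of the system $$-\Delta u_i+\lambda_iu_i=\mu_iu_i^3+\sum_{k\ne i}\beta_{ki}u_k^2u_i\ \text{ in }\Omega,\qquad u_i\in H_0^1(\Omega),\qquad i=1,\dots,m,$$ is exactly $$\Big\{(\lambda_1,\dots,\lambda_m)\in\mathbb{R}^m:\ \lambda_i\text{ is an eigenvalue of }-\Delta\text{ on }H_0^1(\Omega)\text{ for each }i\in\{1,\dots,m\}\Big\}.$$
   Context: A vector $\vec\lambda^*=(\lambda_1^*,\dots,\lambda_m^* )\in\mathbb{R}^m$ is a bifurcation point of the system if there is a sequence $\{(\lambda_{n,1},\dots,\lambda_{n,m};\vec u_n)\}\subset\mathbb{R}^m\times H_0^1(\Omega,\mathbb{R}^m)$ such that $\vec u_n\not\equiv 0$ solves the system with $\lambda_i=\lambda_{n,i}$ ($i=1,\dots,m$), $-\lambda_{n,i}\to\lambda_i^*$ for every $i=1,\dots,m$, and $\vec u_n\to 0$ strongly in $H_0^1(\Omega,\mathbb{R}^m)$ as $n\to\infty$. (Note the sign: $-\lambda_{n,i}\to\lambda_i^*$. No $L^2$-norm is prescribed.) The point is a nontrivial bifurcation point if the sequence can be chosen so that each $\vec u_n$ is nontrivial, meaning that all its components are not identically zero. "Regular" means that the boundary is sufficiently smooth.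 *)

theory Defs
  imports "HOL-Analysis.Analysis"
begin

section \<open>Test functions and domains\<close>

definition partial_deriv :: "'n \<Rightarrow> (real ^ 'n \<Rightarrow> real) \<Rightarrow> real ^ 'n \<Rightarrow> real" where
  "partial_deriv i f x = frechet_derivative f (at x) (axis i 1)"

primrec C_k :: "nat \<Rightarrow> (real ^ 'n \<Rightarrow> real) \<Rightarrow> bool" where
  "C_k 0 f \<longleftrightarrow> continuous_on UNIV f"
| "C_k (Suc k) f \<longleftrightarrow> (\<forall>x. f differentiable (at x)) \<and> (\<forall>i. C_k k (partial_deriv i f))"

definition test_functions :: "(real ^ 'n) set \<Rightarrow> (real ^ 'n \<Rightarrow> real) set" where
  "test_functions \<Omega> =
     {\<phi>. (\<forall>k. C_k k \<phi>) \<and> compact (closure {x. \<phi> x \<noteq> 0}) \<and> closure {x. \<phi> x \<noteq> 0} \<subseteq> \<Omega>}"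

text \<open>
  Near each boundary point the domain is the region above the graph of a \<open>C\<^sup>1\<close> function in
  suitably rotated coordinates. The unit vector \<open>e\<close> is the vertical direction; \<open>\<gamma>\<close> is evaluated
  only at the projection of \<open>x\<close> to the hyperplane orthogonal to \<open>e\<close>, so it is a function of the
  remaining \<open>N - 1\<close> coordinates. \<open>C\<^sup>1\<close> is the least demanding of the classes \<open>C\<^sup>k\<close>, \<open>k \<ge> 1\<close>, so every
  domain with smoother boundary is included.
\<close>

definition C1_boundary :: "(real ^ 'n) set \<Rightarrow> bool" where
  "C1_boundary \<Omega> \<longleftrightarrow>
     (\<forall>x0 \<in> frontier \<Omega>. \<exists>r > 0. \<exists>e \<gamma>. norm e = 1 \<and> C_k 1 \<gamma> \<and>
        \<Omega> \<inter> ball x0 r = {x \<in> ball x0 r. x \<bullet> e > \<gamma> (x - (x \<bullet> e) *\<^sub>R e)})"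

definition bounded_regular_domain :: "(real ^ 'n) set \<Rightarrow> bool" where
  "bounded_regular_domain \<Omega> \<longleftrightarrow>
     \<Omega> \<noteq> {} \<and> open \<Omega> \<and> connected \<Omega> \<and> bounded \<Omega> \<and> C1_boundary \<Omega>"

section \<open>Sobolev spaces\<close>

text \<open>
  Elements of the function spaces are represented by functions on the whole space, of which only
  the values on \<open>\<Omega>\<close>, up to Lebesgue null sets, are relevant.
\<close>

definition L2 :: "(real ^ 'n) set \<Rightarrow> (real ^ 'n \<Rightarrow> 'b::euclidean_space) set" where
  "L2 \<Omega> = {f \<in> borel_measurable (lebesgue_on \<Omega>). integrable (lebesgue_on \<Omega>) (\<lambda>x. (norm (f x))\<^sup>2)}"

definition has_weak_gradient ::
    "(real ^ 'n) set \<Rightarrow> (real ^ 'n \<Rightarrow> real) \<Rightarrow> (real ^ 'n \<Rightarrow> real ^ 'n) \<Rightarrow> bool" where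
  "has_weak_gradient \<Omega> u G \<longleftrightarrow>
     (\<forall>\<phi> \<in> test_functions \<Omega>. \<forall>i.
        (\<integral>x. u x * partial_deriv i \<phi> x \<partial>lebesgue_on \<Omega>) = - (\<integral>x. G x $ i * \<phi> x \<partial>lebesgue_on \<Omega>))"

definition H1 :: "(real ^ 'n) set \<Rightarrow> (real ^ 'n \<Rightarrow> real) set" where
  "H1 \<Omega> = {u \<in> L2 \<Omega>. \<exists>G \<in> L2 \<Omega>. has_weak_gradient \<Omega> u G}"

text \<open>The choice is immaterial: weak gradients are unique almost everywhere in \<open>\<Omega>\<close>.\<close>

definition weak_grad :: "(real ^ 'n) set \<Rightarrow> (real ^ 'n \<Rightarrow> real) \<Rightarrow> real ^ 'n \<Rightarrow> real ^ 'n" where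
  "weak_grad \<Omega> u = (SOME G. G \<in> L2 \<Omega> \<and> has_weak_gradient \<Omega> u G)"

definition H1_norm :: "(real ^ 'n) set \<Rightarrow> (real ^ 'n \<Rightarrow> real) \<Rightarrow> real" where
  "H1_norm \<Omega> u =
     sqrt ((\<integral>x. (u x)\<^sup>2 \<partial>lebesgue_on \<Omega>) + (\<integral>x. (norm (weak_grad \<Omega> u x))\<^sup>2 \<partial>lebesgue_on \<Omega>))"

definition H10 :: "(real ^ 'n) set \<Rightarrow> (real ^ 'n \<Rightarrow> real) set" where
  "H10 \<Omega> = {u \<in> H1 \<Omega>. \<exists>\<phi> :: nat \<Rightarrow> real ^ 'n \<Rightarrow> real.
     (\<forall>n. \<phi> n \<in> test_functions \<Omega>) \<and> (\<lambda>n. H1_norm \<Omega> (\<lambda>x. \<phi> n x - u x)) \<longlonglongrightarrow> 0}"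

definition H1_vec_norm :: "(real ^ 'n) set \<Rightarrow> ('m::finite \<Rightarrow> real ^ 'n \<Rightarrow> real) \<Rightarrow> real" where
  "H1_vec_norm \<Omega> u = sqrt (\<Sum>i\<in>UNIV. (H1_norm \<Omega> (u i))\<^sup>2)"

definition vanishes_on :: "(real ^ 'n) set \<Rightarrow> (real ^ 'n \<Rightarrow> real) \<Rightarrow> bool" where
  "vanishes_on \<Omega> u \<longleftrightarrow> (AE x in lebesgue_on \<Omega>. u x = 0)"

section \<open>Dirichlet eigenvalues, solutions and bifurcation points\<close>

definition dirichlet_eigenvalue :: "(real ^ 'n) set \<Rightarrow> real \<Rightarrow> bool" where
  "dirichlet_eigenvalue \<Omega> l \<longleftrightarrow>
     (\<exists>u \<in> H10 \<Omega>. \<not> vanishes_on \<Omega> u \<and>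
        (\<forall>\<phi> \<in> H10 \<Omega>. (\<integral>x. weak_grad \<Omega> u x \<bullet> weak_grad \<Omega> \<phi> x \<partial>lebesgue_on \<Omega>)
                     = l * (\<integral>x. u x * \<phi> x \<partial>lebesgue_on \<Omega>)))"

text \<open>
  Solutions are weak solutions in \<open>H\<^sub>0\<^sup>1\<close>. In dimension at most four \<open>H\<^sub>0\<^sup>1\<close> embeds into \<open>L\<^sup>4\<close>, so all
  integrands are integrable.
\<close>

definition solves_system ::
    "(real ^ 'n) set \<Rightarrow> ('m::finite \<Rightarrow> real) \<Rightarrow> ('m \<Rightarrow> 'm \<Rightarrow> real) \<Rightarrow> real ^ 'm
      \<Rightarrow> ('m \<Rightarrow> real ^ 'n \<Rightarrow> real) \<Rightarrow> bool" where
  "solves_system \<Omega> \<mu> \<beta> l u \<longleftrightarrow>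
     (\<forall>i. u i \<in> H10 \<Omega> \<and>
       (\<forall>\<phi> \<in> H10 \<Omega>.
          (\<integral>x. weak_grad \<Omega> (u i) x \<bullet> weak_grad \<Omega> \<phi> x + l $ i * u i x * \<phi> x \<partial>lebesgue_on \<Omega>)
        = (\<integral>x. (\<mu> i * (u i x) ^ 3 + (\<Sum>k\<in>UNIV - {i}. \<beta> k i * (u k x)\<^sup>2 * u i x)) * \<phi> x
             \<partial>lebesgue_on \<Omega>)))"

definition bifurcation_sequence ::
    "(real ^ 'n) set \<Rightarrow> ('m::finite \<Rightarrow> real) \<Rightarrow> ('m \<Rightarrow> 'm \<Rightarrow> real) \<Rightarrow> real ^ 'm
      \<Rightarrow> (nat \<Rightarrow> real ^ 'm) \<Rightarrow> (nat \<Rightarrow> 'm \<Rightarrow> real ^ 'n \<Rightarrow> real) \<Rightarrow> bool" where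
  "bifurcation_sequence \<Omega> \<mu> \<beta> lstar l u \<longleftrightarrow>
     (\<forall>n. solves_system \<Omega> \<mu> \<beta> (l n) (u n) \<and> (\<exists>i. \<not> vanishes_on \<Omega> (u n i))) \<and>
     (\<forall>i. (\<lambda>n. - (l n $ i)) \<longlonglongrightarrow> lstar $ i) \<and>
     (\<lambda>n. H1_vec_norm \<Omega> (u n)) \<longlonglongrightarrow> 0"

definition bifurcation_point ::
    "(real ^ 'n) set \<Rightarrow> ('m::finite \<Rightarrow> real) \<Rightarrow> ('m \<Rightarrow> 'm \<Rightarrow> real) \<Rightarrow> real ^ 'm \<Rightarrow> bool" where
  "bifurcation_point \<Omega> \<mu> \<beta> lstar \<longleftrightarrow> (\<exists>l u. bifurcation_sequence \<Omega> \<mu> \<beta> lstar l u)"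

definition nontrivial_bifurcation_point ::
    "(real ^ 'n) set \<Rightarrow> ('m::finite \<Rightarrow> real) \<Rightarrow> ('m \<Rightarrow> 'm \<Rightarrow> real) \<Rightarrow> real ^ 'm \<Rightarrow> bool" where
  "nontrivial_bifurcation_point \<Omega> \<mu> \<beta> lstar \<longleftrightarrow>
     (\<exists>l u. bifurcation_sequence \<Omega> \<mu> \<beta> lstar l u \<and> (\<forall>n i. \<not> vanishes_on \<Omega> (u n i)))"

end

theory Submission
  imports Defs
begin

text \<open>
  Writing \<open>-\<lambda>\<^sub>i = \<Lambda>\<^sub>i + t\<^sub>i\<close>, a small solution near an eigenvalue tuple \<open>\<Lambda>\<close> has the form \<open>u\<^sub>i = \<theta>\<^sub>i (v\<^sub>i + w\<^sub>i)\<close> with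
  \<open>v\<^sub>i\<close> in the unit sphere of the eigenspace of \<open>\<Lambda>\<^sub>i\<close> and \<open>w\<^sub>i\<close> orthogonal to that eigenspace, normalised so that
  \<open>\<parallel>u\<^sub>i\<parallel>\<^sub>2 = \<epsilon>\<close>. Since the nonlinearity is cubic, the component of the system orthogonal to the eigenspaces,
  with \<open>t\<^sub>i\<close> eliminated by testing with \<open>v\<^sub>i\<close>, is a contraction in \<open>w\<close> for small \<open>\<epsilon>\<close>; its fixed point \<open>w(v)\<close> is
  Lipschitz in \<open>v\<close>. The \<open>t\<^sub>i\<close> are thus Lagrange multipliers of the constraints \<open>\<parallel>u\<^sub>i\<parallel>\<^sub>2 = \<epsilon>\<close>, and maximising the
  energy over the compact product of the unit spheres of the eigenspaces solves the remaining
  finite-dimensional equations: along \<open>cos t v\<^sub>i + sin t h\<close> the first variation sees only the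
  eigenspace component of the residual. All components of the solution have norm \<open>\<epsilon>\<close>, hence none is trivial.

  Conversely, if \<open>\<Lambda>\<^sub>i\<close> is not an eigenvalue, \<open>-\<Delta> - \<Lambda>\<^sub>i\<close> is bounded below, so the \<open>i\<close>-th component of every small
  solution with \<open>-\<lambda>\<^sub>i\<close> near \<open>\<Lambda>\<^sub>i\<close> vanishes.

  Both arguments need the embedding of \<open>H\<^sub>0\<^sup>1\<close> into \<open>L\<^sup>4\<close>, which makes the quartic form bounded, and the
  compactness of the embedding into \<open>L\<^sup>2\<close>, used as \<open>\<parallel>u\<parallel>\<^sub>2\<^sup>2 \<le> \<epsilon> \<parallel>u\<parallel>\<^sup>2 + \<Sum> \<langle>u, e\<rangle>\<^sup>2\<close> with finitely many \<open>e\<close>.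
\<close>

section \<open>Hilbert space preliminaries\<close>

text \<open>The eigenvalues may be multiple and the coefficients of either sign, so bifurcation from
  a simple eigenvalue does not apply. A maximum over a compact set exists whatever the signs.
  Prescribing the norm of every component separately, with one multiplier each, is what excludes
  solutions with vanishing components; fixing the total norm would not. The price is a correction
  that depends on the point of the product of spheres and is only known to be Lipschitz, so the
  first variation has to be taken along curves that need not be differentiable. Rescaling by
  \<epsilon> gives the cubic term the coefficient \<epsilon> squared, which supplies the
  contraction.

  The equation is written with the full H1 inner product. Then -Delta u = l u says that the H1
  product of u with any test function is 1 + l times the L2 product, so the abstract parameter is
  \<kappa> = 1 + l, and 1 - \<lambda> is the nearby value along the bifurcating sequence. The
  abstract argument sees the differential equation only through the embedding \<open>\<iota>\<close>
  and the pointwise product \<open>p\<close>.\<close>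

lemma orthogonal_projection_exists:
  fixes S :: "'a::{real_inner,complete_space} set"
  assumes "closed S" "subspace S"
  shows "\<exists>p\<in>S. \<forall>y\<in>S. inner (x - p) y = 0"
proof -
  define d where "d = infdist x S"
  have ne: "S \<noteq> {}" using subspace_0[OF assms(2)] by auto
  have dle: "d \<le> norm (x - y)" if "y \<in> S" for y
    using infdist_le[OF that, of x] by (simp add: d_def dist_norm)
  have d0: "0 \<le> d" by (simp add: d_def infdist_nonneg)
  have "\<exists>y\<in>S. norm (x - y) < d + 1 / real (Suc n)" for n
  proof (rule ccontr)
    assume "\<not> ?thesis"
    then have "d + 1 / real (Suc n) \<le> dist x y" if "y \<in> S" for y using that by (force simp: dist_norm)
    then have "d + 1 / real (Suc n) \<le> d"
      unfolding d_def infdist_notempty[OF ne] by (intro cINF_greatest ne) auto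
    then show False by simp
  qed
  then obtain y where yS: "\<And>n. y n \<in> S" and y: "\<And>n. norm (x - y n) < d + 1 / real (Suc n)" by metis
  have lim: "(\<lambda>n. norm (x - y n)) \<longlonglongrightarrow> d"
  proof (rule tendsto_sandwich[where f = "\<lambda>_. d" and h = "\<lambda>n. d + 1 / real (Suc n)"])
    show "(\<lambda>n. d + 1 / real (Suc n)) \<longlonglongrightarrow> d"
      using tendsto_add[OF tendsto_const[of d] LIMSEQ_Suc[OF lim_1_over_n]] by simp
    show "\<forall>\<^sub>F n in sequentially. d \<le> norm (x - y n)" using dle[OF yS] by simp
    show "\<forall>\<^sub>F n in sequentially. norm (x - y n) \<le> d + 1 / real (Suc n)"
      using y less_imp_le by (intro always_eventually) blast
  qed simp
  \<comment> \<open>Parallelogram law: the midpoint of two points of \<open>S\<close> lies in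
    \<open>S\<close>, hence has distance at least \<open>d\<close> from \<open>x\<close>.\<close>
  have par: "(norm (y n - y k))\<^sup>2 \<le> 2 * (norm (x - y n))\<^sup>2 + 2 * (norm (x - y k))\<^sup>2 - 4 * d\<^sup>2" for n k
  proof -
    have "(1/2) *\<^sub>R (y n + y k) \<in> S" using assms(2) yS by (simp add: subspace_add subspace_scale)
    from dle[OF this] have "d\<^sup>2 \<le> (norm (x - (1/2) *\<^sub>R (y n + y k)))\<^sup>2" using d0 by (simp add: power_mono)
    then show ?thesis
      by (simp add: power2_norm_eq_inner inner_diff_left inner_diff_right inner_add_left inner_add_right
          algebra_simps inner_commute)
  qed
  define h where "h n = 2 * (norm (x - y n))\<^sup>2 - 2 * d\<^sup>2" for n
  have hlim: "h \<longlonglongrightarrow> 0"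
    using tendsto_diff[OF tendsto_mult_left[OF tendsto_power[OF lim, of 2], of 2] tendsto_const[of "2 * d\<^sup>2"]]
    unfolding h_def by simp
  have "Cauchy y"
  proof (rule CauchyI)
    fix e :: real assume e: "0 < e"
    then have "eventually (\<lambda>n. h n < e\<^sup>2 / 2) sequentially"
      using order_tendstoD(2)[OF hlim, of "e\<^sup>2/2"] by simp
    then obtain N where N: "\<And>n. n \<ge> N \<Longrightarrow> h n < e\<^sup>2 / 2" unfolding eventually_sequentially by auto
    have "norm (y m - y n) < e" if "m \<ge> N" "n \<ge> N" for m n
    proof -
      have "(norm (y m - y n))\<^sup>2 < e\<^sup>2" using par[of m n] N[OF that(1)] N[OF that(2)] unfolding h_def by argo
      then show ?thesis using e power2_less_imp_less by force
    qed
    then show "\<exists>M. \<forall>m\<ge>M. \<forall>n\<ge>M. norm (y m - y n) < e" by blast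
  qed
  then obtain p where p: "y \<longlonglongrightarrow> p" using Cauchy_convergent convergent_def by blast
  have pS: "p \<in> S" using closed_sequentially[OF assms(1)] yS p by blast
  have "(\<lambda>n. norm (x - y n)) \<longlonglongrightarrow> norm (x - p)" using p by (intro tendsto_intros)
  then have dp: "norm (x - p) = d" using lim LIMSEQ_unique by blast
  have "inner (x - p) z = 0" if z: "z \<in> S" for z
  proof (rule ccontr)
    assume nz: "inner (x - p) z \<noteq> 0"
    then have z0: "inner z z > 0" by (metis inner_gt_zero_iff inner_zero_right)
    \<comment> \<open>\<open>t *\<^sub>R z\<close> is the projection of \<open>x - p\<close> onto
      the line of \<open>z\<close>; moving \<open>p\<close> by it would come strictly closer to
      \<open>x\<close>.\<close>
    define t where "t = inner (x - p) z / inner z z"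
    have "p + t *\<^sub>R z \<in> S" using pS z assms(2) by (simp add: subspace_add subspace_scale)
    from dle[OF this] have "(norm (x - p))\<^sup>2 \<le> (norm (x - p - t *\<^sub>R z))\<^sup>2"
      using d0 dp by (simp add: power_mono diff_diff_eq)
    also have "\<dots> = (norm (x - p))\<^sup>2 - 2 * t * inner (x - p) z + t\<^sup>2 * inner z z"
      unfolding power2_norm_eq_inner
      by (simp add: inner_diff_left inner_diff_right inner_commute power2_eq_square algebra_simps)
    also have "\<dots> = (norm (x - p))\<^sup>2 - (inner (x - p) z)\<^sup>2 / inner z z"
      using z0 by (simp add: t_def power2_eq_square field_simps)
    finally show False using nz z0 by (simp add: divide_le_0_iff)
  qed
  then show ?thesis using pS by blast
qed

definition orth_proj :: "'a::{real_inner,complete_space} set \<Rightarrow> 'a \<Rightarrow> 'a" where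
  "orth_proj S x = (SOME p. p \<in> S \<and> (\<forall>y\<in>S. inner (x - p) y = 0))"

lemma
  fixes S :: "'a::{real_inner,complete_space} set"
  assumes "closed S" "subspace S"
  shows orth_proj_in: "orth_proj S x \<in> S"
    and orth_proj_orth: "y \<in> S \<Longrightarrow> inner (x - orth_proj S x) y = 0"
proof -
  have "\<exists>p. p \<in> S \<and> (\<forall>y\<in>S. inner (x - p) y = 0)"
    using orthogonal_projection_exists[OF assms] by blast
  from someI_ex[OF this] show "orth_proj S x \<in> S" "y \<in> S \<Longrightarrow> inner (x - orth_proj S x) y = 0"
    unfolding orth_proj_def by auto
qed

lemma orth_proj_unique:
  fixes S :: "'a::{real_inner,complete_space} set"
  assumes S: "closed S" "subspace S" and "p \<in> S" "\<And>y. y \<in> S \<Longrightarrow> inner (x - p) y = 0"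
  shows "orth_proj S x = p"
proof -
  let ?d = "orth_proj S x - p"
  have d: "?d \<in> S" using assms orth_proj_in[OF S] by (simp add: subspace_diff)
  have "inner ?d ?d = inner (x - p) ?d - inner (x - orth_proj S x) ?d"
    by (simp add: inner_diff_left)
  then show ?thesis using assms(4)[OF d] orth_proj_orth[OF S d] by simp
qed

lemma orth_proj_ident:
  fixes S :: "'a::{real_inner,complete_space} set"
  assumes S: "closed S" "subspace S" and "x \<in> S"
  shows "orth_proj S x = x"
  by (rule orth_proj_unique[OF S]) (use assms in auto)

lemma norm_orth_proj_le:
  fixes S :: "'a::{real_inner,complete_space} set"
  assumes S: "closed S" "subspace S"
  shows "norm (orth_proj S x) \<le> norm x"
proof -
  have "inner (orth_proj S x) (orth_proj S x) = inner x (orth_proj S x)"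
    using orth_proj_orth[OF S orth_proj_in[OF S], of x x] by (simp add: inner_diff_left)
  then have "norm (orth_proj S x) * norm (orth_proj S x) \<le> norm x * norm (orth_proj S x)"
    using norm_cauchy_schwarz[of x "orth_proj S x"]
    by (simp add: power2_norm_eq_inner[symmetric] power2_eq_square)
  then show ?thesis by (cases "orth_proj S x = 0") (simp_all add: mult_le_cancel_right)
qed

lemma bounded_linear_orth_proj:
  fixes S :: "'a::{real_inner,complete_space} set"
  assumes S: "closed S" "subspace S"
  shows "bounded_linear (orth_proj S)"
proof (rule bounded_linear_intro[where K = 1])
  show "orth_proj S (x + y) = orth_proj S x + orth_proj S y" for x y
    by (rule orth_proj_unique[OF S])
       (use S orth_proj_in[OF S] orth_proj_orth[OF S] in
         \<open>auto simp: subspace_add add_diff_add inner_add_left\<close>)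
  show "orth_proj S (r *\<^sub>R x) = r *\<^sub>R orth_proj S x" for r x
    by (rule orth_proj_unique[OF S])
       (use S orth_proj_in[OF S] orth_proj_orth[OF S] in
         \<open>auto simp: subspace_scale scaleR_diff_right[symmetric]\<close>)
qed (use norm_orth_proj_le[OF S] in auto)

text \<open>The orthogonal complement of the kernel is a line: subtracting
  \<open>(f x / f z) *\<^sub>R z\<close> moves any \<open>x\<close> into the kernel, to which
  \<open>z\<close> is orthogonal.\<close>

lemma riesz_representation:
  fixes f :: "'a::{real_inner,complete_space} \<Rightarrow> real"
  assumes "bounded_linear f"
  shows "\<exists>r. \<forall>x. inner r x = f x"
proof (cases "\<forall>x. f x = 0")
  case True then show ?thesis by (intro exI[of _ 0]) simp
next
  case False
  interpret f: bounded_linear f by fact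
  obtain x0 where x0: "f x0 \<noteq> 0" using False by blast
  let ?S = "{x. f x = 0}"
  have S: "closed ?S" "subspace ?S"
    by (auto intro!: closed_Collect_eq f.continuous_on continuous_on_id simp: subspace_def f.add f.scaleR f.zero)
  define z where "z = x0 - orth_proj ?S x0"
  have fz: "f z = f x0" using orth_proj_in[OF S, of x0] by (simp add: z_def f.diff)
  have zo: "inner z y = 0" if "f y = 0" for y using orth_proj_orth[OF S, of y x0] that by (simp add: z_def)
  have z0: "inner z z > 0" using fz x0 f.zero by (metis inner_gt_zero_iff)
  have "inner ((f z / inner z z) *\<^sub>R z) x = f x" for x
  proof -
    have "f (x - (f x / f z) *\<^sub>R z) = 0" using fz x0 by (simp add: f.diff f.scaleR)
    from zo[OF this] have "inner z x = (f x / f z) * inner z z" by (simp add: inner_diff_right)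
    then show ?thesis using z0 fz x0 by (simp add: field_simps)
  qed
  then show ?thesis by blast
qed

lemma inner_eqI: "(\<And>z. inner x z = inner y z) \<Longrightarrow> x = (y :: 'a::real_inner)"
  using vector_eq_rdot by blast

lemma bounded_family_convergent_subseq:
  fixes f :: "'e \<Rightarrow> nat \<Rightarrow> real"
  assumes "finite E" "\<And>e. e \<in> E \<Longrightarrow> bounded (range (f e))"
  shows "\<exists>r::nat \<Rightarrow> nat. strict_mono r \<and> (\<forall>e\<in>E. convergent (f e \<circ> r))"
  using assms
proof (induction E rule: finite_induct)
  case empty show ?case by (intro exI[of _ id]) (auto simp: strict_mono_def)
next
  case (insert a E)
  have "\<exists>r::nat \<Rightarrow> nat. strict_mono r \<and> (\<forall>e\<in>E. convergent (f e \<circ> r))"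
    using insert.IH insert.prems by blast
  then obtain r :: "nat \<Rightarrow> nat" where r: "strict_mono r" "\<And>e. e \<in> E \<Longrightarrow> convergent (f e \<circ> r)" by blast
  have "bounded (range (f a \<circ> r))" using insert.prems[of a] by (auto elim: bounded_subset)
  then obtain l s where s: "strict_mono (s::nat \<Rightarrow> nat)" "((f a \<circ> r) \<circ> s) \<longlonglongrightarrow> l"
    using bounded_imp_convergent_subsequence by blast
  have "convergent (f e \<circ> (r \<circ> s))" if "e \<in> insert a E" for e
    using that r(2) s convergent_subseq_convergent[OF _ s(1)] by (fastforce simp: comp_assoc convergent_def)
  then show ?case using r(1) s(1) strict_mono_o by blast
qed

text \<open>Compactness is stated as an inequality instead of through sequences. Both sides are
  continuous in \<open>u\<close>, so it passes from test functions to their closure, and it gives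
  the Fredholm theory below without weak convergence or a spectral theorem.\<close>

locale compact_map =
  fixes \<iota> :: "'h::{real_inner,complete_space} \<Rightarrow> 'l::real_inner"
  assumes bounded_linear_iota: "bounded_linear \<iota>"
    and almost_finite_rank: "\<And>\<epsilon>. 0 < \<epsilon> \<Longrightarrow>
      \<exists>E. finite E \<and> (\<forall>u. (norm (\<iota> u))\<^sup>2 \<le> \<epsilon> * (norm u)\<^sup>2 + (\<Sum>e\<in>E. (inner (\<iota> u) e)\<^sup>2))"
begin

sublocale iota: bounded_linear \<iota> by (rule bounded_linear_iota)

text \<open>The self-adjoint operator "adjoint of \<open>\<iota>\<close> after
  \<open>\<iota>\<close>", obtained directly from Riesz representation in the domain because the
  target space is not assumed complete.\<close>

definition K :: "'h \<Rightarrow> 'h" where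
  "K u = (SOME r. \<forall>\<phi>. inner r \<phi> = inner (\<iota> u) (\<iota> \<phi>))"

lemma inner_K: "inner (K u) \<phi> = inner (\<iota> u) (\<iota> \<phi>)"
proof -
  have "\<exists>r. \<forall>\<phi>. inner r \<phi> = inner (\<iota> u) (\<iota> \<phi>)"
    by (rule riesz_representation)
      (intro bounded_linear_compose[OF bounded_linear_inner_right bounded_linear_iota])
  from someI_ex[OF this] show ?thesis unfolding K_def by auto
qed

lemma bounded_linear_K: "bounded_linear K"
proof -
  obtain B where B: "B \<ge> 0" "\<And>x. norm (\<iota> x) \<le> norm x * B"
    using iota.nonneg_bounded by blast
  show ?thesis
  proof (rule bounded_linear_intro[where K = "B\<^sup>2"])
    show "K (x + y) = K x + K y" for x y
      by (rule inner_eqI) (simp add: inner_add_left inner_K iota.add)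
    show "K (r *\<^sub>R x) = r *\<^sub>R K x" for r x
      by (rule inner_eqI) (simp add: inner_K iota.scaleR)
    show "norm (K x) \<le> norm x * B\<^sup>2" for x
    proof -
      have "norm (K x) * norm (K x) = inner (\<iota> x) (\<iota> (K x))"
        using inner_K[of x "K x"] by (simp add: power2_norm_eq_inner[symmetric] power2_eq_square)
      also have "\<dots> \<le> (norm x * B) * (norm (K x) * B)"
        by (rule order_trans[OF norm_cauchy_schwarz mult_mono]) (use B in auto)
      finally have "norm (K x) * norm (K x) \<le> (norm x * B\<^sup>2) * norm (K x)"
        by (simp add: power2_eq_square mult_ac)
      then show ?thesis by (cases "norm (K x) = 0") (auto simp: mult_le_cancel_right)
    qed
  qed
qed

sublocale K: bounded_linear K by (rule bounded_linear_K)

definition L :: "real \<Rightarrow> 'h \<Rightarrow> 'h" where "L \<kappa> u = u - \<kappa> *\<^sub>R K u"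

lemma bounded_linear_L: "bounded_linear (L \<kappa>)"
  unfolding L_def by (intro bounded_linear_sub bounded_linear_ident bounded_linear_const_scaleR bounded_linear_K)

sublocale L: bounded_linear "L \<kappa>" for \<kappa> by (rule bounded_linear_L)

lemma inner_L: "inner (L \<kappa> u) \<phi> = inner u \<phi> - \<kappa> * inner (\<iota> u) (\<iota> \<phi>)"
  by (simp add: L_def inner_diff_left inner_K)

lemma L_symmetric: "inner (L \<kappa> u) v = inner u (L \<kappa> v)"
  using inner_L[of \<kappa> u v] inner_L[of \<kappa> v u] by (simp add: inner_commute)

text \<open>\<open>L \<kappa>\<close> is proper on bounded sets. For a difference \<open>d\<close>
  of two terms, the squared norm is \<open>inner (L \<kappa> d) d\<close> plus \<kappa> times the
  squared norm of \<open>\<iota> d\<close>; the latter is a small multiple of the squared norm of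
  \<open>d\<close> plus finitely many scalar functionals, and these can be made to converge along a
  subsequence.\<close>

lemma L_convergent_subseq:
  assumes bd: "bounded (range u)" and conv: "convergent (\<lambda>n. L \<kappa> (u n))"
  shows "\<exists>l r. strict_mono (r::nat \<Rightarrow> nat) \<and> (u \<circ> r) \<longlonglongrightarrow> l"
proof -
  obtain B where B: "B > 0" "\<And>n. norm (u n) \<le> B"
    using bd unfolding bounded_pos by auto
  \<comment> \<open>Makes \<open>\<bar>\<kappa>\<bar> * \<epsilon>\<close> at most 1/2, so that this
    share of the squared norm can be absorbed; the summand 1 covers \<kappa> = 0.\<close>
  define \<epsilon> where "\<epsilon> = 1 / (2 * (\<bar>\<kappa>\<bar> + 1))"
  have e0: "\<epsilon> > 0" "\<bar>\<kappa>\<bar> * \<epsilon> \<le> 1 / 2" by (auto simp: \<epsilon>_def field_simps)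
  obtain E where E: "finite E" "\<And>u. (norm (\<iota> u))\<^sup>2 \<le> \<epsilon> * (norm u)\<^sup>2 + (\<Sum>e\<in>E. (inner (\<iota> u) e)\<^sup>2)"
    using almost_finite_rank[OF e0(1)] by blast
  have "bounded (range (\<lambda>n. inner (\<iota> (u n)) e))" for e
  proof -
    have "bounded_linear (\<lambda>x. inner (\<iota> x) e)"
      by (intro bounded_linear_compose[OF bounded_linear_inner_left bounded_linear_iota])
    from bounded_linear_image[OF bd this] show ?thesis by (simp add: image_image)
  qed
  then obtain r :: "nat \<Rightarrow> nat" where r: "strict_mono r"
      and r2: "\<And>e. e \<in> E \<Longrightarrow> convergent ((\<lambda>n. inner (\<iota> (u n)) e) \<circ> r)"
    using bounded_family_convergent_subseq[OF E(1), of "\<lambda>e n. inner (\<iota> (u n)) e"] by blast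
  define a where "a e n = inner (\<iota> (u (r n))) e" for e n
  define l where "l e = lim (a e)" for e
  have al: "a e \<longlonglongrightarrow> l e" if "e \<in> E" for e
    using r2[OF that] unfolding convergent_LIMSEQ_iff l_def a_def comp_def by simp
  define b where "b n = L \<kappa> (u (r n))" for n
  obtain bl where "(\<lambda>n. L \<kappa> (u n)) \<longlonglongrightarrow> bl" using conv convergent_def by blast
  then have bl: "b \<longlonglongrightarrow> bl" unfolding b_def using LIMSEQ_subseq_LIMSEQ[OF _ r] by (fastforce simp: comp_def)
  \<comment> \<open>\<open>h n + h k\<close> will bound the squared distance of the terms
    \<open>n\<close> and \<open>k\<close>. The 4 and the 2 contain the doubling caused by absorbing
    one half; \<open>2 * B\<close> bounds the norm of the difference.\<close>
  define h where "h n = 4 * B * norm (b n - bl) + 2 * \<bar>\<kappa>\<bar> * (\<Sum>e\<in>E. 2 * (a e n - l e)\<^sup>2)" for n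
  have hlim: "h \<longlonglongrightarrow> 0"
  proof -
    have "(\<lambda>n. \<Sum>e\<in>E. 2 * (a e n - l e)\<^sup>2) \<longlonglongrightarrow> (\<Sum>e\<in>E. 2 * (l e - l e)\<^sup>2)"
      by (intro tendsto_intros al)
    moreover have "(\<lambda>n. norm (b n - bl)) \<longlonglongrightarrow> norm (bl - bl)" by (intro tendsto_intros bl)
    ultimately have "h \<longlonglongrightarrow> 4 * B * norm (bl - bl) + 2 * \<bar>\<kappa>\<bar> * (\<Sum>e\<in>E. 2 * (l e - l e)\<^sup>2)"
      unfolding h_def by (rule tendsto_add[OF tendsto_mult_left tendsto_mult_left, rotated])
    then show ?thesis by simp
  qed
  have key: "(norm (u (r n) - u (r k)))\<^sup>2 \<le> h n + h k" for n k
  proof -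
    define d where "d = u (r n) - u (r k)"
    have dB: "norm d \<le> 2 * B" unfolding d_def using norm_triangle_ineq4[of "u (r n)" "u (r k)"] B(2)[of "r n"] B(2)[of "r k"] by linarith
    have Ld: "norm (L \<kappa> d) \<le> norm (b n - bl) + norm (b k - bl)"
      unfolding d_def b_def L.diff using norm_triangle_ineq4[of "L \<kappa> (u (r n)) - bl" "L \<kappa> (u (r k)) - bl"] by simp
    have s: "(\<Sum>e\<in>E. (inner (\<iota> d) e)\<^sup>2) \<le> (\<Sum>e\<in>E. 2 * (a e n - l e)\<^sup>2) + (\<Sum>e\<in>E. 2 * (a e k - l e)\<^sup>2)"
      unfolding sum.distrib[symmetric]
    proof (rule sum_mono)
      fix e
      have "inner (\<iota> d) e = (a e n - l e) - (a e k - l e)"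
        by (simp add: d_def iota.diff inner_diff_left a_def)
      then have "(inner (\<iota> d) e)\<^sup>2 = 2 * (a e n - l e)\<^sup>2 + 2 * (a e k - l e)\<^sup>2 - ((a e n - l e) + (a e k - l e))\<^sup>2"
        by (simp only:) (simp add: power2_eq_square algebra_simps)
      then show "(inner (\<iota> d) e)\<^sup>2 \<le> 2 * (a e n - l e)\<^sup>2 + 2 * (a e k - l e)\<^sup>2" by simp
    qed
    have "(norm d)\<^sup>2 = inner (L \<kappa> d) d + \<kappa> * (norm (\<iota> d))\<^sup>2"
      by (simp add: inner_L power2_norm_eq_inner)
    also have "\<kappa> * (norm (\<iota> d))\<^sup>2 \<le> \<bar>\<kappa>\<bar> * (norm (\<iota> d))\<^sup>2" by (simp add: mult_right_mono)
    also have "\<dots> \<le> \<bar>\<kappa>\<bar> * (\<epsilon> * (norm d)\<^sup>2 + (\<Sum>e\<in>E. (inner (\<iota> d) e)\<^sup>2))"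
      by (intro mult_left_mono E) auto
    also have "\<dots> \<le> (1/2) * (norm d)\<^sup>2 + \<bar>\<kappa>\<bar> * (\<Sum>e\<in>E. (inner (\<iota> d) e)\<^sup>2)"
      using mult_right_mono[OF e0(2), of "(norm d)\<^sup>2"] by (simp add: algebra_simps)
    also have "inner (L \<kappa> d) d \<le> 2 * B * norm (L \<kappa> d)"
      using norm_cauchy_schwarz[of "L \<kappa> d" d] mult_left_mono[OF dB, of "norm (L \<kappa> d)"] by (simp add: mult_ac)
    finally have "(norm d)\<^sup>2 \<le> 4 * B * norm (L \<kappa> d) + 2 * \<bar>\<kappa>\<bar> * (\<Sum>e\<in>E. (inner (\<iota> d) e)\<^sup>2)" by simp
    also have "\<dots> \<le> 4 * B * (norm (b n - bl) + norm (b k - bl)) + 2 * \<bar>\<kappa>\<bar> * ((\<Sum>e\<in>E. 2 * (a e n - l e)\<^sup>2) + (\<Sum>e\<in>E. 2 * (a e k - l e)\<^sup>2))"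
      by (intro add_mono mult_left_mono Ld s) (use B in auto)
    finally show ?thesis unfolding h_def d_def by (simp add: algebra_simps)
  qed
  have "Cauchy (u \<circ> r)"
  proof (rule CauchyI)
    fix e :: real assume e: "0 < e"
    then have "eventually (\<lambda>n. h n < e\<^sup>2 / 2) sequentially"
      using order_tendstoD(2)[OF hlim, of "e\<^sup>2/2"] by simp
    then obtain N where N: "\<And>n. n \<ge> N \<Longrightarrow> h n < e\<^sup>2 / 2" unfolding eventually_sequentially by auto
    have "norm (u (r m) - u (r n)) < e" if "m \<ge> N" "n \<ge> N" for m n
    proof -
      have "(norm (u (r m) - u (r n)))\<^sup>2 < e\<^sup>2" using key[of m n] N[OF that(1)] N[OF that(2)] by argo
      then show ?thesis using e power2_less_imp_less by force
    qed
    then show "\<exists>M. \<forall>m\<ge>M. \<forall>n\<ge>M. norm ((u \<circ> r) m - (u \<circ> r) n) < e" by auto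
  qed
  then show ?thesis using r Cauchy_convergent convergent_def by blast
qed

section \<open>The kernel of \<open>L\<close>, its orthogonal complement, and the inverse of
  \<open>L\<close> there\<close>

definition V :: "real \<Rightarrow> 'h set" where "V \<kappa> = {v. L \<kappa> v = 0}"
definition Vp :: "real \<Rightarrow> 'h set" where "Vp \<kappa> = {w. \<forall>v\<in>V \<kappa>. inner w v = 0}"

lemma V_iff: "v \<in> V \<kappa> \<longleftrightarrow> (\<forall>\<phi>. inner v \<phi> = \<kappa> * inner (\<iota> v) (\<iota> \<phi>))"
proof -
  have "L \<kappa> v = 0 \<longleftrightarrow> (\<forall>\<phi>. inner (L \<kappa> v) \<phi> = inner 0 \<phi>)" using inner_eqI[of "L \<kappa> v" 0] by auto
  then show ?thesis by (simp add: V_def inner_L)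
qed

lemma closed_V: "closed (V \<kappa>)"
  unfolding V_def by (intro closed_Collect_eq L.continuous_on continuous_on_id continuous_on_const)

lemma subspace_V: "subspace (V \<kappa>)"
  unfolding V_def by (auto simp: subspace_def L.add L.scaleR L.zero)

lemma closed_Vp: "closed (Vp \<kappa>)"
proof -
  have "Vp \<kappa> = (\<Inter>v\<in>V \<kappa>. {w. inner w v = 0})" by (auto simp: Vp_def)
  then show ?thesis by (auto intro!: closed_INT closed_Collect_eq continuous_intros)
qed

lemma subspace_Vp: "subspace (Vp \<kappa>)"
  by (auto simp: subspace_def Vp_def inner_add_left)

lemma V_Vp_zero: "x \<in> V \<kappa> \<Longrightarrow> x \<in> Vp \<kappa> \<Longrightarrow> x = 0"
  by (auto simp: Vp_def)

lemma L_in_Vp: "L \<kappa> x \<in> Vp \<kappa>"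
  by (auto simp: Vp_def V_def L_symmetric)

abbreviation PV :: "real \<Rightarrow> 'h \<Rightarrow> 'h" where "PV \<kappa> \<equiv> orth_proj (V \<kappa>)"

lemma PV_in: "PV \<kappa> x \<in> V \<kappa>" by (rule orth_proj_in[OF closed_V subspace_V])
lemma diff_PV_in: "x - PV \<kappa> x \<in> Vp \<kappa>" using orth_proj_orth[OF closed_V subspace_V] by (auto simp: Vp_def)

text \<open>Otherwise some unit vectors of the complement have images tending to 0; by properness a
  subsequence converges, and its limit is a unit vector in both the kernel and its
  complement.\<close>

lemma L_bounded_below: "\<exists>c>0. \<forall>w\<in>Vp \<kappa>. c * norm w \<le> norm (L \<kappa> w)"
proof (rule ccontr)
  assume neg: "\<not> ?thesis"
  have "\<exists>w\<in>Vp \<kappa>. norm (L \<kappa> w) < (1 / real (Suc n)) * norm w" for n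
  proof -
    have "1 / real (Suc n) > 0" by simp
    then show ?thesis using neg by (meson not_le_imp_less)
  qed
  then obtain w where wV: "\<And>n. w n \<in> Vp \<kappa>" and w: "\<And>n. norm (L \<kappa> (w n)) < (1 / real (Suc n)) * norm (w n)" by metis
  have w0: "norm (w n) > 0" for n using w[of n] by (metis L.zero less_irrefl mult_zero_right norm_zero zero_less_norm_iff)
  define x where "x n = (1 / norm (w n)) *\<^sub>R w n" for n
  have x1: "norm (x n) = 1" for n using w0[of n] by (simp add: x_def)
  have xV: "x n \<in> Vp \<kappa>" for n using subspace_Vp wV by (simp add: x_def subspace_scale)
  have Lx: "norm (L \<kappa> (x n)) \<le> 1 / real (Suc n)" for n
    using w[of n] w0[of n] by (simp add: x_def L.scaleR field_simps del: of_nat_Suc)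
  have "(\<lambda>n. L \<kappa> (x n)) \<longlonglongrightarrow> 0"
    by (rule Lim_null_comparison[OF _ LIMSEQ_Suc[OF lim_1_over_n]]) (use Lx in auto)
  moreover have "bounded (range x)" using x1 by (auto simp: bounded_iff)
  ultimately obtain l r where lr: "strict_mono (r::nat \<Rightarrow> nat)" "(x \<circ> r) \<longlonglongrightarrow> l"
    using L_convergent_subseq[of x \<kappa>] convergent_def by blast
  have "(\<lambda>n. L \<kappa> ((x \<circ> r) n)) \<longlonglongrightarrow> L \<kappa> l" by (rule L.tendsto[OF lr(2)])
  moreover have "(\<lambda>n. L \<kappa> ((x \<circ> r) n)) \<longlonglongrightarrow> 0"
    using LIMSEQ_subseq_LIMSEQ[OF \<open>(\<lambda>n. L \<kappa> (x n)) \<longlonglongrightarrow> 0\<close> lr(1)] by (simp add: comp_def)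
  ultimately have "L \<kappa> l = 0" using LIMSEQ_unique by blast
  moreover have "l \<in> Vp \<kappa>" using closed_sequentially[OF closed_Vp _ lr(2)] xV by auto
  ultimately have "l = 0" by (intro V_Vp_zero) (simp add: V_def)
  moreover have "(\<lambda>n. norm ((x \<circ> r) n)) \<longlonglongrightarrow> norm l" by (intro tendsto_intros lr)
  ultimately show False using x1 by (simp add: LIMSEQ_const_iff)
qed

text \<open>The lower bound makes the range closed, so \<open>f\<close> can be projected onto it.
  What remains is orthogonal to the range, hence in the kernel by symmetry of \<open>L\<close>, and
  also in the complement, hence 0.\<close>

lemma L_solvable:
  assumes f: "f \<in> Vp \<kappa>"
  shows "\<exists>w\<in>Vp \<kappa>. L \<kappa> w = f"
proof -
  obtain c where c: "c > 0" "\<And>w. w \<in> Vp \<kappa> \<Longrightarrow> c * norm w \<le> norm (L \<kappa> w)" using L_bounded_below by blast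
  let ?R = "L \<kappa> ` Vp \<kappa>"
  have sub: "subspace ?R" by (rule linear_subspace_image[OF L.linear_axioms subspace_Vp])
  have cl: "closed ?R"
    unfolding closed_sequential_limits
  proof (intro allI impI)
    fix y l assume y: "(\<forall>n. y n \<in> ?R) \<and> y \<longlonglongrightarrow> l"
    then have "\<forall>n. \<exists>w. w \<in> Vp \<kappa> \<and> y n = L \<kappa> w" by (auto simp: image_iff Bex_def)
    from choice[OF this] obtain w where w: "\<And>n. w n \<in> Vp \<kappa>" "\<And>n. y n = L \<kappa> (w n)" by blast
    have "Cauchy y" using y LIMSEQ_imp_Cauchy by blast
    have "Cauchy w"
    proof (rule CauchyI)
      fix e :: real assume "0 < e"
      then have "0 < c * e" using c by simp
      from CauchyD[OF \<open>Cauchy y\<close> this] obtain M where M: "\<And>m n. m \<ge> M \<Longrightarrow> n \<ge> M \<Longrightarrow> norm (y m - y n) < c * e" by blast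
      have "norm (w m - w n) < e" if "m \<ge> M" "n \<ge> M" for m n
      proof -
        have "c * norm (w m - w n) \<le> norm (L \<kappa> (w m - w n))" using c(2) w subspace_Vp by (simp add: subspace_diff)
        also have "\<dots> < c * e" using M[OF that] by (simp add: w(2) L.diff)
        finally show ?thesis using c by simp
      qed
      then show "\<exists>M. \<forall>m\<ge>M. \<forall>n\<ge>M. norm (w m - w n) < e" by blast
    qed
    then obtain x where x: "w \<longlonglongrightarrow> x" using Cauchy_convergent convergent_def by blast
    have "x \<in> Vp \<kappa>" using closed_sequentially[OF closed_Vp _ x] w by blast
    moreover have "y \<longlonglongrightarrow> L \<kappa> x" using L.tendsto[OF x, of \<kappa>] w(2) by presburger
    ultimately show "l \<in> ?R" using y LIMSEQ_unique by blast
  qed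
  define q where "q = orth_proj ?R f"
  have q: "q \<in> ?R" "\<And>y. y \<in> ?R \<Longrightarrow> inner (f - q) y = 0"
    using orth_proj_in[OF cl sub] orth_proj_orth[OF cl sub] by (auto simp: q_def)
  have "inner (L \<kappa> (f - q)) w = inner 0 w" for w
  proof -
    have "L \<kappa> (PV \<kappa> w) = 0" using PV_in[of \<kappa> w] by (simp add: V_def)
    then have "L \<kappa> w = L \<kappa> (w - PV \<kappa> w)" by (simp add: L.diff)
    then have "inner (f - q) (L \<kappa> w) = 0" using q(2) diff_PV_in by simp
    then show ?thesis by (simp add: L_symmetric)
  qed
  then have "f - q \<in> V \<kappa>" using inner_eqI[of "L \<kappa> (f - q)" 0] by (simp add: V_def)
  moreover have "f - q \<in> Vp \<kappa>" using f q(1) L_in_Vp subspace_Vp by (auto intro: subspace_diff)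
  ultimately have "f - q = 0" by (rule V_Vp_zero)
  then have "f = q" by simp
  then show ?thesis using q(1) by auto
qed

text \<open>The inverse of \<open>L \<kappa>\<close> on the complement of the kernel, extended by 0
  on the kernel. It is available also when \<kappa> is an eigenvalue.\<close>

definition A :: "real \<Rightarrow> 'h \<Rightarrow> 'h" where
  "A \<kappa> f = (SOME w. w \<in> Vp \<kappa> \<and> L \<kappa> w = f - PV \<kappa> f)"

lemma A_in: "A \<kappa> f \<in> Vp \<kappa>" and L_A: "L \<kappa> (A \<kappa> f) = f - PV \<kappa> f"
proof -
  have "\<exists>w. w \<in> Vp \<kappa> \<and> L \<kappa> w = f - PV \<kappa> f" using L_solvable[OF diff_PV_in] by blast
  from someI_ex[OF this] show "A \<kappa> f \<in> Vp \<kappa>" "L \<kappa> (A \<kappa> f) = f - PV \<kappa> f" by (auto simp: A_def)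
qed

lemma A_unique: "w \<in> Vp \<kappa> \<Longrightarrow> L \<kappa> w = f - PV \<kappa> f \<Longrightarrow> A \<kappa> f = w"
proof -
  assume w: "w \<in> Vp \<kappa>" "L \<kappa> w = f - PV \<kappa> f"
  have "A \<kappa> f - w \<in> Vp \<kappa>" using w A_in subspace_Vp by (simp add: subspace_diff)
  moreover have "A \<kappa> f - w \<in> V \<kappa>" using w L_A by (simp add: V_def L.diff)
  ultimately have "A \<kappa> f - w = 0" by (rule V_Vp_zero[rotated])
  then show ?thesis by simp
qed

lemma bounded_linear_A: "bounded_linear (A \<kappa>)"
proof -
  obtain c where c: "c > 0" "\<And>w. w \<in> Vp \<kappa> \<Longrightarrow> c * norm w \<le> norm (L \<kappa> w)" using L_bounded_below by blast
  interpret P: bounded_linear "PV \<kappa>" by (rule bounded_linear_orth_proj[OF closed_V subspace_V])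
  show ?thesis
  proof (rule bounded_linear_intro[where K = "2 / c"])
    show "A \<kappa> (x + y) = A \<kappa> x + A \<kappa> y" for x y
      by (rule A_unique) (use A_in subspace_Vp in \<open>auto simp: subspace_add L.add L_A P.add\<close>)
    show "A \<kappa> (r *\<^sub>R x) = r *\<^sub>R A \<kappa> x" for r x
      by (rule A_unique) (use A_in subspace_Vp in \<open>auto simp: subspace_scale L.scaleR L_A P.scaleR algebra_simps\<close>)
    show "norm (A \<kappa> x) \<le> norm x * (2 / c)" for x
    proof -
      have "c * norm (A \<kappa> x) \<le> norm (x - PV \<kappa> x)" using c(2)[OF A_in] by (simp add: L_A)
      also have "\<dots> \<le> 2 * norm x"
        using norm_triangle_ineq4[of x "PV \<kappa> x"] norm_orth_proj_le[OF closed_V subspace_V, of \<kappa> x] by simp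
      finally show ?thesis using c(1) by (simp add: field_simps)
    qed
  qed
qed

lemma norm_V: "v \<in> V \<kappa> \<Longrightarrow> (norm v)\<^sup>2 = \<kappa> * (norm (\<iota> v))\<^sup>2"
  by (simp add: V_iff power2_norm_eq_inner)

definition Sph :: "real \<Rightarrow> 'h set" where "Sph \<kappa> = {v \<in> V \<kappa>. norm (\<iota> v) = 1}"

text \<open>This takes the place of finite dimension of the eigenspace: \<open>L \<kappa>\<close>
  vanishes on the sphere and the norm is constant there, so properness applies to every
  sequence.\<close>

lemma compact_Sph: "compact (Sph \<kappa>)"
  unfolding compact_eq_seq_compact_metric seq_compact_def
proof (intro allI impI)
  fix u :: "nat \<Rightarrow> 'h" assume u: "\<forall>n. u n \<in> Sph \<kappa>"
  have "(norm (u n))\<^sup>2 = \<kappa>" for n using u norm_V[of "u n" \<kappa>] by (simp add: Sph_def)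
  then have "norm (u n) = sqrt \<kappa>" for n by (metis norm_ge_zero real_sqrt_unique)
  then have bd: "bounded (range u)" by (auto simp: bounded_iff)
  have "(\<lambda>n. L \<kappa> (u n)) = (\<lambda>n. 0)" using u by (auto simp: Sph_def V_def)
  then have "convergent (\<lambda>n. L \<kappa> (u n))" by (simp add: convergent_const)
  from L_convergent_subseq[OF bd this] obtain l r where r: "strict_mono (r::nat \<Rightarrow> nat)" "(u \<circ> r) \<longlonglongrightarrow> l" by blast
  have "closed (Sph \<kappa>)"
    unfolding Sph_def Collect_conj_eq Collect_mem_eq
    by (intro closed_Int closed_V closed_Collect_eq continuous_intros iota.continuous_on)
  then have "l \<in> Sph \<kappa>" using closed_sequentially[OF _ _ r(2)] u by auto
  then show "\<exists>l\<in>Sph \<kappa>. \<exists>r. strict_mono r \<and> (u \<circ> r) \<longlonglongrightarrow> l" using r by blast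
qed

lemma Sph_nonempty:
  assumes "v \<in> V \<kappa>" "v \<noteq> 0"
  shows "Sph \<kappa> \<noteq> {}"
proof -
  have "norm (\<iota> v) \<noteq> 0" using norm_V[OF assms(1)] assms(2) by auto
  then have "(1 / norm (\<iota> v)) *\<^sub>R v \<in> Sph \<kappa>"
    using assms(1) subspace_V by (simp add: Sph_def subspace_scale iota.scaleR)
  then show ?thesis by blast
qed

lemma kernel_trivial_bounded_below:
  assumes "V \<kappa> = {0}"
  shows "\<exists>c>0. \<forall>w. c * norm w \<le> norm (L \<kappa> w)"
  using L_bounded_below[of \<kappa>] assms by (auto simp: Vp_def)

end

section \<open>Bounded Lipschitz maps\<close>

text \<open>The bound is part of the notion because a product of Lipschitz maps is Lipschitz only
  where both are bounded; in this form the class is closed under all operations that build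
  \<open>T\<close> and \<open>Z\<close>.\<close>

definition bdd_lipschitz :: "'a::real_normed_vector set \<Rightarrow> ('a \<Rightarrow> 'b::real_normed_vector) \<Rightarrow> bool" where
  "bdd_lipschitz X f \<longleftrightarrow> (\<exists>C\<ge>0. (\<forall>x\<in>X. norm (f x) \<le> C) \<and> (\<forall>x\<in>X. \<forall>y\<in>X. norm (f x - f y) \<le> C * norm (x - y)))"

lemma bdd_lipschitzI:
  assumes "\<And>x. x \<in> X \<Longrightarrow> norm (f x) \<le> C" "\<And>x y. x \<in> X \<Longrightarrow> y \<in> X \<Longrightarrow> norm (f x - f y) \<le> D * norm (x - y)"
  shows "bdd_lipschitz X f"
  unfolding bdd_lipschitz_def
proof (intro exI[of _ "max 0 (max C D)"] conjI ballI)
  fix x y assume "x \<in> X" "y \<in> X"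
  then show "norm (f x - f y) \<le> max 0 (max C D) * norm (x - y)"
    by (intro order_trans[OF assms(2) mult_right_mono]) auto
qed (use assms(1) in \<open>force+\<close>)

lemma bdd_lipschitz_bounded_linear:
  assumes "bounded_linear h" "bounded X"
  shows "bdd_lipschitz X h"
proof -
  interpret h: bounded_linear h by fact
  obtain B where B: "\<And>x. norm (h x) \<le> B * norm x" using h.bounded by (auto simp: mult.commute)
  have "bounded (h ` X)" by (rule bounded_linear_image[OF assms(2,1)])
  then obtain C where "\<And>x. x \<in> X \<Longrightarrow> norm (h x) \<le> C" by (auto simp: bounded_iff)
  then show ?thesis by (intro bdd_lipschitzI[of X h C B]) (auto simp: h.diff[symmetric] B)
qed

lemma bdd_lipschitz_compose:
  assumes "bounded_linear h" "bdd_lipschitz X f"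
  shows "bdd_lipschitz X (\<lambda>x. h (f x))"
proof -
  interpret h: bounded_linear h by fact
  obtain B where B: "B \<ge> 0" "\<And>x. norm (h x) \<le> B * norm x" using h.nonneg_bounded by (auto simp: mult.commute)
  obtain C where C: "C \<ge> 0" "\<And>x. x \<in> X \<Longrightarrow> norm (f x) \<le> C"
    "\<And>x y. x \<in> X \<Longrightarrow> y \<in> X \<Longrightarrow> norm (f x - f y) \<le> C * norm (x - y)"
    using assms(2) unfolding bdd_lipschitz_def by blast
  show ?thesis
  proof (rule bdd_lipschitzI[of _ _ "B * C" "B * C"])
    fix x y assume xy: "x \<in> X" "y \<in> X"
    show "norm (h (f x)) \<le> B * C" using xy by (intro order_trans[OF B(2)] mult_left_mono C B)
    show "norm (h (f x) - h (f y)) \<le> B * C * norm (x - y)"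
      unfolding h.diff[symmetric] mult.assoc using xy by (intro order_trans[OF B(2)] mult_left_mono C B)
  qed
qed

lemma bdd_lipschitz_const: "bdd_lipschitz X (\<lambda>x. c)"
  by (rule bdd_lipschitzI[of _ _ "norm c" 0]) auto

lemma bdd_lipschitz_add:
  assumes "bdd_lipschitz X f" "bdd_lipschitz X g"
  shows "bdd_lipschitz X (\<lambda>x. f x + g x)"
proof -
  obtain C where C: "C \<ge> 0" "\<And>x. x \<in> X \<Longrightarrow> norm (f x) \<le> C"
    "\<And>x y. x \<in> X \<Longrightarrow> y \<in> X \<Longrightarrow> norm (f x - f y) \<le> C * norm (x - y)"
    using assms(1) unfolding bdd_lipschitz_def by blast
  obtain D where D: "D \<ge> 0" "\<And>x. x \<in> X \<Longrightarrow> norm (g x) \<le> D"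
    "\<And>x y. x \<in> X \<Longrightarrow> y \<in> X \<Longrightarrow> norm (g x - g y) \<le> D * norm (x - y)"
    using assms(2) unfolding bdd_lipschitz_def by blast
  show ?thesis
  proof (rule bdd_lipschitzI[of _ _ "C + D" "C + D"])
    fix x y assume xy: "x \<in> X" "y \<in> X"
    show "norm (f x + g x) \<le> C + D" using xy by (intro norm_triangle_mono C D)
    show "norm (f x + g x - (f y + g y)) \<le> (C + D) * norm (x - y)"
      unfolding add_diff_add distrib_right using xy by (intro norm_triangle_mono C D)
  qed
qed

lemma bdd_lipschitz_minus: "bdd_lipschitz X f \<Longrightarrow> bdd_lipschitz X (\<lambda>x. - f x)"
  by (rule bdd_lipschitz_compose[OF bounded_linear_minus[OF bounded_linear_ident]])

lemma bdd_lipschitz_diff: "bdd_lipschitz X f \<Longrightarrow> bdd_lipschitz X g \<Longrightarrow> bdd_lipschitz X (\<lambda>x. f x - g x)"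
  using bdd_lipschitz_add[OF _ bdd_lipschitz_minus, of X f g] by simp

lemma bdd_lipschitz_sum:
  assumes "\<And>i. i \<in> I \<Longrightarrow> bdd_lipschitz X (f i)"
  shows "bdd_lipschitz X (\<lambda>x. \<Sum>i\<in>I. f i x)"
  using assms by (induction I rule: infinite_finite_induct) (auto intro: bdd_lipschitz_const bdd_lipschitz_add)

lemma bdd_lipschitz_bilinear:
  assumes "bounded_bilinear h" "bdd_lipschitz X f" "bdd_lipschitz X g"
  shows "bdd_lipschitz X (\<lambda>x. h (f x) (g x))"
proof -
  interpret h: bounded_bilinear h by fact
  obtain B where B: "B \<ge> 0" "\<And>x y. norm (h x y) \<le> norm x * norm y * B" using h.nonneg_bounded by blast
  obtain C where C: "C \<ge> 0" "\<And>x. x \<in> X \<Longrightarrow> norm (f x) \<le> C"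
    "\<And>x y. x \<in> X \<Longrightarrow> y \<in> X \<Longrightarrow> norm (f x - f y) \<le> C * norm (x - y)"
    using assms(2) unfolding bdd_lipschitz_def by blast
  obtain D where D: "D \<ge> 0" "\<And>x. x \<in> X \<Longrightarrow> norm (g x) \<le> D"
    "\<And>x y. x \<in> X \<Longrightarrow> y \<in> X \<Longrightarrow> norm (g x - g y) \<le> D * norm (x - y)"
    using assms(3) unfolding bdd_lipschitz_def by blast
  show ?thesis
  proof (rule bdd_lipschitzI[of _ _ "C * D * B" "2 * (C * D * B)"])
    fix x y assume xy: "x \<in> X" "y \<in> X"
    show "norm (h (f x) (g x)) \<le> C * D * B"
      using xy by (intro order_trans[OF B(2)] mult_right_mono mult_mono C D B) auto
    have "h (f x) (g x) - h (f y) (g y) = h (f x - f y) (g x) + h (f y) (g x - g y)"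
      by (simp add: h.diff_left h.diff_right)
    moreover have "norm (h (f x - f y) (g x)) \<le> (C * norm (x - y)) * D * B"
      using xy by (intro order_trans[OF B(2)] mult_right_mono mult_mono C D B) (auto simp: C)
    moreover have "norm (h (f y) (g x - g y)) \<le> C * (D * norm (x - y)) * B"
      using xy by (intro order_trans[OF B(2)] mult_right_mono mult_mono C D B) (auto simp: C D)
    ultimately show "norm (h (f x) (g x) - h (f y) (g y)) \<le> 2 * (C * D * B) * norm (x - y)"
      using norm_triangle_ineq[of "h (f x - f y) (g x)" "h (f y) (g x - g y)"] by (simp add: algebra_simps)
  qed
qed

text \<open>On arguments from 1 upwards \<open>1 / sqrt\<close> has Lipschitz constant 1. The
  normalising factors \<open>\<rho>\<close> have such arguments.\<close>

lemma bdd_lipschitz_rsqrt: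
  fixes f :: "'a::real_normed_vector \<Rightarrow> real"
  assumes "bdd_lipschitz X f" "\<And>x. x \<in> X \<Longrightarrow> 1 \<le> f x"
  shows "bdd_lipschitz X (\<lambda>x. 1 / sqrt (f x))"
proof -
  have *: "\<bar>1 / sqrt a - 1 / sqrt b\<bar> \<le> \<bar>a - b\<bar>" if "1 \<le> a" "1 \<le> b" for a b :: real
  proof -
    have s: "1 \<le> sqrt a" "1 \<le> sqrt b" using that by auto
    have "\<bar>1 / sqrt a - 1 / sqrt b\<bar> = \<bar>sqrt b - sqrt a\<bar> / (sqrt a * sqrt b)"
      using that s by (simp add: diff_divide_eq_iff divide_diff_eq_iff field_simps abs_mult)
    also have "\<dots> \<le> \<bar>sqrt b - sqrt a\<bar> / 1"
      using s mult_mono[OF s] by (intro divide_left_mono) (auto intro!: mult_pos_pos simp del: real_sqrt_mult_self)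
    also have "\<dots> \<le> \<bar>sqrt b - sqrt a\<bar> * (sqrt b + sqrt a)"
      using mult_left_mono[of 1 "sqrt b + sqrt a" "\<bar>sqrt b - sqrt a\<bar>"] s by simp
    also have "\<dots> = \<bar>(sqrt b - sqrt a) * (sqrt b + sqrt a)\<bar>" using s by (simp add: abs_mult)
    also have "(sqrt b - sqrt a) * (sqrt b + sqrt a) = b - a" using that by (simp add: algebra_simps)
    finally show ?thesis by (simp add: abs_minus_commute)
  qed
  obtain C where C: "C \<ge> 0" "\<And>x. x \<in> X \<Longrightarrow> norm (f x) \<le> C"
    "\<And>x y. x \<in> X \<Longrightarrow> y \<in> X \<Longrightarrow> norm (f x - f y) \<le> C * norm (x - y)"
    using assms(1) unfolding bdd_lipschitz_def by blast
  show ?thesis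
  proof (rule bdd_lipschitzI[of _ _ 1 C])
    fix x y assume xy: "x \<in> X" "y \<in> X"
    show "norm (1 / sqrt (f x)) \<le> 1" using assms(2)[OF xy(1)] by simp
    show "norm (1 / sqrt (f x) - 1 / sqrt (f y)) \<le> C * norm (x - y)"
      using *[OF assms(2)[OF xy(1)] assms(2)[OF xy(2)]] C(3)[OF xy] by simp
  qed
qed

lemma norm_vec_le_sum: "norm (x :: 'b::real_normed_vector ^ 'm) \<le> (\<Sum>i\<in>UNIV. norm (x $ i))"
  unfolding norm_vec_def by (rule L2_set_le_sum) simp

lemma bdd_lipschitz_vec:
  fixes f :: "'a::real_normed_vector \<Rightarrow> 'b::real_normed_vector ^ 'm"
  assumes "\<And>i. bdd_lipschitz X (\<lambda>x. f x $ i)"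
  shows "bdd_lipschitz X f"
proof -
  have "\<forall>i. \<exists>C. C \<ge> 0 \<and> (\<forall>x\<in>X. norm (f x $ i) \<le> C) \<and> (\<forall>x\<in>X. \<forall>y\<in>X. norm (f x $ i - f y $ i) \<le> C * norm (x - y))"
    using assms unfolding bdd_lipschitz_def by auto
  from choice[OF this] obtain C where C: "\<And>i x. x \<in> X \<Longrightarrow> norm (f x $ i) \<le> C i"
     "\<And>i x y. x \<in> X \<Longrightarrow> y \<in> X \<Longrightarrow> norm (f x $ i - f y $ i) \<le> C i * norm (x - y)" by blast
  show ?thesis
  proof (rule bdd_lipschitzI[of _ _ "\<Sum>i\<in>UNIV. C i" "\<Sum>i\<in>UNIV. C i"])
    fix x y assume xy: "x \<in> X" "y \<in> X"
    show "norm (f x) \<le> (\<Sum>i\<in>UNIV. C i)"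
      by (rule order_trans[OF norm_vec_le_sum sum_mono]) (use C xy in auto)
    show "norm (f x - f y) \<le> (\<Sum>i\<in>UNIV. C i) * norm (x - y)"
      unfolding sum_distrib_right by (rule order_trans[OF norm_vec_le_sum sum_mono]) (use C xy in auto)
  qed
qed

text \<open>Tychonoff's theorem concerns the function type; the continuous map from functions to
  vectors transports it.\<close>

lemma compact_vec_components:
  fixes S :: "'m::finite \<Rightarrow> 'b::real_normed_vector set"
  assumes "\<And>i. compact (S i)"
  shows "compact {v :: 'b ^ 'm. \<forall>i. v $ i \<in> S i}"
proof -
  have "compactin (product_topology (\<lambda>i. euclidean) UNIV) (PiE UNIV S)"
    using assms by (simp add: compactin_PiE)
  then have "compact (PiE UNIV S)" by (simp add: euclidean_product_topology)
  moreover have "continuous_on (PiE UNIV S) (\<lambda>f. \<chi> i. f i)"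
    by (intro continuous_on_vec_lambda continuous_on_subset[OF continuous_on_product_coordinates]) auto
  ultimately have "compact ((\<lambda>f. \<chi> i. f i) ` PiE UNIV S)" using compact_continuous_image by blast
  also have "(\<lambda>f. \<chi> i. f i) ` PiE UNIV S = {v :: 'b ^ 'm. \<forall>i. v $ i \<in> S i}"
  proof (intro set_eqI iffI)
    fix v :: "'b ^ 'm" assume "v \<in> {v. \<forall>i. v $ i \<in> S i}"
    then have "v = (\<chi> i. (\<lambda>i. v $ i) i)" "(\<lambda>i. v $ i) \<in> PiE UNIV S" by (auto simp: vec_eq_iff)
    then show "v \<in> (\<lambda>f. \<chi> i. f i) ` PiE UNIV S" by blast
  qed auto
  finally show ?thesis .
qed

section \<open>Bifurcation for a quartic perturbation of a quadratic form\<close>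

text \<open>\<open>p a b\<close> models the product of two H1 functions as an element of L2, so that
  \<open>inner (p a a) (p b b)\<close> models the integral of the product of their squares.\<close>

locale quartic_form = compact_map \<iota>
  for \<iota> :: "'h::{real_inner,complete_space} \<Rightarrow> 'l::real_inner" +
  fixes p :: "'h \<Rightarrow> 'h \<Rightarrow> 'l"
  assumes bounded_bilinear_p: "bounded_bilinear p"
    and p_commute: "p a b = p b a"
begin

sublocale p: bounded_bilinear p by (rule bounded_bilinear_p)

text \<open>The adjoint of \<open>p c\<close> applied to \<open>g\<close>. With
  \<open>g = p a a\<close> it represents the cubic term a^2 c as a vector of the Hilbert
  space.\<close>

definition pstar :: "'l \<Rightarrow> 'h \<Rightarrow> 'h" where
  "pstar g c = (SOME r. \<forall>\<phi>. inner r \<phi> = inner g (p c \<phi>))"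

lemma inner_pstar: "inner (pstar g c) \<phi> = inner g (p c \<phi>)"
proof -
  have "\<exists>r. \<forall>\<phi>. inner r \<phi> = inner g (p c \<phi>)"
    by (rule riesz_representation)
      (intro bounded_linear_compose[OF bounded_linear_inner_right p.bounded_linear_right])
  from someI_ex[OF this] show ?thesis unfolding pstar_def by auto
qed

lemma bounded_bilinear_pstar: "bounded_bilinear pstar"
proof
  show "pstar (a + a') b = pstar a b + pstar a' b" for a a' b
    by (rule inner_eqI) (simp add: inner_add_left inner_pstar)
  show "pstar a (b + b') = pstar a b + pstar a b'" for a b b'
    by (rule inner_eqI) (simp add: inner_add_left inner_add_right inner_pstar p.add_left)
  show "pstar (r *\<^sub>R a) b = r *\<^sub>R pstar a b" for r a b
    by (rule inner_eqI) (simp add: inner_pstar)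
  show "pstar a (r *\<^sub>R b) = r *\<^sub>R pstar a b" for r a b
    by (rule inner_eqI) (simp add: inner_pstar p.scaleR_left)
  obtain B where B: "B \<ge> 0" "\<And>x y. norm (p x y) \<le> norm x * norm y * B" using p.nonneg_bounded by blast
  have "norm (pstar a b) \<le> norm a * norm b * B" for a b
  proof -
    have "norm (pstar a b) * norm (pstar a b) = inner a (p b (pstar a b))"
      by (simp add: inner_pstar[symmetric] power2_norm_eq_inner[symmetric] power2_eq_square)
    also have "\<dots> \<le> norm a * (norm b * norm (pstar a b) * B)"
      by (rule order_trans[OF norm_cauchy_schwarz mult_left_mono]) (use B in auto)
    finally have "norm (pstar a b) * norm (pstar a b) \<le> (norm a * norm b * B) * norm (pstar a b)"
      by (simp add: mult_ac)
    then show ?thesis by (cases "norm (pstar a b) = 0") (use B in \<open>auto simp: mult_le_cancel_right\<close>)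
  qed
  then show "\<exists>K. \<forall>a b. norm (pstar a b) \<le> norm a * norm b * K" by blast
qed

sublocale ps: bounded_bilinear pstar by (rule bounded_bilinear_pstar)

definition solution :: "('m::finite \<Rightarrow> 'm \<Rightarrow> real) \<Rightarrow> ('m \<Rightarrow> real) \<Rightarrow> ('m \<Rightarrow> 'h) \<Rightarrow> bool" where
  "solution \<beta> \<tau> U \<longleftrightarrow> (\<forall>i \<phi>. inner (U i) \<phi> - \<tau> i * inner (\<iota> (U i)) (\<iota> \<phi>) =
      (\<Sum>k\<in>UNIV. \<beta> k i * inner (p (U k) (U k)) (p (U i) \<phi>)))"

text \<open>Each term on the right of the equation for \<open>L \<kappa> (U i)\<close> carries a
  factor \<open>U i\<close> and a small factor, either \<open>\<tau> i - \<kappa>\<close> or the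
  square of some \<open>U k\<close>. Its size is therefore below the lower bound
  \<open>c * norm (U i)\<close> unless \<open>U i\<close> is 0.\<close>

lemma no_small_solution:
  fixes \<beta> :: "'m::finite \<Rightarrow> 'm \<Rightarrow> real"
  assumes "V \<kappa> = {0}"
  shows "\<exists>\<delta>>0. \<forall>U \<tau> i. solution \<beta> \<tau> U \<longrightarrow> \<bar>\<tau> i - \<kappa>\<bar> < \<delta> \<longrightarrow> (\<forall>k. norm (U k) < \<delta>) \<longrightarrow> U i = 0"
proof -
  obtain c where c: "c > 0" "\<And>w. c * norm w \<le> norm (L \<kappa> w)" using kernel_trivial_bounded_below[OF assms] by blast
  obtain B where B: "B \<ge> 0" "\<And>x y. norm (pstar x y) \<le> norm x * norm y * B" using ps.nonneg_bounded by blast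
  obtain D where D: "D \<ge> 0" "\<And>x y. norm (p x y) \<le> norm x * norm y * D" using p.nonneg_bounded by blast
  obtain E where E: "E \<ge> 0" "\<And>x. norm (K x) \<le> norm x * E" using K.nonneg_bounded by blast
  define S where "S = E + (\<Sum>i\<in>UNIV. \<Sum>k\<in>UNIV. \<bar>\<beta> k i\<bar>) * D * B"
  have S0: "S \<ge> 0" unfolding S_def using B D E by (intro add_nonneg_nonneg mult_nonneg_nonneg sum_nonneg) auto
  \<comment> \<open>The cap 1 lets the product of two norms below \<delta> be estimated by \<delta>;
    the other entry makes \<open>\<delta> * S\<close> smaller than \<open>c\<close>.\<close>
  define \<delta> where "\<delta> = min 1 (c / (S + 1))"
  have \<delta>: "\<delta> > 0" "\<delta> \<le> 1" "\<delta> * S < c"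
  proof -
    show "\<delta> > 0" "\<delta> \<le> 1" using c S0 by (auto simp: \<delta>_def)
    have "\<delta> * S \<le> c / (S + 1) * S" using S0 by (intro mult_right_mono) (auto simp: \<delta>_def)
    also have "\<dots> < c" using S0 c by (simp add: field_simps)
    finally show "\<delta> * S < c" .
  qed
  have "U i = 0" if sol: "solution \<beta> \<tau> U" and t: "\<bar>\<tau> i - \<kappa>\<bar> < \<delta>" and U: "\<And>k. norm (U k) < \<delta>" for U \<tau> i
  proof (rule ccontr)
    assume "U i \<noteq> 0"
    then have n0: "norm (U i) > 0" by simp
    have "inner (L \<kappa> (U i)) \<phi> = inner ((\<tau> i - \<kappa>) *\<^sub>R K (U i) + (\<Sum>k\<in>UNIV. \<beta> k i *\<^sub>R pstar (p (U k) (U k)) (U i))) \<phi>" for \<phi>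
      using sol[unfolded solution_def, rule_format, of i \<phi>]
      by (simp add: inner_L inner_add_left inner_K inner_sum_left inner_pstar algebra_simps)
    then have eq: "L \<kappa> (U i) = (\<tau> i - \<kappa>) *\<^sub>R K (U i) + (\<Sum>k\<in>UNIV. \<beta> k i *\<^sub>R pstar (p (U k) (U k)) (U i))"
      by (rule inner_eqI)
    have a: "norm ((\<tau> i - \<kappa>) *\<^sub>R K (U i)) \<le> \<delta> * (norm (U i) * E)"
      using t E by (simp add: mult_mono)
    have b: "norm (\<beta> k i *\<^sub>R pstar (p (U k) (U k)) (U i)) \<le> \<bar>\<beta> k i\<bar> * (\<delta> * (D * (norm (U i) * B)))" for k
    proof -
      have "norm (U k) * norm (U k) \<le> \<delta> * 1" using U[of k] \<delta> by (intro mult_mono) auto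
      then have "norm (p (U k) (U k)) \<le> \<delta> * D" using D(2)[of "U k" "U k"] mult_right_mono[OF _ D(1)] by fastforce
      then have "norm (pstar (p (U k) (U k)) (U i)) \<le> (\<delta> * D) * norm (U i) * B"
        by (intro order_trans[OF B(2)] mult_right_mono B) auto
      from mult_left_mono[OF this, of "\<bar>\<beta> k i\<bar>"] show ?thesis by (simp add: mult_ac)
    qed
    have "c * norm (U i) \<le> norm (L \<kappa> (U i))" by (rule c)
    also have "\<dots> \<le> \<delta> * (norm (U i) * E) + (\<Sum>k\<in>UNIV. \<bar>\<beta> k i\<bar> * (\<delta> * (D * (norm (U i) * B))))"
      unfolding eq by (intro norm_triangle_mono a sum_norm_le b)
    also have "\<dots> = \<delta> * norm (U i) * (E + (\<Sum>k\<in>UNIV. \<bar>\<beta> k i\<bar>) * D * B)"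
      by (simp add: sum_distrib_right sum_distrib_left algebra_simps)
    also have "\<dots> \<le> \<delta> * norm (U i) * S"
    proof (rule mult_left_mono)
      have "(\<Sum>k\<in>UNIV. \<bar>\<beta> k i\<bar>) \<le> (\<Sum>i\<in>UNIV. \<Sum>k\<in>UNIV. \<bar>\<beta> k i\<bar>)"
        by (rule member_le_sum[of i UNIV "\<lambda>i. \<Sum>k\<in>UNIV. \<bar>\<beta> k i\<bar>"]) (auto intro: sum_nonneg)
      then show "E + (\<Sum>k\<in>UNIV. \<bar>\<beta> k i\<bar>) * D * B \<le> S" unfolding S_def using B D by (simp add: mult_right_mono)
    qed (use \<delta> in auto)
    also have "\<dots> < c * norm (U i)" using \<delta>(3) n0 by (simp add: mult.commute mult.left_commute)
    finally show False by simp
  qed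
  then show ?thesis using \<delta>(1) by blast
qed

end

text \<open>A chain rule for curves that are only Lipschitz: the remainder of \<open>f\<close> is
  small relative to the increment of \<open>y\<close>, hence relative to \<open>t\<close>, so it is
  enough that the linear part has a limit. The curve itself need not be differentiable at
  \<open>t0\<close>.\<close>

lemma derivative_along_lipschitz_curve:
  fixes f :: "'a::real_normed_vector \<Rightarrow> real" and y :: "real \<Rightarrow> 'a"
  assumes f: "(f has_derivative D) (at (y t0))" and y: "\<And>t. norm (y t - y t0) \<le> H * \<bar>t - t0\<bar>"
    and lim: "((\<lambda>t. D (y (t0 + t) - y t0) / t) \<longlongrightarrow> a) (at 0)"
  shows "DERIV (\<lambda>t. f (y t)) t0 :> a"
proof -
  have "((\<lambda>t. (f (y (t0 + t)) - f (y t0)) / t - D (y (t0 + t) - y t0) / t) \<longlongrightarrow> 0) (at 0)"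
  proof (rule LIM_I)
    fix r :: real assume r: "0 < r"
    have H: "0 \<le> H" using order_trans[OF norm_ge_zero y[of "t0 + 1"]] by simp
    have "0 < r / (H + 1)" using r H by simp
    with f obtain d where d: "d > 0"
      "\<And>z. norm (z - y t0) < d \<Longrightarrow> norm (f z - f (y t0) - D (z - y t0)) \<le> r / (H + 1) * norm (z - y t0)"
      unfolding has_derivative_at_alt by blast
    show "\<exists>s>0. \<forall>t. t \<noteq> 0 \<and> norm (t - 0) < s \<longrightarrow>
        norm ((f (y (t0 + t)) - f (y t0)) / t - D (y (t0 + t) - y t0) / t - 0) < r"
    proof (intro exI[of _ "d / (H + 1)"] conjI allI impI)
      show "0 < d / (H + 1)" using d H by simp
      fix t :: real assume t: "t \<noteq> 0 \<and> norm (t - 0) < d / (H + 1)"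
      have yt: "norm (y (t0 + t) - y t0) \<le> H * \<bar>t\<bar>" using y[of "t0 + t"] by simp
      also have "\<dots> \<le> (H + 1) * \<bar>t\<bar>" by (simp add: algebra_simps)
      also have "\<dots> < d" using t H by (simp add: field_simps)
      finally have "norm (f (y (t0 + t)) - f (y t0) - D (y (t0 + t) - y t0)) \<le> r / (H + 1) * norm (y (t0 + t) - y t0)"
        by (rule d)
      also have "\<dots> \<le> r / (H + 1) * (H * \<bar>t\<bar>)" using r H yt by (intro mult_left_mono) auto
      also have "\<dots> < r * \<bar>t\<bar>" using r H t by (simp add: field_simps)
      finally have "\<bar>f (y (t0 + t)) - f (y t0) - D (y (t0 + t) - y t0)\<bar> / \<bar>t\<bar> < r" using t by (simp add: field_simps)
      then show "norm ((f (y (t0 + t)) - f (y t0)) / t - D (y (t0 + t) - y t0) / t - 0) < r"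
        by (simp add: diff_divide_distrib[symmetric] abs_divide)
    qed
  qed
  from Lim_transform[OF lim this] show ?thesis by (simp add: DERIV_def)
qed

section \<open>Reduction to the product of eigenspace spheres, with prescribed component
  norms\<close>

locale bifurcation_problem = quartic_form \<iota> p
  for \<iota> :: "'h::{real_inner,complete_space} \<Rightarrow> 'l::real_inner" and p :: "'h \<Rightarrow> 'h \<Rightarrow> 'l" +
  fixes \<beta> :: "'m::finite \<Rightarrow> 'm \<Rightarrow> real" and \<kappa> :: "'m \<Rightarrow> real"
  assumes \<beta>_sym: "\<beta> i j = \<beta> j i"
    and Sph_ne: "Sph (\<kappa> i) \<noteq> {}"
begin

text \<open>
  The unknowns are pairs \<open>x = (v, w)\<close>, where \<open>v\<close> lies in the product of the unit spheres of the
  kernels and \<open>w\<close> is the correction in the orthogonal complements. The vector \<open>\<epsilon> \<rho>\<^sub>i (v\<^sub>i + w\<^sub>i)\<close>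
  has image of norm \<open>\<epsilon>\<close> under \<open>\<iota>\<close>.
\<close>

definition M :: "('h ^ 'm) set" where "M = {v. \<forall>i. v $ i \<in> Sph (\<kappa> i)}"
definition W :: "('h ^ 'm) set" where "W = {w. \<forall>i. norm (w $ i) \<le> 1}"

definition z :: "('h ^ 'm) \<times> ('h ^ 'm) \<Rightarrow> 'm \<Rightarrow> 'h" where "z x i = fst x $ i + snd x $ i"
definition \<rho> :: "('h ^ 'm) \<times> ('h ^ 'm) \<Rightarrow> 'm \<Rightarrow> real" where
  "\<rho> x i = 1 / sqrt (1 + inner (\<iota> (snd x $ i)) (\<iota> (snd x $ i)))"
text \<open>The cubic term with \<epsilon> cubed and the outer \<open>\<rho> x i\<close> divided
  out. The linear part has the factor \<open>\<epsilon> * \<rho> x i\<close>, so \<epsilon> squared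
  is left in front of \<open>N\<close>.\<close>

definition N :: "('h ^ 'm) \<times> ('h ^ 'm) \<Rightarrow> 'm \<Rightarrow> 'h" where
  "N x i = (\<Sum>k\<in>UNIV. (\<beta> k i * (\<rho> x k * \<rho> x k)) *\<^sub>R pstar (p (z x k) (z x k)) (z x i))"
text \<open>The negative shift of the i-th eigenvalue parameter, in units of \<epsilon> squared,
  read off by testing the equation with the kernel vector \<open>fst x $ i\<close>.\<close>

definition s :: "('h ^ 'm) \<times> ('h ^ 'm) \<Rightarrow> 'm \<Rightarrow> real" where "s x i = inner (N x i) (fst x $ i)"
text \<open>With e for \<epsilon> squared, \<open>w = e *\<^sub>R T (v, w)\<close> is the part
  orthogonal to the kernels of the equation z - e N = (\<kappa> - e s) K z. The term with
  \<open>K (v $ i)\<close> lies in the kernel and is invisible to \<open>A\<close>, so only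
  \<open>K (snd x $ i)\<close> appears.\<close>

definition T :: "('h ^ 'm) \<times> ('h ^ 'm) \<Rightarrow> 'h ^ 'm" where
  "T x = (\<chi> i. A (\<kappa> i) (N x i - s x i *\<^sub>R K (snd x $ i)))"
definition Z :: "('h ^ 'm) \<times> ('h ^ 'm) \<Rightarrow> 'h ^ 'm" where "Z x = (\<chi> i. \<rho> x i *\<^sub>R z x i)"

lemma compact_M: "compact M"
  unfolding M_def by (intro compact_vec_components compact_Sph)

lemma M_ne: "M \<noteq> {}"
proof -
  have "(\<chi> i. SOME v. v \<in> Sph (\<kappa> i)) \<in> M" using Sph_ne by (simp add: M_def some_in_eq)
  then show ?thesis by blast
qed

lemma bounded_domain: "bounded (M \<times> W)"
proof (rule bounded_Times[OF compact_imp_bounded[OF compact_M]])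
  have "norm w \<le> real CARD('m)" if "w \<in> W" for w
    using norm_vec_le_sum[of w] sum_bounded_above[of UNIV "\<lambda>i. norm (w $ i)" 1] that by (simp add: W_def)
  then show "bounded W" unfolding bounded_iff by blast
qed

lemma bdd_lipschitz_parts:
  "bdd_lipschitz (M \<times> W) (\<lambda>x. fst x $ i)" "bdd_lipschitz (M \<times> W) (\<lambda>x. snd x $ i)"
  by (intro bdd_lipschitz_bounded_linear[OF _ bounded_domain]
      bounded_linear_compose[OF bounded_linear_vec_nth] bounded_linear_fst bounded_linear_snd)+

lemma bdd_lipschitz_z: "bdd_lipschitz (M \<times> W) (\<lambda>x. z x i)"
  unfolding z_def by (intro bdd_lipschitz_add bdd_lipschitz_parts)

lemma bdd_lipschitz_\<rho>: "bdd_lipschitz (M \<times> W) (\<lambda>x. \<rho> x i)"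
  unfolding \<rho>_def
  by (intro bdd_lipschitz_rsqrt bdd_lipschitz_add bdd_lipschitz_const bdd_lipschitz_bilinear[OF bounded_bilinear_inner]
      bdd_lipschitz_compose[OF bounded_linear_iota] bdd_lipschitz_parts) simp

lemma bdd_lipschitz_N: "bdd_lipschitz (M \<times> W) (\<lambda>x. N x i)"
  unfolding N_def
  by (intro bdd_lipschitz_sum bdd_lipschitz_bilinear[OF bounded_bilinear_scaleR] bdd_lipschitz_bilinear[OF bounded_bilinear_mult]
      bdd_lipschitz_const bdd_lipschitz_\<rho> bdd_lipschitz_bilinear[OF bounded_bilinear_pstar]
      bdd_lipschitz_bilinear[OF bounded_bilinear_p] bdd_lipschitz_z)

lemma bdd_lipschitz_s: "bdd_lipschitz (M \<times> W) (\<lambda>x. s x i)"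
  unfolding s_def
  by (intro bdd_lipschitz_bilinear[OF bounded_bilinear_inner] bdd_lipschitz_N bdd_lipschitz_parts)

lemma bdd_lipschitz_T: "bdd_lipschitz (M \<times> W) T"
  unfolding T_def
  by (rule bdd_lipschitz_vec, simp only: vec_lambda_beta)
     (intro bdd_lipschitz_compose[OF bounded_linear_A] bdd_lipschitz_diff bdd_lipschitz_N
      bdd_lipschitz_bilinear[OF bounded_bilinear_scaleR] bdd_lipschitz_s bdd_lipschitz_compose[OF bounded_linear_K]
      bdd_lipschitz_parts)

lemma bdd_lipschitz_Z: "bdd_lipschitz (M \<times> W) Z"
  unfolding Z_def
  by (rule bdd_lipschitz_vec, simp only: vec_lambda_beta)
     (intro bdd_lipschitz_bilinear[OF bounded_bilinear_scaleR] bdd_lipschitz_\<rho> bdd_lipschitz_z)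

lemma complete_W: "complete W"
proof -
  have "W = (\<Inter>i. {w. norm (w $ i) \<le> 1})" by (auto simp: W_def)
  moreover have "closed (\<Inter>i. {w :: 'h ^ 'm. norm (w $ i) \<le> 1})"
    by (auto intro!: closed_INT closed_Collect_le continuous_intros)
  ultimately show ?thesis by (simp add: complete_eq_closed)
qed

text \<open>\<open>e * C \<le> 1 / 2\<close> gives at once that \<open>W\<close> is mapped into
  itself and that the map contracts. \<open>W\<close> contains no orthogonality condition; a fixed
  point satisfies it because \<open>A\<close> takes values in the complement.\<close>

lemma fixed_point:
  assumes C: "C \<ge> 0" "\<And>x. x \<in> M \<times> W \<Longrightarrow> norm (T x) \<le> C"
      "\<And>x y. x \<in> M \<times> W \<Longrightarrow> y \<in> M \<times> W \<Longrightarrow> norm (T x - T y) \<le> C * norm (x - y)"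
    and e: "e \<ge> 0" "e * C \<le> 1 / 2" and v: "v \<in> M"
  shows "\<exists>w\<in>W. e *\<^sub>R T (v, w) = w"
proof -
  have "\<exists>!w\<in>W. e *\<^sub>R T (v, w) = w"
  proof (rule Banach_fix[OF complete_W, where c = "1/2"])
    have "0 \<in> W" by (simp add: W_def) then show "W \<noteq> {}" by blast
    have "norm (e *\<^sub>R T (v, w)) \<le> 1 / 2" if "w \<in> W" for w
      using mult_left_mono[OF C(2)[of "(v, w)"] e(1)] v that e by simp
    then have "norm ((e *\<^sub>R T (v, w)) $ i) \<le> 1" if "w \<in> W" for w i
      using Finite_Cartesian_Product.norm_nth_le[of "e *\<^sub>R T (v, w)" i] that by fastforce
    then show "(\<lambda>w. e *\<^sub>R T (v, w)) ` W \<subseteq> W" unfolding W_def by blast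
    show "dist (e *\<^sub>R T (v, w)) (e *\<^sub>R T (v, w')) \<le> 1 / 2 * dist w w'" if "w \<in> W" "w' \<in> W" for w w'
    proof -
      have "norm (T (v, w) - T (v, w')) \<le> C * norm (w - w')"
        using C(3)[of "(v, w)" "(v, w')"] v that by (simp add: norm_Pair)
      from mult_left_mono[OF this e(1)] have "dist (e *\<^sub>R T (v, w)) (e *\<^sub>R T (v, w')) \<le> (e * C) * norm (w - w')"
        using e(1) by (simp add: dist_norm scaleR_diff_right[symmetric])
      also have "\<dots> \<le> 1 / 2 * dist w w'" using e mult_right_mono[OF e(2), of "norm (w - w')"] by (simp add: dist_norm)
      finally show ?thesis .
    qed
  qed auto
  then show ?thesis by blast
qed

text \<open>The energy without the eigenvalue terms: these depend only on the norms of the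
  \<open>\<iota> (U $ i)\<close>, which are constant along the family considered. The denominators 2
  and 4 are the degrees of homogeneity.\<close>

definition J :: "'h ^ 'm \<Rightarrow> real" where
  "J U = (\<Sum>i\<in>UNIV. inner (U $ i) (U $ i)) / 2
     - (\<Sum>i\<in>UNIV. \<Sum>j\<in>UNIV. \<beta> j i * inner (p (U $ j) (U $ j)) (p (U $ i) (U $ i))) / 4"

definition F :: "'h ^ 'm \<Rightarrow> 'm \<Rightarrow> 'h" where
  "F U i = (\<Sum>j\<in>UNIV. \<beta> j i *\<^sub>R pstar (p (U $ j) (U $ j)) (U $ i))"

text \<open>Varying the factor with index j gives the same double sum as varying that with index i,
  after exchanging indices by the symmetry of \<beta>. Thus the gradient of \<open>J\<close> is the
  linear minus the cubic part of the system.\<close>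

lemma J_has_derivative: "(J has_derivative (\<lambda>k. \<Sum>i\<in>UNIV. inner (U $ i - F U i) (k $ i))) (at U)"
proof -
  have nth: "((\<lambda>U. U $ i) has_derivative (\<lambda>k. k $ i)) (at U)" for i and U :: "'h ^ 'm"
    by (rule bounded_linear_imp_has_derivative[OF bounded_linear_vec_nth])
  note d = has_derivative_inner p.FDERIV nth
  have "(J has_derivative (\<lambda>k. (\<Sum>i\<in>UNIV. inner (U $ i) (k $ i) + inner (k $ i) (U $ i)) / 2
     - (\<Sum>i\<in>UNIV. \<Sum>j\<in>UNIV. \<beta> j i * (inner (p (U $ j) (U $ j)) (p (U $ i) (k $ i) + p (k $ i) (U $ i))
          + inner (p (U $ j) (k $ j) + p (k $ j) (U $ j)) (p (U $ i) (U $ i)))) / 4)) (at U)"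
    unfolding J_def
    by (intro has_derivative_diff bounded_linear.has_derivative[OF bounded_linear_divide] has_derivative_sum
        has_derivative_mult_right d)
  also have "(\<lambda>k. (\<Sum>i\<in>UNIV. inner (U $ i) (k $ i) + inner (k $ i) (U $ i)) / 2
     - (\<Sum>i\<in>UNIV. \<Sum>j\<in>UNIV. \<beta> j i * (inner (p (U $ j) (U $ j)) (p (U $ i) (k $ i) + p (k $ i) (U $ i))
          + inner (p (U $ j) (k $ j) + p (k $ j) (U $ j)) (p (U $ i) (U $ i)))) / 4)
     = (\<lambda>k. \<Sum>i\<in>UNIV. inner (U $ i - F U i) (k $ i))"
  proof
    fix k :: "'h ^ 'm"
    define a where "a i j = \<beta> j i * inner (p (U $ j) (U $ j)) (p (U $ i) (k $ i))" for i j
    have "\<beta> j i * (inner (p (U $ j) (U $ j)) (p (U $ i) (k $ i) + p (k $ i) (U $ i))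
          + inner (p (U $ j) (k $ j) + p (k $ j) (U $ j)) (p (U $ i) (U $ i))) = 2 * a i j + 2 * a j i" for i j
      unfolding a_def \<beta>_sym[of j i] p_commute[of "k $ i"] p_commute[of "k $ j"]
      by (simp add: inner_add_right inner_add_left algebra_simps inner_commute)
    then have "(\<Sum>i\<in>UNIV. \<Sum>j\<in>UNIV. \<beta> j i * (inner (p (U $ j) (U $ j)) (p (U $ i) (k $ i) + p (k $ i) (U $ i))
          + inner (p (U $ j) (k $ j) + p (k $ j) (U $ j)) (p (U $ i) (U $ i))))
       = (\<Sum>i\<in>UNIV. \<Sum>j\<in>UNIV. 2 * a i j) + (\<Sum>i\<in>UNIV. \<Sum>j\<in>UNIV. 2 * a j i)"
      by (simp add: sum.distrib)
    also have "(\<Sum>i\<in>UNIV. \<Sum>j\<in>UNIV. 2 * a j i) = (\<Sum>i\<in>UNIV. \<Sum>j\<in>UNIV. 2 * a i j)" by (rule sum.swap)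
    also have "(\<Sum>i\<in>UNIV. \<Sum>j\<in>UNIV. 2 * a i j) = 2 * (\<Sum>i\<in>UNIV. inner (F U i) (k $ i))"
      by (simp add: a_def F_def inner_sum_left inner_pstar sum_distrib_left)
    finally have e: "(\<Sum>i\<in>UNIV. \<Sum>j\<in>UNIV. \<beta> j i * (inner (p (U $ j) (U $ j)) (p (U $ i) (k $ i) + p (k $ i) (U $ i))
          + inner (p (U $ j) (k $ j) + p (k $ j) (U $ j)) (p (U $ i) (U $ i)))) = 4 * (\<Sum>i\<in>UNIV. inner (F U i) (k $ i))" by simp
    show "(\<Sum>i\<in>UNIV. inner (U $ i) (k $ i) + inner (k $ i) (U $ i)) / 2
     - (\<Sum>i\<in>UNIV. \<Sum>j\<in>UNIV. \<beta> j i * (inner (p (U $ j) (U $ j)) (p (U $ i) (k $ i) + p (k $ i) (U $ i))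
          + inner (p (U $ j) (k $ j) + p (k $ j) (U $ j)) (p (U $ i) (U $ i)))) / 4
       = (\<Sum>i\<in>UNIV. inner (U $ i - F U i) (k $ i))"
      unfolding e
      by (simp add: inner_diff_left sum_subtractf inner_commute[of "k $ _"] sum_distrib_left[symmetric])
  qed
  finally show ?thesis .
qed

lemma M_iota: "v \<in> M \<Longrightarrow> inner (\<iota> (v $ i)) (\<iota> (v $ i)) = 1"
  and M_V: "v \<in> M \<Longrightarrow> v $ i \<in> V (\<kappa> i)"
  by (auto simp: M_def Sph_def power2_norm_eq_inner[symmetric])

lemma \<kappa>_pos: "\<kappa> i > 0"
proof -
  obtain v where v: "v \<in> V (\<kappa> i)" "norm (\<iota> v) = 1" using Sph_ne[of i] by (auto simp: Sph_def)
  then have "v \<noteq> 0" by (auto simp: iota.zero)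
  then show ?thesis using norm_V[OF v(1)] v(2) by (metis mult.right_neutral one_power2 zero_less_norm_iff zero_less_power)
qed

lemma V_K:
  assumes "v \<in> V (\<kappa> i)"
  shows "K v = (1 / \<kappa> i) *\<^sub>R v"
proof -
  have "(1 / \<kappa> i) *\<^sub>R v = (1 / \<kappa> i) *\<^sub>R (\<kappa> i *\<^sub>R K v)" using assms by (simp add: V_def L_def)
  then show ?thesis using \<kappa>_pos[of i] by simp
qed

text \<open>On the kernel the two inner products are proportional with the positive factor
  \<open>\<kappa> i\<close>, so orthogonality in one is orthogonality in the other.\<close>

lemma V_Vp_iota:
  assumes "v \<in> V (\<kappa> i)" "w \<in> Vp (\<kappa> i)"
  shows "inner (\<iota> v) (\<iota> w) = 0"
proof -
  have "inner v w = \<kappa> i * inner (\<iota> v) (\<iota> w)" using assms(1) by (simp add: V_iff)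
  moreover have "inner v w = 0" using assms by (simp add: Vp_def inner_commute)
  ultimately show ?thesis using \<kappa>_pos[of i] by simp
qed

text \<open>
  The part of the residual that is left at a fixed point vanishes only for a maximising \<open>v\<close>.
\<close>

definition R :: "real \<Rightarrow> ('h ^ 'm) \<times> ('h ^ 'm) \<Rightarrow> 'm \<Rightarrow> 'h" where
  "R e x i = z x i - e *\<^sub>R N x i - (\<kappa> i - e * s x i) *\<^sub>R K (z x i)"

text \<open>Since \<open>L\<close> undoes \<open>A\<close> up to the kernel projection, everything
  in the residual cancels except \<open>K (v $ i)\<close> and a projected term, both in the kernel.
  The choice of \<open>s\<close> removes the component along \<open>v $ i\<close>.\<close>

lemma residual:
  assumes v: "v \<in> M" and w: "e *\<^sub>R T (v, w) = w"
  shows "w $ i \<in> Vp (\<kappa> i)" and "R e (v, w) i \<in> V (\<kappa> i)" and "inner (R e (v, w) i) (v $ i) = 0"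
proof -
  define f where "f = N (v, w) i - s (v, w) i *\<^sub>R K (w $ i)"
  have wi: "w $ i = e *\<^sub>R A (\<kappa> i) f"
    by (subst w[symmetric]) (simp add: T_def f_def)
  then show wV: "w $ i \<in> Vp (\<kappa> i)" using A_in subspace_Vp by (simp add: subspace_scale)
  have vV: "v $ i \<in> V (\<kappa> i)" by (rule M_V[OF v])
  have "L (\<kappa> i) (w $ i) = e *\<^sub>R (f - PV (\<kappa> i) f)" by (subst wi) (simp add: L.scaleR L_A)
  moreover have "L (\<kappa> i) (v $ i) = 0" using vV by (simp add: V_def)
  ultimately have Lz: "z (v, w) i - \<kappa> i *\<^sub>R K (z (v, w) i) = e *\<^sub>R (f - PV (\<kappa> i) f)"
    by (simp add: z_def L.add L_def[symmetric])
  have "R e (v, w) i = (z (v, w) i - \<kappa> i *\<^sub>R K (z (v, w) i)) - e *\<^sub>R N (v, w) i + (e * s (v, w) i) *\<^sub>R K (z (v, w) i)"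
    by (simp add: R_def algebra_simps)
  also have "\<dots> = e *\<^sub>R (s (v, w) i *\<^sub>R K (v $ i) - PV (\<kappa> i) f)"
    unfolding Lz by (simp add: f_def z_def K.add algebra_simps)
  finally have Req: "R e (v, w) i = e *\<^sub>R (s (v, w) i *\<^sub>R K (v $ i) - PV (\<kappa> i) f)" .
  have "K (v $ i) \<in> V (\<kappa> i)" using V_K[OF vV] vV subspace_V by (simp add: subspace_scale)
  then show "R e (v, w) i \<in> V (\<kappa> i)"
    unfolding Req using PV_in subspace_V by (simp add: subspace_scale subspace_diff)
  have "inner (f - PV (\<kappa> i) f) (v $ i) = 0" using diff_PV_in vV by (auto simp: Vp_def)
  then have "inner (PV (\<kappa> i) f) (v $ i) = inner f (v $ i)" by (simp add: inner_diff_left)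
  also have "\<dots> = s (v, w) i"
    using V_Vp_iota[OF vV wV]
    by (simp add: f_def inner_diff_left s_def inner_K inner_commute[of "\<iota> (w $ i)"])
  finally show "inner (R e (v, w) i) (v $ i) = 0"
    unfolding Req by (simp add: inner_diff_left inner_K M_iota[OF v])
qed

text \<open>By orthogonality the squared norm before scaling is 1 plus that of
  \<open>\<iota> (w $ i)\<close>, which is what \<open>\<rho>\<close> normalises.\<close>

lemma norm_iota_Z:
  assumes "v \<in> M" "w $ i \<in> Vp (\<kappa> i)"
  shows "inner (\<iota> (Z (v, w) $ i)) (\<iota> (Z (v, w) $ i)) = 1"
proof -
  have "inner (\<iota> (z (v, w) i)) (\<iota> (z (v, w) i)) = 1 + inner (\<iota> (w $ i)) (\<iota> (w $ i))"
    using V_Vp_iota[OF M_V[OF assms(1)] assms(2)] M_iota[OF assms(1)]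
    by (simp add: z_def iota.add inner_add_left inner_add_right inner_commute)
  moreover have "1 + inner (\<iota> (w $ i)) (\<iota> (w $ i)) > 0" by (simp add: add_pos_nonneg)
  ultimately show ?thesis
    by (simp add: Z_def iota.scaleR \<rho>_def)
qed

lemma F_Z: "F (\<epsilon> *\<^sub>R Z x) i = (\<epsilon> ^ 3 * \<rho> x i) *\<^sub>R N x i"
  by (simp add: F_def Z_def N_def p.scaleR_left p.scaleR_right ps.scaleR_left ps.scaleR_right
      scaleR_sum_right power3_eq_cube mult_ac)

lemma \<rho>_pos: "\<rho> x i > 0"
  by (simp add: \<rho>_def add_pos_nonneg)

proposition bifurcation:
  assumes "0 < \<delta>"
  shows "\<exists>U \<tau>. solution \<beta> \<tau> U \<and> (\<forall>i. \<iota> (U i) \<noteq> 0 \<and> norm (U i) < \<delta> \<and> \<bar>\<tau> i - \<kappa> i\<bar> < \<delta>)"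
proof -
  let ?X = "M \<times> W"
  obtain C where C: "C \<ge> 0" "\<And>x. x \<in> ?X \<Longrightarrow> norm (T x) \<le> C"
      "\<And>x y. x \<in> ?X \<Longrightarrow> y \<in> ?X \<Longrightarrow> norm (T x - T y) \<le> C * norm (x - y)"
    using bdd_lipschitz_T unfolding bdd_lipschitz_def by blast
  obtain D where D: "D \<ge> 0" "\<And>x. x \<in> ?X \<Longrightarrow> norm (Z x) \<le> D"
      "\<And>x y. x \<in> ?X \<Longrightarrow> y \<in> ?X \<Longrightarrow> norm (Z x - Z y) \<le> D * norm (x - y)"
    using bdd_lipschitz_Z unfolding bdd_lipschitz_def by blast
  have "\<forall>i. \<exists>E\<ge>0. \<forall>x\<in>?X. \<bar>s x i\<bar> \<le> E" using bdd_lipschitz_s unfolding bdd_lipschitz_def by fastforce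
  from choice[OF this] obtain E where E: "\<And>i. E i \<ge> 0" "\<And>i x. x \<in> ?X \<Longrightarrow> \<bar>s x i\<bar> \<le> E i" by blast
  define S where "S = C + D + (\<Sum>i\<in>UNIV. E i)"
  have S: "S \<ge> 0" "C \<le> S" "D \<le> S" "E i \<le> S" for i
    using C(1) D(1) E(1) sum_nonneg[of UNIV E] member_le_sum[of i UNIV E] by (auto simp: S_def)
  \<comment> \<open>\<open>\<epsilon> * S\<close> falls below 1/2 for the contraction and below
    \<delta> for the sizes of solution and parameter shift; \<open>S\<close> dominates all three
    constants. The cap 1 gives \<open>e2 \<le> \<epsilon>\<close>, and the summand 1 keeps the
    denominator positive.\<close>
  define \<epsilon> where "\<epsilon> = min 1 (min (1 / 2) (\<delta> / 2) / (S + 1))"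
  have e: "\<epsilon> > 0" "\<epsilon> \<le> 1" using assms S(1) by (auto simp: \<epsilon>_def)
  have eS: "\<epsilon> * S \<le> 1 / 2" "\<epsilon> * S < \<delta>"
  proof -
    have "\<epsilon> * S \<le> min (1 / 2) (\<delta> / 2) / (S + 1) * S" using S(1) by (intro mult_right_mono) (auto simp: \<epsilon>_def)
    also have "\<dots> = min (1 / 2) (\<delta> / 2) * (S / (S + 1))" by simp
    also have "\<dots> \<le> min (1 / 2) (\<delta> / 2) * 1" using S(1) assms by (intro mult_left_mono) auto
    finally have "\<epsilon> * S \<le> min (1 / 2) (\<delta> / 2)" by simp
    then show "\<epsilon> * S \<le> 1 / 2" "\<epsilon> * S < \<delta>" using assms by auto
  qed
  define e2 where "e2 = \<epsilon>\<^sup>2"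
  have e2: "e2 \<ge> 0" "e2 \<le> \<epsilon>" using e by (auto simp: e2_def power2_eq_square mult_left_le)
  have e2S: "e2 * t \<le> \<epsilon> * S" if "0 \<le> t" "t \<le> S" for t
    using that e e2 by (intro mult_mono) auto
  have "e2 * C \<le> 1 / 2" using e2S[of C] C(1) S eS by linarith
  then have "\<forall>v\<in>M. \<exists>w. w \<in> W \<and> e2 *\<^sub>R T (v, w) = w" using fixed_point[OF C e2(1)] by blast
  from bchoice[OF this] obtain w where w: "\<And>v. v \<in> M \<Longrightarrow> w v \<in> W" "\<And>v. v \<in> M \<Longrightarrow> e2 *\<^sub>R T (v, w v) = w v" by blast
  define x where "x v = (v, w v)" for v
  have xX: "x v \<in> ?X" if "v \<in> M" for v using w that by (simp add: x_def)
  \<comment> \<open>The correction moves at most half as far as the pair does, and this half is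
    absorbed on the left.\<close>
  have xlip: "norm (x v - x v') \<le> 2 * norm (v - v')" if "v \<in> M" "v' \<in> M" for v v'
  proof -
    have le: "norm (x v - x v') \<le> norm (v - v') + norm (w v - w v')"
      unfolding x_def diff_Pair by (rule norm_Pair_le)
    have "w v - w v' = e2 *\<^sub>R (T (x v) - T (x v'))"
      using w(2)[OF that(1)] w(2)[OF that(2)] by (simp add: x_def scaleR_diff_right)
    then have "norm (w v - w v') = e2 * norm (T (x v) - T (x v'))" using e2 by simp
    also have "\<dots> \<le> e2 * (C * norm (x v - x v'))" using e2 C(3) xX that by (intro mult_left_mono) auto
    also have "\<dots> \<le> 1 / 2 * norm (x v - x v')"
      using mult_right_mono[OF \<open>e2 * C \<le> 1 / 2\<close>, of "norm (x v - x v')"] by (simp add: mult.assoc)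
    finally show ?thesis using le by simp
  qed
  define U where "U v = \<epsilon> *\<^sub>R Z (x v)" for v
  have Ulip: "norm (U v - U v') \<le> 2 * \<epsilon> * D * norm (v - v')" if "v \<in> M" "v' \<in> M" for v v'
  proof -
    have "norm (U v - U v') = \<epsilon> * norm (Z (x v) - Z (x v'))" using e by (simp add: U_def scaleR_diff_right[symmetric])
    also have "\<dots> \<le> \<epsilon> * (D * (2 * norm (v - v')))"
      using e D xX that by (intro mult_left_mono order_trans[OF D(3)] xlip) auto
    finally show ?thesis by (simp add: mult_ac)
  qed
  have "(2 * \<epsilon> * D)-lipschitz_on M U" using Ulip e D(1) by (intro lipschitz_onI) (auto simp: dist_norm)
  then have "continuous_on M U" by (rule lipschitz_on_continuous_on)
  moreover have "continuous_on UNIV J"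
    using has_derivative_continuous[OF J_has_derivative] by (simp add: continuous_on_eq_continuous_at)
  ultimately have "continuous_on M (\<lambda>v. J (U v))" by (intro continuous_on_compose2[of UNIV J M U]) auto
  from continuous_attains_sup[OF compact_M M_ne this] obtain v where v: "v \<in> M"
      and vmax: "\<And>v'. v' \<in> M \<Longrightarrow> J (U v') \<le> J (U v)" by blast
  note res = residual[OF _ w(2), folded x_def]
  have iU: "inner (\<iota> (U v $ i)) (\<iota> (U v $ i)) = e2" if "v \<in> M" for v i
    using norm_iota_Z[OF that res(1)[OF that that]]
    by (simp add: U_def x_def iota.scaleR e2_def power2_eq_square)
  define \<tau> where "\<tau> i = \<kappa> i - e2 * s (x v) i" for i
  \<comment> \<open>The gradient of \<open>J\<close> splits into the residual and a multiple of
    \<open>K (U v $ i)\<close>, which is the gradient of half the constrained squared norm.\<close>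
  have grad: "U v $ i - F (U v) i = (\<epsilon> * \<rho> (x v) i) *\<^sub>R R e2 (x v) i + \<tau> i *\<^sub>R K (U v $ i)" for i
  proof -
    have "U v $ i = (\<epsilon> * \<rho> (x v) i) *\<^sub>R z (x v) i" by (simp add: U_def Z_def)
    then show ?thesis
      unfolding F_Z U_def
      by (simp add: R_def \<tau>_def Z_def K.scaleR e2_def scaleR_diff_right scaleR_diff_left right_diff_distrib
          power2_eq_square power3_eq_cube mult_ac)
  qed
  have R0: "R e2 (x v) i = 0" for i
  proof (rule ccontr)
    define r where "r = R e2 (x v) i"
    assume "R e2 (x v) i \<noteq> 0"
    then have r0: "r \<noteq> 0" by (simp add: r_def)
    have rV: "r \<in> V (\<kappa> i)" and rv: "inner r (v $ i) = 0" using res(2,3)[OF v v] by (auto simp: r_def)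
    have ir: "norm (\<iota> r) > 0" using norm_V[OF rV] r0 by auto
    \<comment> \<open>\<open>h\<close> has the same \<open>\<iota>\<close>-norm as
      \<open>v $ i\<close> and is orthogonal to it, so rotating \<open>v $ i\<close> towards
      \<open>h\<close> stays in the unit sphere of the kernel.\<close>
    define h where "h = (1 / norm (\<iota> r)) *\<^sub>R r"
    have hV: "h \<in> V (\<kappa> i)" using rV subspace_V by (simp add: h_def subspace_scale)
    have ih: "inner (\<iota> h) (\<iota> h) = 1" using ir by (simp add: h_def iota.scaleR power2_norm_eq_inner[symmetric] power2_eq_square)
    have ihv: "inner (\<iota> h) (\<iota> (v $ i)) = 0"
    proof -
      have "inner r (v $ i) = \<kappa> i * inner (\<iota> r) (\<iota> (v $ i))" using rV by (simp add: V_iff)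
      then show ?thesis using rv \<kappa>_pos[of i] by (simp add: h_def iota.scaleR)
    qed
    define c where "c t = (\<chi> j. if j = i then cos t *\<^sub>R (v $ i) + sin t *\<^sub>R h else v $ j)" for t
    have c0: "c 0 = v" by (simp add: c_def vec_eq_iff)
    have cM: "c t \<in> M" for t
    proof -
      have "cos t *\<^sub>R (v $ i) + sin t *\<^sub>R h \<in> V (\<kappa> i)"
        using subspace_V M_V[OF v] hV by (simp add: subspace_add subspace_scale)
      moreover have "(norm (\<iota> (cos t *\<^sub>R (v $ i) + sin t *\<^sub>R h)))\<^sup>2 = (cos t)\<^sup>2 + (sin t)\<^sup>2"
        using ih ihv M_iota[OF v, of i] unfolding power2_norm_eq_inner
        by (simp add: iota.add iota.scaleR inner_add_left inner_add_right inner_commute power2_eq_square)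
      then have "norm (\<iota> (cos t *\<^sub>R (v $ i) + sin t *\<^sub>R h)) = 1"
        by (metis abs_norm_cancel power2_eq_1_iff sin_cos_squared_add2 abs_1 abs_minus)
      ultimately show ?thesis using v by (auto simp: M_def c_def Sph_def)
    qed
    define B where "B = norm (v $ i) + norm h"
    have cB: "norm (c t - v) \<le> \<bar>t\<bar> * B" for t
    proof -
      have "norm (c t - v) \<le> (\<Sum>j\<in>UNIV. norm ((c t - v) $ j))" by (rule norm_vec_le_sum)
      also have "\<dots> = (\<Sum>j\<in>UNIV. if j = i then norm ((cos t - 1) *\<^sub>R (v $ i) + sin t *\<^sub>R h) else 0)"
        by (intro sum.cong) (auto simp: c_def algebra_simps)
      also have "\<dots> = norm ((cos t - 1) *\<^sub>R (v $ i) + sin t *\<^sub>R h)" by simp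
      also have "\<dots> \<le> \<bar>cos t - 1\<bar> * norm (v $ i) + \<bar>sin t\<bar> * norm h"
        by (rule order_trans[OF norm_triangle_ineq]) simp
      also have "\<dots> \<le> \<bar>t\<bar> * norm (v $ i) + \<bar>t\<bar> * norm h"
      proof (intro add_mono mult_right_mono)
        have "dist (cos t) (cos 0) \<le> 1 * dist t 0"
          by (rule field_differentiable_bound[of UNIV cos "\<lambda>x. - sin x", unfolded dist_norm[symmetric]])
             (auto intro!: derivative_eq_intros)
        then show "\<bar>cos t - 1\<bar> \<le> \<bar>t\<bar>" by (simp add: dist_real_def)
        show "\<bar>sin t\<bar> \<le> \<bar>t\<bar>" by (rule abs_sin_x_le_abs_x)
      qed auto
      finally show ?thesis by (simp add: B_def algebra_simps)
    qed
    define H where "H = 2 * \<epsilon> * D * B"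
    have yH: "norm (U (c t) - U v) \<le> H * \<bar>t\<bar>" for t
      using order_trans[OF Ulip[OF cM v] mult_left_mono[OF cB, of "2 * \<epsilon> * D" t]] e D(1) by (simp add: H_def mult_ac)
    define a where "a t = (\<epsilon> * \<rho> (x v) i) * (\<epsilon> * \<rho> (x (c t)) i) * inner r h" for t
    \<comment> \<open>The contribution of the multipliers, which will turn out to be quadratic in
      \<open>t\<close>.\<close>
    define q where "q t = (\<Sum>j\<in>UNIV. \<tau> j * (- (norm (\<iota> (U (c t) $ j - U v $ j)))\<^sup>2 / 2))" for t
    have DU: "(\<Sum>j\<in>UNIV. inner (U v $ j - F (U v) j) ((U (c t) - U v) $ j)) = a t * sin t + q t" for t
    proof -
      \<comment> \<open>The residual lies in the kernel, so it is orthogonal to the correction and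
        sees \<open>v'\<close> only. This is why no derivative of the correction is needed.\<close>
      have Rk: "inner (R e2 (x v) j) (U v' $ j) = \<epsilon> * \<rho> (x v') j * inner (R e2 (x v) j) (v' $ j)" if "v' \<in> M" for v' j
      proof -
        have "inner (w v' $ j) (R e2 (x v) j) = 0" using res(1)[OF that that] res(2)[OF v v] by (auto simp: Vp_def)
        then show ?thesis by (simp add: U_def Z_def z_def x_def inner_add_left inner_add_right inner_commute)
      qed
      have 1: "inner (R e2 (x v) j) (U (c t) $ j - U v $ j) = (if j = i then \<epsilon> * \<rho> (x (c t)) i * inner r h * sin t else 0)" for j
      proof -
        have "c t $ j = (if j = i then cos t *\<^sub>R (v $ i) + sin t *\<^sub>R h else v $ j)" by (simp add: c_def)
        then show ?thesis
          using res(3)[OF v v, of j] rv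
          by (auto simp: inner_diff_right Rk[OF cM] Rk[OF v] inner_add_right r_def)
      qed
      \<comment> \<open>Both points have the same \<open>\<iota>\<close>-norm, so the pairing with
        their difference is minus half the squared distance.\<close>
      have 2: "inner (K (U v $ j)) (U (c t) $ j - U v $ j) = - (norm (\<iota> (U (c t) $ j - U v $ j)))\<^sup>2 / 2" for j
        using iU[OF cM, of t j] iU[OF v, of j]
        unfolding inner_K by (simp add: power2_norm_eq_inner iota.diff inner_diff_left inner_diff_right inner_commute)
      have "(\<Sum>j\<in>UNIV. inner (U v $ j - F (U v) j) ((U (c t) - U v) $ j)) =
         (\<Sum>j\<in>UNIV. (if j = i then a t * sin t else 0) + \<tau> j * (- (norm (\<iota> (U (c t) $ j - U v $ j)))\<^sup>2 / 2))"
        unfolding grad inner_add_left inner_scaleR_left vector_minus_component 1 2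
        by (intro sum.cong) (auto simp: a_def)
      then show ?thesis unfolding sum.distrib by (simp add: q_def)
    qed
    obtain G where G: "G \<ge> 0" "\<And>y. norm (\<iota> y) \<le> norm y * G" using iota.nonneg_bounded by blast
    define Q where "Q = (\<Sum>j\<in>UNIV. \<bar>\<tau> j\<bar>) * (H * G)\<^sup>2"
    have qQ: "\<bar>q t\<bar> \<le> Q * t\<^sup>2" for t
    proof -
      have "norm (\<iota> (U (c t) $ j - U v $ j)) \<le> \<bar>H * G * t\<bar>" for j
      proof -
        have "norm (\<iota> (U (c t) $ j - U v $ j)) \<le> norm (U (c t) - U v) * G"
          using G Finite_Cartesian_Product.norm_nth_le[of "U (c t) - U v" j] by (auto intro!: order_trans[OF G(2)] mult_right_mono)
        also have "\<dots> \<le> (H * \<bar>t\<bar>) * G" by (intro mult_right_mono yH G)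
        also have "\<dots> \<le> \<bar>H * G * t\<bar>"
          using mult_right_mono[OF mult_right_mono[OF abs_ge_self[of H] abs_ge_zero[of t]] G(1)] G(1)
          by (simp add: abs_mult mult_ac)
        finally show ?thesis .
      qed
      then have b: "(norm (\<iota> (U (c t) $ j - U v $ j)))\<^sup>2 \<le> (H * G)\<^sup>2 * t\<^sup>2" for j
        by (metis abs_norm_cancel abs_le_square_iff power_mult_distrib)
      have "\<bar>q t\<bar> \<le> (\<Sum>j\<in>UNIV. \<bar>\<tau> j\<bar> * ((H * G)\<^sup>2 * t\<^sup>2))"
        unfolding q_def
      proof (rule order_trans[OF sum_abs sum_mono])
        fix j
        have "\<bar>- (norm (\<iota> (U (c t) $ j - U v $ j)))\<^sup>2 / 2\<bar> \<le> (H * G)\<^sup>2 * t\<^sup>2"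
          by (intro order_trans[OF _ b[of j]]) simp
        then show "\<bar>\<tau> j * (- (norm (\<iota> (U (c t) $ j - U v $ j)))\<^sup>2 / 2)\<bar> \<le> \<bar>\<tau> j\<bar> * ((H * G)\<^sup>2 * t\<^sup>2)"
          unfolding abs_mult by (intro mult_left_mono) auto
      qed
      then show ?thesis by (simp add: Q_def sum_distrib_right mult.assoc)
    qed
    have qlim: "((\<lambda>t. q t / t) \<longlongrightarrow> 0) (at 0)"
    proof (rule Lim_null_comparison)
      show "\<forall>\<^sub>F t in at 0. norm (q t / t) \<le> Q * \<bar>t\<bar>"
      proof (rule eventually_at_topological[THEN iffD2], intro exI[of _ UNIV] conjI ballI impI)
        fix t :: real assume "t \<noteq> 0"
        then show "norm (q t / t) \<le> Q * \<bar>t\<bar>" using qQ[of t]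
          by (simp add: abs_divide divide_le_eq power2_eq_square abs_mult_self_eq mult.assoc)
      qed auto
      show "((\<lambda>t. Q * \<bar>t\<bar>) \<longlongrightarrow> 0) (at 0)" by (auto intro!: tendsto_eq_intros)
    qed
    \<comment> \<open>Continuity of \<open>\<rho>\<close> along the curve is enough, because it
      multiplies \<open>sin t\<close>, which carries the first order.\<close>
    obtain P where P: "P \<ge> 0" "\<And>x y. x \<in> ?X \<Longrightarrow> y \<in> ?X \<Longrightarrow> norm (\<rho> x i - \<rho> y i) \<le> P * norm (x - y)"
      using bdd_lipschitz_\<rho>[of i] unfolding bdd_lipschitz_def by blast
    have "((\<lambda>t. \<rho> (x (c t)) i - \<rho> (x v) i) \<longlongrightarrow> 0) (at 0)"
    proof (rule Lim_null_comparison)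
      have "norm (\<rho> (x (c t)) i - \<rho> (x v) i) \<le> P * (2 * (\<bar>t\<bar> * B))" for t
        using order_trans[OF P(2)[OF xX[OF cM] xX[OF v]] mult_left_mono[OF order_trans[OF xlip[OF cM v] mult_left_mono[OF cB]] P(1)]]
        by simp
      then show "\<forall>\<^sub>F t in at 0. norm (\<rho> (x (c t)) i - \<rho> (x v) i) \<le> P * (2 * (\<bar>t\<bar> * B))" by simp
      show "((\<lambda>t. P * (2 * (\<bar>t\<bar> * B))) \<longlongrightarrow> 0) (at 0)" by (auto intro!: tendsto_eq_intros)
    qed
    then have \<rho>lim: "((\<lambda>t. \<rho> (x (c t)) i) \<longlongrightarrow> \<rho> (x v) i) (at 0)" by (simp add: LIM_zero_iff)
    have slim: "((\<lambda>t::real. sin t / t) \<longlongrightarrow> 1) (at 0)"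
      using DERIV_sin[of "0::real"] by (simp add: DERIV_def)
    have "((\<lambda>t. a t * (sin t / t) + q t / t) \<longlongrightarrow> a 0 * 1 + 0) (at 0)"
      unfolding a_def c0 by (intro tendsto_intros \<rho>lim slim qlim)
    moreover have "a t * (sin t / t) + q t / t = (\<Sum>j\<in>UNIV. inner (U v $ j - F (U v) j) ((U (c t) - U v) $ j)) / t" for t
      unfolding DU by (simp add: add_divide_distrib)
    ultimately have "((\<lambda>t. (\<Sum>j\<in>UNIV. inner (U v $ j - F (U v) j) ((U (c t) - U v) $ j)) / t) \<longlongrightarrow> a 0) (at 0)" by simp
    then have "DERIV (\<lambda>t. J (U (c t))) 0 :> a 0"
      using derivative_along_lipschitz_curve[OF J_has_derivative, of "\<lambda>t. U (c t)" 0 H "a 0"] yH by (simp add: c0)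
    then have "a 0 = 0"
      by (rule DERIV_local_max[of _ _ _ 1]) (use vmax cM c0 in auto)
    \<comment> \<open>\<open>inner r h\<close> is the squared norm of \<open>r\<close> divided by
      the norm of \<open>\<iota> r\<close>, hence positive for nonzero \<open>r\<close>.\<close>
    then have "inner r h = 0" using e(1) \<rho>_pos[of "x v" i] by (simp add: a_def c0)
    then show False using r0 ir by (simp add: h_def)
  qed
  have "solution \<beta> \<tau> (\<lambda>i. U v $ i)"
    unfolding solution_def
  proof (intro allI)
    fix i \<phi>
    have "inner (U v $ i - F (U v) i) \<phi> = \<tau> i * inner (\<iota> (U v $ i)) (\<iota> \<phi>)"
      unfolding grad R0 by (simp add: inner_K)
    then show "inner (U v $ i) \<phi> - \<tau> i * inner (\<iota> (U v $ i)) (\<iota> \<phi>) =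
        (\<Sum>k\<in>UNIV. \<beta> k i * inner (p (U v $ k) (U v $ k)) (p (U v $ i) \<phi>))"
      by (simp add: inner_diff_left F_def inner_sum_left inner_pstar)
  qed
  moreover have "\<iota> (U v $ i) \<noteq> 0" for i using iU[OF v, of i] e by (auto simp: e2_def)
  moreover have "norm (U v $ i) < \<delta>" for i
  proof -
    have "norm (U v $ i) \<le> norm (U v)" by (rule Finite_Cartesian_Product.norm_nth_le)
    also have "\<dots> \<le> \<epsilon> * S" using e D(2)[OF xX[OF v]] S(3) by (simp add: U_def mult_left_mono)
    finally show ?thesis using eS by simp
  qed
  moreover have "\<bar>\<tau> i - \<kappa> i\<bar> < \<delta>" for i
  proof -
    have "\<bar>\<tau> i - \<kappa> i\<bar> = e2 * \<bar>s (x v) i\<bar>" using e2 by (simp add: \<tau>_def abs_mult)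
    also have "\<dots> \<le> \<epsilon> * S" using e2S order_trans[OF E(2)[OF xX[OF v]] S(4)] by auto
    finally show ?thesis using eS by simp
  qed
  ultimately show ?thesis by (intro exI[of _ "\<lambda>i. U v $ i"] exI[of _ \<tau>]) auto
qed

end

section \<open>The Hilbert space of square-integrable functions\<close>

definition sqint :: "('a::euclidean_space \<Rightarrow> real) set" where
  "sqint = {f \<in> borel_measurable lebesgue. integrable lebesgue (\<lambda>x. (f x)\<^sup>2)}"

lemma sqint_measurable[measurable_dest]: "f \<in> sqint \<Longrightarrow> f \<in> borel_measurable lebesgue"
  and sqint_integrable: "f \<in> sqint \<Longrightarrow> integrable lebesgue (\<lambda>x. (f x)\<^sup>2)"
  by (auto simp: sqint_def)

lemma sqintI: "f \<in> borel_measurable lebesgue \<Longrightarrow> integrable lebesgue (\<lambda>x. (f x)\<^sup>2) \<Longrightarrow> f \<in> sqint"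
  by (auto simp: sqint_def)

lemma sqint_mult_integrable:
  assumes f: "f \<in> sqint" and g: "g \<in> sqint"
  shows "integrable lebesgue (\<lambda>x. f x * g x)"
proof (rule Bochner_Integration.integrable_bound)
  show "integrable lebesgue (\<lambda>x. (f x)\<^sup>2 + (g x)\<^sup>2)" using f g by (intro Bochner_Integration.integrable_add sqint_integrable)
  show "(\<lambda>x. f x * g x) \<in> borel_measurable lebesgue" using f g by measurable
  have "\<bar>a * b\<bar> \<le> a\<^sup>2 + b\<^sup>2" for a b :: real
  proof -
    have "0 \<le> \<bar>a * b\<bar>" by (rule abs_ge_zero)
    moreover have "2 * \<bar>a * b\<bar> \<le> a\<^sup>2 + b\<^sup>2"
      using sum_squares_bound[of "\<bar>a\<bar>" "\<bar>b\<bar>"] by (simp add: abs_mult mult.assoc)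
    ultimately show ?thesis by linarith
  qed
  then show "AE x in lebesgue. norm (f x * g x) \<le> norm ((f x)\<^sup>2 + (g x)\<^sup>2)" by simp
qed

lemma sqint_add:
  assumes "f \<in> sqint" "g \<in> sqint"
  shows "(\<lambda>x. f x + g x) \<in> sqint"
proof -
  have "integrable lebesgue (\<lambda>x. (f x)\<^sup>2 + (g x)\<^sup>2 + 2 * (f x * g x))"
    using assms by (intro Bochner_Integration.integrable_add sqint_integrable integrable_mult_right sqint_mult_integrable)
  then have "integrable lebesgue (\<lambda>x. (f x + g x)\<^sup>2)" by (simp add: power2_sum mult.assoc)
  moreover have "(\<lambda>x. f x + g x) \<in> borel_measurable lebesgue" using assms by measurable
  ultimately show ?thesis by (rule sqintI[rotated])
qed

lemma sqint_scale:
  assumes "f \<in> sqint"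
  shows "(\<lambda>x. c * f x) \<in> sqint"
proof (rule sqintI)
  show "(\<lambda>x. c * f x) \<in> borel_measurable lebesgue" using assms by measurable
  show "integrable lebesgue (\<lambda>x. (c * f x)\<^sup>2)"
    unfolding power_mult_distrib using sqint_integrable[OF assms] by simp
qed

lemma sqint_uminus: "f \<in> sqint \<Longrightarrow> (\<lambda>x. - f x) \<in> sqint"
  using sqint_scale[of f "-1"] by simp

lemma sqint_diff: "f \<in> sqint \<Longrightarrow> g \<in> sqint \<Longrightarrow> (\<lambda>x. f x - g x) \<in> sqint"
  using sqint_add[OF _ sqint_uminus, of f g] by simp

lemma sqint_zero: "(\<lambda>x. 0) \<in> sqint" by (simp add: sqint_def)

text \<open>Functions modulo null sets must form a type, because the abstract part quantifies over
  types of class \<open>real_inner\<close> and \<open>complete_space\<close>.\<close>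

typedef (overloaded) 'a lsq = "{S :: ('a::euclidean_space \<Rightarrow> real) set. \<exists>f\<in>sqint. S = {g \<in> sqint. AE x in lebesgue. f x = g x}}"
  using sqint_zero by blast

definition cls :: "('a::euclidean_space \<Rightarrow> real) \<Rightarrow> 'a lsq" where
  "cls f = Abs_lsq {g \<in> sqint. AE x in lebesgue. f x = g x}"

definition rep :: "'a::euclidean_space lsq \<Rightarrow> 'a \<Rightarrow> real" where
  "rep s = (SOME f. f \<in> sqint \<and> Rep_lsq s = {g \<in> sqint. AE x in lebesgue. f x = g x})"

lemma rep_sqint: "rep s \<in> sqint" and cls_rep: "cls (rep s) = s"
proof -
  have "\<exists>f. f \<in> sqint \<and> Rep_lsq s = {g \<in> sqint. AE x in lebesgue. f x = g x}"
    using Rep_lsq[of s] by blast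
  from someI_ex[OF this] have *: "rep s \<in> sqint" "Rep_lsq s = {g \<in> sqint. AE x in lebesgue. rep s x = g x}"
    unfolding rep_def by auto
  show "rep s \<in> sqint" by (rule *)
  show "cls (rep s) = s" unfolding cls_def *(2)[symmetric] by (rule Rep_lsq_inverse)
qed

lemma cls_eq_iff:
  assumes "f \<in> sqint" "g \<in> sqint"
  shows "cls f = cls g \<longleftrightarrow> (AE x in lebesgue. f x = g x)"
proof -
  have "cls f = cls g \<longleftrightarrow> {h \<in> sqint. AE x in lebesgue. f x = h x} = {h \<in> sqint. AE x in lebesgue. g x = h x}"
    unfolding cls_def using assms by (intro Abs_lsq_inject) auto
  also have "\<dots> \<longleftrightarrow> (AE x in lebesgue. f x = g x)"
  proof
    assume "{h \<in> sqint. AE x in lebesgue. f x = h x} = {h \<in> sqint. AE x in lebesgue. g x = h x}"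
    moreover have "g \<in> {h \<in> sqint. AE x in lebesgue. g x = h x}" using assms by simp
    ultimately show "AE x in lebesgue. f x = g x" by blast
  next
    assume "AE x in lebesgue. f x = g x"
    then show "{h \<in> sqint. AE x in lebesgue. f x = h x} = {h \<in> sqint. AE x in lebesgue. g x = h x}"
      by (auto elim: AE_mp)
  qed
  finally show ?thesis .
qed

lemma rep_cls: "f \<in> sqint \<Longrightarrow> AE x in lebesgue. rep (cls f) x = f x"
  using cls_eq_iff[OF rep_sqint, of f "cls f"] by (simp add: cls_rep)

lemma lsq_cases: obtains f where "f \<in> sqint" "s = cls f"
  using rep_sqint[of s] cls_rep[of s] by metis

instantiation lsq :: (euclidean_space) real_vector
begin

definition "0 = cls (\<lambda>x. 0)"
definition "a + b = cls (\<lambda>x. rep a x + rep b x)"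
definition "- (a :: 'a lsq) = cls (\<lambda>x. - rep a x)"
definition "a - b = cls (\<lambda>x. rep a x - rep b x)"
definition "c *\<^sub>R a = cls (\<lambda>x. c * rep a x)"

lemma cls_add: "f \<in> sqint \<Longrightarrow> g \<in> sqint \<Longrightarrow> cls f + cls g = cls (\<lambda>x. f x + g x)"
  using rep_cls[of f] rep_cls[of g] unfolding plus_lsq_def
  by (subst cls_eq_iff) (auto intro: sqint_add rep_sqint)

lemma cls_uminus: "f \<in> sqint \<Longrightarrow> - cls f = cls (\<lambda>x. - f x)"
  using rep_cls[of f] unfolding uminus_lsq_def
  by (subst cls_eq_iff) (auto intro: sqint_uminus rep_sqint)

lemma cls_diff: "f \<in> sqint \<Longrightarrow> g \<in> sqint \<Longrightarrow> cls f - cls g = cls (\<lambda>x. f x - g x)"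
  using rep_cls[of f] rep_cls[of g] unfolding minus_lsq_def
  by (subst cls_eq_iff) (auto intro: sqint_diff rep_sqint)

lemma cls_scale: "f \<in> sqint \<Longrightarrow> c *\<^sub>R cls f = cls (\<lambda>x. c * f x)"
  using rep_cls[of f] unfolding scaleR_lsq_def
  by (subst cls_eq_iff) (auto intro: sqint_scale rep_sqint)

lemmas cls_simps = cls_add cls_uminus cls_diff cls_scale zero_lsq_def[symmetric]
lemmas sqint_intros = sqint_add sqint_uminus sqint_diff sqint_scale sqint_zero

instance
proof
  fix a b c :: "'a lsq" and r t :: real
  obtain f where f: "f \<in> sqint" "a = cls f" by (rule lsq_cases)
  obtain g where g: "g \<in> sqint" "b = cls g" by (rule lsq_cases)
  obtain h where h: "h \<in> sqint" "c = cls h" by (rule lsq_cases)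
  note s = f(2) g(2) h(2) zero_lsq_def and m = f(1) g(1) h(1) sqint_intros
  show "a + b + c = a + (b + c)" unfolding s by (simp add: cls_simps m add.assoc)
  show "a + b = b + a" unfolding s by (simp add: cls_simps m add.commute)
  show "0 + a = a" unfolding s by (simp add: cls_add m)
  show "- a + a = 0" unfolding s by (simp add: cls_add cls_uminus m)
  show "a - b = a + - b" unfolding s by (simp add: cls_simps m)
  show "r *\<^sub>R (a + b) = r *\<^sub>R a + r *\<^sub>R b" unfolding s by (simp add: cls_simps m distrib_left)
  show "(r + t) *\<^sub>R a = r *\<^sub>R a + t *\<^sub>R a" unfolding s by (simp add: cls_simps m distrib_right)
  show "r *\<^sub>R t *\<^sub>R a = (r * t) *\<^sub>R a" unfolding s by (simp add: cls_simps m mult.assoc)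
  show "1 *\<^sub>R a = a" unfolding s by (simp add: cls_simps m)
qed

end

instantiation lsq :: (euclidean_space) real_inner
begin

definition "inner a b = (\<integral>x. rep a x * rep b x \<partial>lebesgue)"
definition "norm a = sqrt (inner a (a :: 'a lsq))"
definition "dist a b = norm (a - (b :: 'a lsq))"
definition "sgn a = inverse (norm a) *\<^sub>R (a :: 'a lsq)"
definition "uniformity = (INF e\<in>{0<..}. principal {(x, y :: 'a lsq). dist x y < e})"
definition "open U = (\<forall>x\<in>U. eventually (\<lambda>(x', y). x' = x \<longrightarrow> y \<in> U) (uniformity :: ('a lsq \<times> 'a lsq) filter))"

lemma inner_cls:
  assumes "f \<in> sqint" "g \<in> sqint"
  shows "inner (cls f) (cls g) = (\<integral>x. f x * g x \<partial>lebesgue)"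
  unfolding inner_lsq_def
proof (rule integral_cong_AE)
  show "(\<lambda>x. rep (cls f) x * rep (cls g) x) \<in> borel_measurable lebesgue"
    using rep_sqint[of "cls f"] rep_sqint[of "cls g"] by measurable
  show "(\<lambda>x. f x * g x) \<in> borel_measurable lebesgue" using assms by measurable
  show "AE x in lebesgue. rep (cls f) x * rep (cls g) x = f x * g x"
    using rep_cls[OF assms(1)] rep_cls[OF assms(2)] by auto
qed

instance
proof
  fix a b c :: "'a lsq" and r :: real
  obtain f where f: "f \<in> sqint" "a = cls f" by (rule lsq_cases)
  obtain g where g: "g \<in> sqint" "b = cls g" by (rule lsq_cases)
  obtain h where h: "h \<in> sqint" "c = cls h" by (rule lsq_cases)
  note s = f(2) g(2) h(2) and m = f(1) g(1) h(1) sqint_intros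
  note [simp] = sqint_mult_integrable
  show "inner a b = inner b a" by (simp add: inner_lsq_def mult.commute)
  show "inner (a + b) c = inner a c + inner b c"
    unfolding s by (simp add: cls_simps m inner_cls distrib_right)
  show "inner (r *\<^sub>R a) b = r * inner a b"
    unfolding s by (simp add: cls_simps m inner_cls mult.assoc)
  show "0 \<le> inner a a" unfolding s by (simp add: inner_cls m)
  have "inner a a = 0 \<longleftrightarrow> (AE x in lebesgue. f x * f x = 0)"
    unfolding s inner_cls[OF m(1) m(1)] using sqint_mult_integrable[OF m(1) m(1)]
    by (rule integral_nonneg_eq_0_iff_AE) simp
  also have "\<dots> \<longleftrightarrow> a = 0" unfolding s zero_lsq_def by (subst cls_eq_iff) (auto simp: m)
  finally show "inner a a = 0 \<longleftrightarrow> a = 0" .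
qed (simp_all add: norm_lsq_def dist_lsq_def sgn_lsq_def uniformity_lsq_def open_lsq_def)

end

lemma norm_cls: "f \<in> sqint \<Longrightarrow> (norm (cls f))\<^sup>2 = (\<integral>x. (f x)\<^sup>2 \<partial>lebesgue)"
  unfolding power2_norm_eq_inner by (simp add: inner_cls power2_eq_square)

lemma norm_cls_diff:
  "f \<in> sqint \<Longrightarrow> g \<in> sqint \<Longrightarrow> (norm (cls f - cls g))\<^sup>2 = (\<integral>x. (f x - g x)\<^sup>2 \<partial>lebesgue)"
  by (simp add: cls_diff norm_cls sqint_diff)

text \<open>Convergence in L2 is L1 convergence of the squared differences, which has an almost
  everywhere convergent subsequence. It serves to carry pointwise information, such as vanishing
  outside the domain, to limits of test functions.\<close>

lemma tendsto_lsq_AE_subseq: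
  fixes X :: "nat \<Rightarrow> 'a::euclidean_space lsq"
  assumes "X \<longlonglongrightarrow> l"
  shows "\<exists>r::nat \<Rightarrow> nat. strict_mono r \<and> (AE x in lebesgue. (\<lambda>k. rep (X (r k)) x) \<longlonglongrightarrow> rep l x)"
proof -
  define u where "u n x = (rep (X n) x - rep l x)\<^sup>2" for n x
  have "(\<lambda>n. (norm (X n - l))\<^sup>2) \<longlonglongrightarrow> 0"
    using assms tendsto_power[of "\<lambda>n. norm (X n - l)" 0 sequentially 2] by (simp add: tendsto_norm_zero_iff LIM_zero_iff)
  moreover have "(norm (X n - l))\<^sup>2 = (\<integral>x. u n x \<partial>lebesgue)" for n
    using norm_cls_diff[OF rep_sqint rep_sqint, of "X n" l] by (simp add: cls_rep u_def)
  ultimately have "(\<lambda>n. \<integral>x. norm (u n x) \<partial>lebesgue) \<longlonglongrightarrow> 0" by (simp add: u_def)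
  moreover have "integrable lebesgue (u n)" for n
    unfolding u_def by (rule sqint_integrable[OF sqint_diff[OF rep_sqint rep_sqint]])
  ultimately obtain r where r: "strict_mono (r::nat \<Rightarrow> nat)" "AE x in lebesgue. (\<lambda>k. u (r k) x) \<longlonglongrightarrow> 0"
    using tendsto_L1_AE_subseq[of lebesgue u] by blast
  from r(2) have "AE x in lebesgue. (\<lambda>k. rep (X (r k)) x) \<longlonglongrightarrow> rep l x"
  proof (eventually_elim)
    fix x assume "(\<lambda>k. u (r k) x) \<longlonglongrightarrow> 0"
    then have "(\<lambda>k. sqrt ((rep (X (r k)) x - rep l x)\<^sup>2)) \<longlonglongrightarrow> sqrt 0"
      unfolding u_def by (rule tendsto_real_sqrt)
    then show "(\<lambda>k. rep (X (r k)) x) \<longlonglongrightarrow> rep l x" by (simp add: tendsto_rabs_zero_iff LIM_zero_iff)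
  qed
  then show ?thesis using r(1) by blast
qed

lemma ennreal_norm_cls:
  assumes "f \<in> sqint"
  shows "(\<integral>\<^sup>+x. ennreal ((f x)\<^sup>2) \<partial>lebesgue) = ennreal ((norm (cls f))\<^sup>2)"
  using nn_integral_eq_integral[OF sqint_integrable[OF assms]] by (simp add: norm_cls[OF assms])

text \<open>The weight \<open>2 ^ k\<close> forces \<open>\<bar>g k\<bar>\<close> below a constant
  times \<open>sqrt (1 / 2) ^ k\<close>: a bound on squares becomes absolute summability.\<close>

lemma summable_of_suminf_power2:
  fixes g :: "nat \<Rightarrow> real"
  assumes "(\<Sum>k. ennreal (2 ^ k * (g k)\<^sup>2)) \<noteq> \<infinity>"
  shows "summable (\<lambda>k. \<bar>g k\<bar>)"
proof -
  define C where "C = enn2real (\<Sum>k. ennreal (2 ^ k * (g k)\<^sup>2))"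
  have C: "(\<Sum>k. ennreal (2 ^ k * (g k)\<^sup>2)) = ennreal C" "C \<ge> 0" using assms by (simp_all add: C_def less_top)
  have gk: "\<bar>g k\<bar> \<le> sqrt C * (sqrt (1 / 2)) ^ k" for k
  proof -
    have "ennreal (2 ^ k * (g k)\<^sup>2) \<le> ennreal C"
    proof -
      have "(\<Sum>k\<in>{k}. ennreal (2 ^ k * (g k)\<^sup>2)) \<le> ennreal C"
        unfolding C(1)[symmetric] by (rule sum_le_suminf) auto
      then show ?thesis by (simp only: sum.insert finite.emptyI empty_iff not_False_eq_True sum.empty add_0_right)
    qed
    then have "2 ^ k * (g k)\<^sup>2 \<le> C" using C(2) by (simp only: ennreal_le_iff)
    then have "(g k)\<^sup>2 \<le> C * (1 / 2) ^ k" by (simp add: field_simps power_one_over)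
    then have "sqrt ((g k)\<^sup>2) \<le> sqrt (C * (1 / 2) ^ k)" by (rule real_sqrt_le_mono)
    then show ?thesis unfolding real_sqrt_abs real_sqrt_mult real_sqrt_power[of "1 / 2"] .
  qed
  have "sqrt (1 / 2) < sqrt 1" by (rule real_sqrt_less_mono) simp
  then have "summable (\<lambda>k. sqrt C * (sqrt (1 / 2)) ^ k)" by (intro summable_mult summable_geometric) simp
  then show ?thesis by (rule summable_comparison_test[rotated]) (use gk in auto)
qed

text \<open>Riesz-Fischer. Along a subsequence with steps below \<open>(1 / 2) ^ k\<close> the
  squared differences weighted by \<open>2 ^ k\<close> have finite total integral, so the
  representatives converge almost everywhere.\<close>

instance lsq :: (euclidean_space) complete_space
proof
  fix X :: "nat \<Rightarrow> 'a lsq"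
  assume "Cauchy X"
  have "\<exists>r::nat \<Rightarrow> nat. strict_mono r \<and> (\<forall>k. norm (X (r (Suc k)) - X (r k)) < (1 / 2) ^ k)"
  proof -
    have "\<exists>r::nat \<Rightarrow> nat. \<forall>n. (\<forall>m\<ge>r n. norm (X m - X (r n)) < (1 / 2) ^ n) \<and> r n < r (Suc n)"
    proof (rule dependent_nat_choice)
      show "\<exists>x. \<forall>m\<ge>x. norm (X m - X x) < (1 / 2) ^ 0"
        using CauchyD[OF \<open>Cauchy X\<close>, of 1] by auto
      fix x :: nat and n :: nat
      obtain N where "\<forall>m\<ge>N. \<forall>n'\<ge>N. norm (X m - X n') < (1 / 2) ^ Suc n"
        using CauchyD[OF \<open>Cauchy X\<close>, of "(1/2) ^ Suc n"] by auto
      then show "\<exists>y. (\<forall>m\<ge>y. norm (X m - X y) < (1 / 2) ^ Suc n) \<and> x < y"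
        by (intro exI[of _ "max N (Suc x)"]) auto
    qed
    then obtain r :: "nat \<Rightarrow> nat" where r: "\<And>n m. m \<ge> r n \<Longrightarrow> norm (X m - X (r n)) < (1 / 2) ^ n" "\<And>n. r n < r (Suc n)" by blast
    have "norm (X (r (Suc k)) - X (r k)) < (1 / 2) ^ k" for k by (rule r(1)) (simp add: r(2) less_imp_le)
    then show ?thesis using r(2) by (intro exI[of _ r]) (auto simp: strict_mono_Suc_iff)
  qed
  then obtain r :: "nat \<Rightarrow> nat" where r: "strict_mono r" "\<And>k. norm (X (r (Suc k)) - X (r k)) < (1 / 2) ^ k" by blast
  define f where "f k = rep (X (r k))" for k
  have f: "f k \<in> sqint" "cls (f k) = X (r k)" for k by (simp_all add: f_def rep_sqint cls_rep)
  have fm[measurable]: "f k \<in> borel_measurable lebesgue" for k using f(1) by (rule sqint_measurable)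
  have "(\<integral>\<^sup>+x. (\<Sum>k. ennreal (2 ^ k * (f (Suc k) x - f k x)\<^sup>2)) \<partial>lebesgue)
      = (\<Sum>k. \<integral>\<^sup>+x. ennreal (2 ^ k * (f (Suc k) x - f k x)\<^sup>2) \<partial>lebesgue)"
    by (rule nn_integral_suminf) measurable
  also have "\<dots> \<le> (\<Sum>k. ennreal ((1 / 2) ^ k))"
  proof (rule suminf_le)
    fix k
    have "(\<integral>\<^sup>+x. ennreal (2 ^ k * (f (Suc k) x - f k x)\<^sup>2) \<partial>lebesgue) = ennreal (2 ^ k) * (\<integral>\<^sup>+x. ennreal ((f (Suc k) x - f k x)\<^sup>2) \<partial>lebesgue)"
      by (subst nn_integral_cmult[symmetric]) (auto simp: ennreal_mult)
    also have "(\<integral>\<^sup>+x. ennreal ((f (Suc k) x - f k x)\<^sup>2) \<partial>lebesgue) = ennreal ((norm (X (r (Suc k)) - X (r k)))\<^sup>2)"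
      using ennreal_norm_cls[OF sqint_diff[OF f(1) f(1)], of "Suc k" k] by (simp add: cls_diff[symmetric] f)
    also have "\<dots> \<le> ennreal (((1 / 2) ^ k)\<^sup>2)"
      using r(2)[of k] by (intro ennreal_leI power_mono) auto
    also have "ennreal (2 ^ k) * ennreal (((1 / 2) ^ k)\<^sup>2) = ennreal ((1 / 2) ^ k)"
      by (simp add: ennreal_mult'[symmetric] power2_eq_square power_mult_distrib[symmetric] mult.assoc[symmetric] del: power_one_over)
    finally show "(\<integral>\<^sup>+x. ennreal (2 ^ k * (f (Suc k) x - f k x)\<^sup>2) \<partial>lebesgue) \<le> ennreal ((1 / 2) ^ k)"
      by (simp add: mult_left_mono)
  qed auto
  also have "\<dots> < \<infinity>"
    by (subst suminf_ennreal2) (auto intro: summable_geometric)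
  finally have "AE x in lebesgue. (\<Sum>k. ennreal (2 ^ k * (f (Suc k) x - f k x)\<^sup>2)) \<noteq> \<infinity>"
    by (intro nn_integral_PInf_AE) auto
  then have conv: "AE x in lebesgue. convergent (\<lambda>k. f k x)"
  proof eventually_elim
    fix x assume "(\<Sum>k. ennreal (2 ^ k * (f (Suc k) x - f k x)\<^sup>2)) \<noteq> \<infinity>"
    from summable_of_suminf_power2[OF this] have "summable (\<lambda>k. f (Suc k) x - f k x)" by (rule summable_rabs_cancel)
    then have "convergent (\<lambda>n. \<Sum>k<n. f (Suc k) x - f k x)" by (simp add: summable_iff_convergent)
    then have "convergent (\<lambda>n. f n x - f 0 x)"
      using sum_lessThan_telescope[of "\<lambda>k. f k x"] by simp
    then have "convergent (\<lambda>n. (f n x - f 0 x) + f 0 x)"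
      by (intro convergent_add convergent_const)
    then show "convergent (\<lambda>k. f k x)" by simp
  qed
  define F where "F x = lim (\<lambda>k. f k x)" for x
  have Fm[measurable]: "F \<in> borel_measurable lebesgue" unfolding F_def by measurable
  have lim: "AE x in lebesgue. (\<lambda>k. f k x) \<longlonglongrightarrow> F x"
    using conv by eventually_elim (simp add: F_def convergent_LIMSEQ_iff)
  \<comment> \<open>Fatou's lemma: a bound on the later differences passes to the pointwise limit.
    It yields both the square integrability of \<open>F\<close> and the convergence in norm.\<close>
  have bound: "(\<integral>\<^sup>+x. ennreal ((F x - f k x)\<^sup>2) \<partial>lebesgue) \<le> ennreal (e\<^sup>2)"
    if e: "\<And>j. j \<ge> k \<Longrightarrow> norm (X (r j) - X (r k)) \<le> e" for k e
  proof -
    have "(\<integral>\<^sup>+x. ennreal ((F x - f k x)\<^sup>2) \<partial>lebesgue) = (\<integral>\<^sup>+x. liminf (\<lambda>j. ennreal ((f j x - f k x)\<^sup>2)) \<partial>lebesgue)"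
    proof (rule nn_integral_cong_AE)
      show "AE x in lebesgue. ennreal ((F x - f k x)\<^sup>2) = liminf (\<lambda>j. ennreal ((f j x - f k x)\<^sup>2))"
        using lim
      proof eventually_elim
        fix x assume "(\<lambda>k. f k x) \<longlonglongrightarrow> F x"
        then have "(\<lambda>j. ennreal ((f j x - f k x)\<^sup>2)) \<longlonglongrightarrow> ennreal ((F x - f k x)\<^sup>2)"
          by (intro tendsto_ennrealI tendsto_intros)
        then show "ennreal ((F x - f k x)\<^sup>2) = liminf (\<lambda>j. ennreal ((f j x - f k x)\<^sup>2))"
          using lim_imp_Liminf[of sequentially "\<lambda>j. ennreal ((f j x - f k x)\<^sup>2)" "ennreal ((F x - f k x)\<^sup>2)"] by simp
      qed
    qed
    also have "\<dots> \<le> liminf (\<lambda>j. \<integral>\<^sup>+x. ennreal ((f j x - f k x)\<^sup>2) \<partial>lebesgue)"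
      by (rule nn_integral_liminf) measurable
    also have "\<dots> \<le> limsup (\<lambda>j. \<integral>\<^sup>+x. ennreal ((f j x - f k x)\<^sup>2) \<partial>lebesgue)"
      by (rule Liminf_le_Limsup) simp
    also have "\<dots> \<le> ennreal (e\<^sup>2)"
    proof (rule Limsup_bounded, unfold eventually_sequentially, intro exI[of _ k] allI impI)
      fix j assume "k \<le> j"
      have "(\<integral>\<^sup>+x. ennreal ((f j x - f k x)\<^sup>2) \<partial>lebesgue) = ennreal ((norm (X (r j) - X (r k)))\<^sup>2)"
        using ennreal_norm_cls[OF sqint_diff[OF f(1) f(1)], of j k] by (simp add: cls_diff[symmetric] f)
      also have "\<dots> \<le> ennreal (e\<^sup>2)" using e[OF \<open>k \<le> j\<close>] by (intro ennreal_leI power_mono) auto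
      finally show "(\<integral>\<^sup>+x. ennreal ((f j x - f k x)\<^sup>2) \<partial>lebesgue) \<le> ennreal (e\<^sup>2)" .
    qed
    finally show ?thesis .
  qed
  have cauchy: "\<exists>K. \<forall>k\<ge>K. \<forall>j\<ge>k. norm (X (r j) - X (r k)) \<le> e" if e0: "e > 0" for e
  proof -
    obtain M where M: "\<forall>m\<ge>M. \<forall>n\<ge>M. norm (X m - X n) < e" using CauchyD[OF \<open>Cauchy X\<close> e0] by blast
    have "norm (X (r j) - X (r k)) \<le> e" if "k \<ge> M" "j \<ge> k" for j k
    proof (rule less_imp_le, rule M[rule_format])
      show "r j \<ge> M" "r k \<ge> M" using seq_suble[OF r(1), of k] seq_suble[OF r(1), of j] that by linarith+
    qed
    then show ?thesis by blast
  qed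
  have Ff: "(\<lambda>x. F x - f k x) \<in> sqint" if "\<And>j. j \<ge> k \<Longrightarrow> norm (X (r j) - X (r k)) \<le> e" for k e
    using bound[OF that] unfolding sqint_def
    by (auto simp: integrable_iff_bounded intro: le_less_trans)
  obtain K where K: "\<And>k j. k \<ge> K \<Longrightarrow> j \<ge> k \<Longrightarrow> norm (X (r j) - X (r k)) \<le> 1" using cauchy[of 1] by auto
  have F: "F \<in> sqint" using sqint_add[OF Ff[OF K[of K]] f(1)[of K]] by simp
  have "(X \<circ> r) \<longlonglongrightarrow> cls F"
  proof (rule LIMSEQ_I)
    fix e :: real assume e: "0 < e"
    then obtain K where K: "\<And>k j. k \<ge> K \<Longrightarrow> j \<ge> k \<Longrightarrow> norm (X (r j) - X (r k)) \<le> e / 2" using cauchy[of "e/2"] by auto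
    have "norm (X (r k) - cls F) < e" if "k \<ge> K" for k
    proof -
      have "ennreal ((norm (cls F - X (r k)))\<^sup>2) \<le> ennreal ((e / 2)\<^sup>2)"
        using bound[OF K[OF that]] ennreal_norm_cls[OF sqint_diff[OF F f(1)[of k]]] by (simp add: cls_diff[symmetric] F f)
      then have "(norm (cls F - X (r k)))\<^sup>2 \<le> (e / 2)\<^sup>2"
        by (simp only: ennreal_le_iff zero_le_power2)
      then have "norm (cls F - X (r k)) \<le> e / 2" by (rule power2_le_imp_le) (use e in simp)
      then show ?thesis using e by (simp add: norm_minus_commute)
    qed
    then show "\<exists>no. \<forall>n\<ge>no. norm ((X \<circ> r) n - cls F) < e" by auto
  qed
  then show "convergent X"
    using Cauchy_converges_subseq[OF \<open>Cauchy X\<close> r(1)] by (auto simp: convergent_def)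
qed

section \<open>Test functions\<close>

definition grad :: "(real ^ 'n \<Rightarrow> real) \<Rightarrow> real ^ 'n \<Rightarrow> real ^ 'n" where
  "grad f x = (\<chi> i. partial_deriv i f x)"

lemma partial_deriv_eqI: "(f has_derivative D) (at x) \<Longrightarrow> partial_deriv i f x = D (axis i 1)"
  unfolding partial_deriv_def using frechet_derivative_at by metis

lemma C_k_continuous: "C_k k f \<Longrightarrow> continuous_on UNIV f"
  by (cases k) (auto intro: differentiable_imp_continuous_within simp: continuous_on_eq_continuous_at)

lemma C_k_SucD: "C_k (Suc k) f \<Longrightarrow> C_k k f"
proof (induction k arbitrary: f)
  case 0 then show ?case using C_k_continuous[OF 0] by simp
next
  case (Suc k)
  have "C_k (Suc k) (partial_deriv i f)" for i using Suc.prems unfolding C_k.simps(2)[of "Suc k" f] by blast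
  then have "C_k k (partial_deriv i f)" for i by (rule Suc.IH)
  then show ?case using Suc.prems by simp
qed

lemma C_k_const: "C_k k (\<lambda>x :: real ^ 'n. c)"
proof (induction k arbitrary: c)
  case (Suc k)
  have "partial_deriv i (\<lambda>x :: real ^ 'n. c) = (\<lambda>x. 0)" for i by (auto simp: partial_deriv_def)
  then show ?case using Suc by simp
qed simp

lemma C_k_add: "C_k k f \<Longrightarrow> C_k k g \<Longrightarrow> C_k k (\<lambda>x. f x + g x)"
proof (induction k arbitrary: f g)
  case 0 then show ?case by (auto intro: continuous_intros)
next
  case (Suc k)
  have d: "f differentiable at x" "g differentiable at x" for x using Suc.prems by auto
  have "partial_deriv i (\<lambda>x. f x + g x) = (\<lambda>x. partial_deriv i f x + partial_deriv i g x)" for i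
  proof
    fix x show "partial_deriv i (\<lambda>x. f x + g x) x = partial_deriv i f x + partial_deriv i g x"
      using has_derivative_add[OF d[of x, unfolded frechet_derivative_works]]
      by (subst partial_deriv_eqI) (auto simp: partial_deriv_def)
  qed
  then show ?case using Suc d by auto
qed

lemma partial_deriv_mult:
  assumes "f differentiable at x" "g differentiable at x"
  shows "partial_deriv i (\<lambda>x. f x * g x) x = f x * partial_deriv i g x + partial_deriv i f x * g x"
  using has_derivative_mult[OF assms[unfolded frechet_derivative_works]]
  by (subst partial_deriv_eqI) (auto simp: partial_deriv_def)

lemma C_k_mult: "C_k k f \<Longrightarrow> C_k k g \<Longrightarrow> C_k k (\<lambda>x. f x * g x)"
proof (induction k arbitrary: f g)
  case 0 then show ?case by (auto intro: continuous_intros)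
next
  case (Suc k)
  have d: "f differentiable at x" "g differentiable at x" for x using Suc.prems by auto
  have "C_k k f" "C_k k g" using Suc.prems by (auto intro: C_k_SucD)
  then have "C_k k (\<lambda>x. f x * partial_deriv i g x + partial_deriv i f x * g x)" for i
    using Suc.prems by (intro C_k_add Suc.IH) auto
  moreover have "partial_deriv i (\<lambda>x. f x * g x) = (\<lambda>x. f x * partial_deriv i g x + partial_deriv i f x * g x)" for i
    using partial_deriv_mult[OF d] by auto
  ultimately show ?case using d by auto
qed

lemma C_k_prod: "(\<And>i. i \<in> I \<Longrightarrow> C_k k (f i)) \<Longrightarrow> C_k k (\<lambda>x. \<Prod>i\<in>I. f i x)"
  by (induction I rule: infinite_finite_induct) (auto intro: C_k_const C_k_mult)

lemma
  assumes "\<phi> \<in> test_functions \<Omega>"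
  shows test_differentiable: "\<phi> differentiable at x"
    and test_continuous: "continuous_on A \<phi>"
    and test_support: "compact (closure {x. \<phi> x \<noteq> 0})"
    and test_outside: "x \<notin> \<Omega> \<Longrightarrow> \<phi> x = 0"
proof -
  have C: "C_k k \<phi>" for k using assms by (auto simp: test_functions_def)
  show "\<phi> differentiable at x" using C[of 1] by simp
  show "continuous_on A \<phi>" using C_k_continuous[OF C] continuous_on_subset by blast
  show "compact (closure {x. \<phi> x \<noteq> 0})" using assms by (auto simp: test_functions_def)
  show "\<phi> x = 0" if "x \<notin> \<Omega>"
  proof (rule ccontr)
    assume "\<phi> x \<noteq> 0"
    then have "x \<in> closure {x. \<phi> x \<noteq> 0}" by (intro subsetD[OF closure_subset]) simp
    then show False using that assms by (auto simp: test_functions_def)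
  qed
qed

lemma test_functionsI:
  assumes "\<And>k. C_k k \<phi>" "\<And>x. x \<notin> S \<Longrightarrow> \<phi> x = 0" "compact S" "S \<subseteq> \<Omega>"
  shows "\<phi> \<in> test_functions \<Omega>"
proof -
  have "closure {x. \<phi> x \<noteq> 0} \<subseteq> S"
    using assms(2) by (intro closure_minimal compact_imp_closed[OF assms(3)]) auto
  moreover have "closed (closure {x. \<phi> x \<noteq> 0})" by simp
  ultimately have "compact (closure {x. \<phi> x \<noteq> 0})" using compact_Int_closed[OF assms(3)] by (metis Int_absorb1)
  then show ?thesis using assms \<open>closure {x. \<phi> x \<noteq> 0} \<subseteq> S\<close> by (auto simp: test_functions_def)
qed

lemma zero_outside_support: "x \<notin> closure {x. f x \<noteq> 0} \<Longrightarrow> f x = 0"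
  using closure_subset[of "{x. f x \<noteq> 0}"] by auto

lemma test_partial:
  assumes "\<phi> \<in> test_functions \<Omega>"
  shows "partial_deriv i \<phi> \<in> test_functions \<Omega>"
proof (rule test_functionsI)
  let ?S = "closure {x. \<phi> x \<noteq> 0}"
  show "C_k k (partial_deriv i \<phi>)" for k
    using assms C_k.simps(2)[of k \<phi>] by (auto simp: test_functions_def)
  show "compact ?S" "?S \<subseteq> \<Omega>" using assms by (auto simp: test_functions_def)
  show "partial_deriv i \<phi> x = 0" if "x \<notin> ?S" for x
  proof -
    have "(\<phi> has_derivative (\<lambda>_. 0)) (at x)"
    proof (rule has_derivative_transform_within_open[of "\<lambda>_. 0" _ x UNIV "- ?S"])
      show "0 = \<phi> y" if "y \<in> - ?S" for y using that closure_subset[of "{x. \<phi> x \<noteq> 0}"] by auto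
    qed (use that in auto)
    from partial_deriv_eqI[OF this] show ?thesis by simp
  qed
qed

lemma test_mult_C_k:
  assumes "\<phi> \<in> test_functions \<Omega>" "\<And>k. C_k k g"
  shows "(\<lambda>x. g x * \<phi> x) \<in> test_functions \<Omega>"
proof (rule test_functionsI)
  show "C_k k (\<lambda>x. g x * \<phi> x)" for k using assms by (intro C_k_mult) (auto simp: test_functions_def)
  show "g x * \<phi> x = 0" if "x \<notin> closure {x. \<phi> x \<noteq> 0}" for x using that closure_subset[of "{x. \<phi> x \<noteq> 0}"] by auto
qed (use assms in \<open>auto simp: test_functions_def\<close>)

lemma test_mult:
  "\<phi> \<in> test_functions \<Omega> \<Longrightarrow> \<psi> \<in> test_functions \<Omega> \<Longrightarrow> (\<lambda>x. \<phi> x * \<psi> x) \<in> test_functions \<Omega>"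
  by (rule test_mult_C_k) (auto simp: test_functions_def)

lemma test_scale: "\<phi> \<in> test_functions \<Omega> \<Longrightarrow> (\<lambda>x. c * \<phi> x) \<in> test_functions \<Omega>"
  by (rule test_mult_C_k[OF _ C_k_const])

lemma test_add:
  assumes "\<phi> \<in> test_functions \<Omega>" "\<psi> \<in> test_functions \<Omega>"
  shows "(\<lambda>x. \<phi> x + \<psi> x) \<in> test_functions \<Omega>"
proof (rule test_functionsI)
  let ?S = "closure {x. \<phi> x \<noteq> 0}" and ?T = "closure {x. \<psi> x \<noteq> 0}"
  show "C_k k (\<lambda>x. \<phi> x + \<psi> x)" for k using assms by (intro C_k_add) (auto simp: test_functions_def)
  show "\<phi> x + \<psi> x = 0" if "x \<notin> ?S \<union> ?T" for x
    using that zero_outside_support[of x \<phi>] zero_outside_support[of x \<psi>] by simp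
  show "compact (?S \<union> ?T)" "?S \<union> ?T \<subseteq> \<Omega>" using assms by (auto simp: test_functions_def)
qed

lemma test_zero: "(\<lambda>x. 0) \<in> test_functions \<Omega>"
  by (rule test_functionsI[of _ "{}"]) (auto intro: C_k_const)

lemma test_partial_add:
  assumes "\<phi> \<in> test_functions \<Omega>" "\<psi> \<in> test_functions \<Omega>"
  shows "partial_deriv i (\<lambda>x. \<phi> x + \<psi> x) = (\<lambda>x. partial_deriv i \<phi> x + partial_deriv i \<psi> x)"
proof
  fix x show "partial_deriv i (\<lambda>x. \<phi> x + \<psi> x) x = partial_deriv i \<phi> x + partial_deriv i \<psi> x"
    using has_derivative_add[OF assms[THEN test_differentiable, unfolded frechet_derivative_works]]
    by (subst partial_deriv_eqI) (auto simp: partial_deriv_def)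
qed

lemma test_partial_scale:
  assumes "\<phi> \<in> test_functions \<Omega>"
  shows "partial_deriv i (\<lambda>x. c * \<phi> x) = (\<lambda>x. c * partial_deriv i \<phi> x)"
proof
  fix x show "partial_deriv i (\<lambda>x. c * \<phi> x) x = c * partial_deriv i \<phi> x"
    using has_derivative_mult_right[OF test_differentiable[OF assms, unfolded frechet_derivative_works], of c]
    by (subst partial_deriv_eqI) (auto simp: partial_deriv_def)
qed

lemma continuous_compact_support_integrable:
  fixes f :: "'a::euclidean_space \<Rightarrow> real"
  assumes "continuous_on UNIV f" "compact S" "\<And>x. x \<notin> S \<Longrightarrow> f x = 0"
  shows "integrable lborel f" and "integrable lebesgue f"
proof -
  have "integrable lborel (\<lambda>x. indicator S x *\<^sub>R f x)"
    by (rule borel_integrable_compact[OF assms(2) continuous_on_subset[OF assms(1)]]) simp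
  also have "(\<lambda>x. indicator S x *\<^sub>R f x) = f"
  proof
    fix x show "indicator S x *\<^sub>R f x = f x" using assms(3)[of x] by (cases "x \<in> S") auto
  qed
  finally show "integrable lborel f" .
  then show "integrable lebesgue f" by (subst integrable_completion) (auto dest: borel_measurable_integrable)
qed

lemma test_measurable:
  assumes "\<phi> \<in> test_functions \<Omega>"
  shows "\<phi> \<in> borel_measurable borel"
  by (rule borel_measurable_continuous_onI[OF test_continuous[OF assms]])

lemma test_integrable:
  assumes "\<phi> \<in> test_functions \<Omega>"
  shows "integrable lborel \<phi>" and "integrable lebesgue \<phi>"
  using closure_subset[of "{x. \<phi> x \<noteq> 0}"]
  by (auto intro!: continuous_compact_support_integrable[OF test_continuous[OF assms] test_support[OF assms]])

lemma test_sqint: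
  assumes "\<phi> \<in> test_functions \<Omega>"
  shows "\<phi> \<in> sqint"
proof (rule sqintI)
  show "\<phi> \<in> borel_measurable lebesgue" using test_integrable(2)[OF assms] by (rule borel_measurable_integrable)
  show "integrable lebesgue (\<lambda>x. (\<phi> x)\<^sup>2)"
    unfolding power2_eq_square using test_integrable(2)[OF test_mult[OF assms assms]] .
qed

lemma test_bounded:
  assumes "\<phi> \<in> test_functions \<Omega>"
  obtains B where "B \<ge> 0" "\<And>x. \<bar>\<phi> x\<bar> \<le> B"
proof -
  let ?S = "closure {x. \<phi> x \<noteq> 0}"
  have "bounded (\<phi> ` ?S)"
    by (intro compact_imp_bounded compact_continuous_image test_continuous[OF assms] test_support[OF assms])
  then obtain B where B: "\<And>x. x \<in> ?S \<Longrightarrow> \<bar>\<phi> x\<bar> \<le> B" by (auto simp: bounded_iff)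
  have "\<bar>\<phi> x\<bar> \<le> max 0 B" for x
  proof (cases "\<phi> x = 0")
    case False
    then have "x \<in> ?S" using closure_subset[of "{x. \<phi> x \<noteq> 0}"] by auto
    then show ?thesis using B by fastforce
  qed simp
  then show ?thesis using that[of "max 0 B"] by simp
qed

lemma line_derivative:
  assumes "f differentiable at (x + t *\<^sub>R v)"
  shows "((\<lambda>t. f (x + t *\<^sub>R v)) has_real_derivative inner (grad f (x + t *\<^sub>R v)) v) (at t)"
proof -
  let ?D = "frechet_derivative f (at (x + t *\<^sub>R v))"
  have D: "(f has_derivative ?D) (at (x + t *\<^sub>R v))" using assms by (simp add: frechet_derivative_works)
  interpret D: bounded_linear ?D using has_derivative_bounded_linear[OF D] .
  have "?D v = ?D (\<Sum>i\<in>UNIV. v $ i *\<^sub>R axis i 1)" using basis_expansion[of v] by (simp add: scalar_mult_eq_scaleR)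
  also have "\<dots> = inner (grad f (x + t *\<^sub>R v)) v"
    by (simp add: D.sum D.scaleR grad_def inner_vec_def partial_deriv_def mult.commute)
  finally have Dv: "?D v = inner (grad f (x + t *\<^sub>R v)) v" .
  have "((\<lambda>t. x + t *\<^sub>R v) has_derivative (\<lambda>s. s *\<^sub>R v)) (at t)" by (auto intro!: derivative_eq_intros)
  from has_derivative_compose[OF this D] show ?thesis
    unfolding has_field_derivative_def by (simp add: D.scaleR Dv mult.commute[of _ "inner _ _"])
qed

lemma partial_line_derivative:
  assumes "f differentiable at (x + t *\<^sub>R axis i 1)"
  shows "((\<lambda>t. f (x + t *\<^sub>R axis i 1)) has_real_derivative partial_deriv i f (x + t *\<^sub>R axis i 1)) (at t)"
  using line_derivative[OF assms] by (simp add: inner_axis grad_def)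

section \<open>Integration by parts for test functions\<close>

lemma integral_translate:
  fixes f :: "'a::euclidean_space \<Rightarrow> real"
  assumes "f \<in> borel_measurable borel"
  shows "(\<integral>x. f (x + a) \<partial>lborel) = (\<integral>x. f x \<partial>lborel)"
proof -
  have "(\<integral>x. f x \<partial>lborel) = (\<integral>x. f x \<partial>distr lborel borel ((+) a))" by (simp add: lborel_distr_plus)
  also have "\<dots> = (\<integral>x. f (a + x) \<partial>lborel)" using assms by (subst integral_distr) auto
  finally show ?thesis by (simp add: add.commute)
qed

text \<open>Difference quotients have integral 0 by translation invariance. The mean value theorem
  dominates them by the bound \<open>B\<close> of the derivative, on a ball enlarged by 1 because
  the step is at most 1.\<close>

lemma integral_partial_deriv_zero:
  fixes \<phi> :: "real ^ 'n \<Rightarrow> real"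
  assumes \<phi>: "\<phi> \<in> test_functions \<Omega>"
  shows "(\<integral>x. partial_deriv i \<phi> x \<partial>lebesgue) = 0"
proof -
  let ?e = "axis i 1 :: real ^ 'n"
  define h where "h n = 1 / real (Suc n)" for n
  define s where "s n x = (\<phi> (x + h n *\<^sub>R ?e) - \<phi> x) / h n" for n x
  note d\<phi> = test_partial[OF \<phi>, of i]
  have [measurable]: "\<phi> \<in> borel_measurable borel" "partial_deriv i \<phi> \<in> borel_measurable borel"
    using test_measurable \<phi> d\<phi> by auto
  obtain B where B: "B \<ge> 0" "\<And>x. \<bar>partial_deriv i \<phi> x\<bar> \<le> B" using test_bounded[OF d\<phi>] by blast
  obtain R where R: "\<And>x. x \<in> closure {x. \<phi> x \<noteq> 0} \<Longrightarrow> norm x \<le> R"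
    using compact_imp_bounded[OF test_support[OF \<phi>]] by (auto simp: bounded_iff)
  have out: "\<phi> x = 0" if "norm x > R" for x using R[of x] closure_subset[of "{x. \<phi> x \<noteq> 0}"] that by fastforce
  have h: "0 < h n" "h n \<le> 1" for n by (auto simp: h_def)
  have "(\<lambda>n. \<integral>x. s n x \<partial>lborel) \<longlonglongrightarrow> (\<integral>x. partial_deriv i \<phi> x \<partial>lborel)"
  proof (rule integral_dominated_convergence[where w = "\<lambda>x. B * indicator (cball 0 (R + 1)) x"])
    have "integrable lborel (indicator (cball 0 (R + 1)) :: real ^ 'n \<Rightarrow> real)"
      using emeasure_bounded_finite[of "cball (0 :: real ^ 'n) (R + 1)"] by (subst integrable_indicator_iff) auto
    then show "integrable lborel (\<lambda>x :: real ^ 'n. B * indicator (cball 0 (R + 1)) x :: real)" by simp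
    show "AE x in lborel. (\<lambda>n. s n x) \<longlonglongrightarrow> partial_deriv i \<phi> x"
    proof (rule AE_I2)
      fix x
      have "((\<lambda>t. \<phi> (x + t *\<^sub>R ?e)) has_real_derivative partial_deriv i \<phi> x) (at 0)"
        using partial_line_derivative[of \<phi> x 0 i] test_differentiable[OF \<phi>] by simp
      then have "((\<lambda>t. (\<phi> (x + t *\<^sub>R ?e) - \<phi> x) / t) \<longlongrightarrow> partial_deriv i \<phi> x) (at 0)"
        by (simp add: DERIV_def)
      moreover have "filterlim h (at 0) sequentially"
      proof -
        have "h \<longlonglongrightarrow> 0" using LIMSEQ_Suc[OF lim_1_over_n[where 'a = real]] by (simp add: h_def[abs_def])
        moreover have "h n \<noteq> 0" for n using h[of n] by simp
        ultimately show ?thesis unfolding filterlim_at by simp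
      qed
      ultimately show "(\<lambda>n. s n x) \<longlonglongrightarrow> partial_deriv i \<phi> x" unfolding s_def by (rule filterlim_compose)
    qed
    fix n
    show "AE x in lborel. norm (s n x) \<le> B * indicator (cball 0 (R + 1)) x"
    proof (rule AE_I2)
      fix x
      show "norm (s n x) \<le> B * indicator (cball 0 (R + 1)) x"
      proof (cases "norm x \<le> R + 1")
        case True
        have "\<exists>z. 0 < z \<and> z < h n \<and> \<phi> (x + h n *\<^sub>R ?e) - \<phi> (x + 0 *\<^sub>R ?e) = (h n - 0) * partial_deriv i \<phi> (x + z *\<^sub>R ?e)"
          using h[of n] by (intro MVT2 partial_line_derivative test_differentiable[OF \<phi>])
        then obtain z where "s n x = partial_deriv i \<phi> (x + z *\<^sub>R ?e)" using h[of n] by (auto simp: s_def)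
        then show ?thesis using True B(2) by simp
      next
        case False
        have "norm x \<le> norm (x + h n *\<^sub>R ?e) + norm (h n *\<^sub>R ?e)"
          using norm_triangle_ineq4[of "x + h n *\<^sub>R ?e" "h n *\<^sub>R ?e"] by simp
        also have "norm (h n *\<^sub>R ?e) \<le> 1" using h[of n] by simp
        finally have "norm (x + h n *\<^sub>R ?e) > R" using False by simp
        then show ?thesis using False out[of x] out[of "x + h n *\<^sub>R ?e"] by (simp add: s_def)
      qed
    qed
    show "s n \<in> borel_measurable lborel" unfolding s_def by measurable
  qed measurable
  moreover have "(\<integral>x. s n x \<partial>lborel) = 0" for n
  proof -
    have t: "integrable lborel (\<lambda>x. \<phi> (x + h n *\<^sub>R ?e))"
      using integrable_distr[of "(+) (h n *\<^sub>R ?e)" lborel borel \<phi>] test_integrable(1)[OF \<phi>]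
      by (simp add: lborel_distr_plus add.commute)
    have "(\<integral>x. s n x \<partial>lborel) = ((\<integral>x. \<phi> (x + h n *\<^sub>R ?e) \<partial>lborel) - (\<integral>x. \<phi> x \<partial>lborel)) / h n"
      unfolding s_def using t test_integrable(1)[OF \<phi>] by simp
    then show ?thesis by (simp add: integral_translate)
  qed
  ultimately have "(\<integral>x. partial_deriv i \<phi> x \<partial>lborel) = 0" by (simp add: LIMSEQ_const_iff)
  then show ?thesis by (subst integral_completion) auto
qed

lemma test_integration_by_parts:
  assumes "\<phi> \<in> test_functions \<Omega>" "\<psi> \<in> test_functions \<Omega>"
  shows "(\<integral>x. \<phi> x * partial_deriv i \<psi> x \<partial>lebesgue) = - (\<integral>x. partial_deriv i \<phi> x * \<psi> x \<partial>lebesgue)"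
proof -
  have "0 = (\<integral>x. partial_deriv i (\<lambda>x. \<phi> x * \<psi> x) x \<partial>lebesgue)"
    using integral_partial_deriv_zero[OF test_mult[OF assms]] by simp
  also have "\<dots> = (\<integral>x. \<phi> x * partial_deriv i \<psi> x + partial_deriv i \<phi> x * \<psi> x \<partial>lebesgue)"
    by (simp add: partial_deriv_mult[OF assms[THEN test_differentiable]])
  also have "\<dots> = (\<integral>x. \<phi> x * partial_deriv i \<psi> x \<partial>lebesgue) + (\<integral>x. partial_deriv i \<phi> x * \<psi> x \<partial>lebesgue)"
    using assms by (intro Bochner_Integration.integral_add sqint_mult_integrable test_sqint test_partial)
  finally show ?thesis by simp
qed

section \<open>The fundamental lemma of the calculus of variations\<close>

text \<open>The shape \<open>P(1/t) exp(-c/t)\<close> is stable under differentiation, which makes the smoothness induction work.\<close>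

definition flat :: "real poly \<Rightarrow> real \<Rightarrow> real \<Rightarrow> real" where
  "flat P c t = (if t \<le> 0 then 0 else poly P (1 / t) * exp (- (c / t)))"

text \<open>The extra power \<open>s ^ n\<close> strengthens the induction on the polynomial:
  passing from \<open>pCons a P\<close> to \<open>P\<close> costs one factor
  \<open>s\<close>.\<close>

lemma poly_exp_tendsto_0:
  fixes c :: real
  assumes "0 < c"
  shows "((\<lambda>s. s ^ n * poly P s * exp (- (c * s))) \<longlongrightarrow> 0) at_top"
proof (induction P arbitrary: n)
  case 0 then show ?case by simp
next
  case (pCons a P)
  have "filterlim (\<lambda>s. c * s) at_top at_top"
    by (rule filterlim_tendsto_pos_mult_at_top[OF tendsto_const assms]) (rule filterlim_ident)
  from filterlim_compose[OF tendsto_power_div_exp_0 this, of n]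
  have "((\<lambda>s. a / c ^ n * ((c * s) ^ n / exp (c * s))) \<longlongrightarrow> a / c ^ n * 0) at_top" by (intro tendsto_intros)
  moreover have "a / c ^ n * ((c * s) ^ n / exp (c * s)) = a * s ^ n * exp (- (c * s))" for s
    using assms by (simp add: exp_minus field_simps power_mult_distrib)
  ultimately have "((\<lambda>s. a * s ^ n * exp (- (c * s))) \<longlongrightarrow> 0) at_top" by simp
  from tendsto_add[OF this pCons.IH[of "Suc n"]] show ?case by (simp add: algebra_simps)
qed

text \<open>The chain rule for \<open>1 / t\<close> produces the factor
  \<open>(1 / t)\<^sup>2\<close>, hence the polynomial \<open>[:0, 0, 1:]\<close>; the exponential
  contributes \<open>c * P\<close> and the polynomial \<open>- pderiv P\<close>. At 0 the difference
  quotient from the right is again a polynomial in \<open>1 / t\<close> times the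
  exponential.\<close>

lemma DERIV_flat:
  assumes c: "0 < c"
  shows "DERIV (flat P c) t :> flat ([:0, 0, 1:] * (smult c P - pderiv P)) c t"
proof -
  consider "t < 0" | "t = 0" | "t > 0" by linarith
  then show ?thesis
  proof cases
    case 1
    have "DERIV (\<lambda>_. 0) t :> (0::real)" by simp
    then have "DERIV (flat P c) t :> 0"
      by (rule has_field_derivative_transform_within_open[of _ _ _ "{..<0}"]) (use 1 in \<open>auto simp: flat_def\<close>)
    then show ?thesis using 1 by (simp add: flat_def)
  next
    case 3
    have "DERIV (\<lambda>t. poly P (1 / t) * exp (- (c / t))) t :>
        poly P (1 / t) * (exp (- (c / t)) * (c / t\<^sup>2)) + poly (pderiv P) (1 / t) * (- 1 / t\<^sup>2) * exp (- (c / t))"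
      using 3 by (auto intro!: derivative_eq_intros simp: power2_eq_square)
    then have "DERIV (flat P c) t :>
        poly P (1 / t) * (exp (- (c / t)) * (c / t\<^sup>2)) + poly (pderiv P) (1 / t) * (- 1 / t\<^sup>2) * exp (- (c / t))"
      by (rule has_field_derivative_transform_within_open[of _ _ _ "{0<..}"]) (use 3 in \<open>auto simp: flat_def\<close>)
    then show ?thesis using 3 by (simp add: flat_def power2_eq_square field_simps)
  next
    case 2
    have "((\<lambda>h. flat P c h / h) \<longlongrightarrow> 0) (at_right 0)"
    proof (rule Lim_transform_eventually)
      show "((\<lambda>h. (inverse h) ^ 1 * poly P (inverse h) * exp (- (c * inverse h))) \<longlongrightarrow> 0) (at_right 0)"
        by (rule filterlim_compose[OF poly_exp_tendsto_0[OF c] filterlim_inverse_at_top_right])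
      show "\<forall>\<^sub>F h in at_right 0. (inverse h) ^ 1 * poly P (inverse h) * exp (- (c * inverse h)) = flat P c h / h"
        unfolding eventually_at_right_field by (intro exI[of _ 1]) (auto simp: flat_def field_simps)
    qed
    moreover have "((\<lambda>h. flat P c h / h) \<longlongrightarrow> 0) (at_left 0)"
      by (rule Lim_transform_eventually[OF tendsto_const])
         (auto simp: eventually_at_left_field flat_def intro!: exI[of _ "-1"])
    ultimately have "((\<lambda>h. flat P c h / h) \<longlongrightarrow> 0) (at 0)" by (simp add: filterlim_split_at)
    then show ?thesis using 2 by (simp add: DERIV_def flat_def)
  qed
qed

lemma C_k_flat:
  assumes c: "0 < c"
  shows "C_k k (\<lambda>x :: real ^ 'n. flat P c (a * x $ i + b))"
proof (induction k arbitrary: P)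
  case 0
  have "continuous_on UNIV (flat P c)" using DERIV_isCont[OF DERIV_flat[OF c]] by (simp add: continuous_on_eq_continuous_at)
  then show ?case by (auto intro!: continuous_on_compose2[of UNIV "flat P c"] continuous_intros)
next
  case (Suc k)
  define Q where "Q = [:0, 0, 1:] * (smult c P - pderiv P)"
  have D: "((\<lambda>x :: real ^ 'n. flat P c (a * x $ i + b)) has_derivative (\<lambda>v. flat Q c (a * x $ i + b) * (a * v $ i))) (at x)" for x
  proof -
    have "((\<lambda>x :: real ^ 'n. a * x $ i + b) has_derivative (\<lambda>v. a * v $ i)) (at x)"
      by (auto intro!: derivative_eq_intros bounded_linear_imp_has_derivative bounded_linear_vec_nth)
    from has_derivative_compose[OF this DERIV_flat[OF c, unfolded has_field_derivative_def]] show ?thesis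
      by (simp add: Q_def mult_ac)
  qed
  have "partial_deriv j (\<lambda>x :: real ^ 'n. flat P c (a * x $ i + b)) = (\<lambda>x. (if i = j then a else 0) * flat Q c (a * x $ i + b))" for j
  proof
    fix x :: "real ^ 'n"
    show "partial_deriv j (\<lambda>x :: real ^ 'n. flat P c (a * x $ i + b)) x = (if i = j then a else 0) * flat Q c (a * x $ i + b)"
      by (subst partial_deriv_eqI[OF D]) (auto simp: axis_def)
  qed
  moreover have "C_k k (\<lambda>x. (if i = j then a else 0) * flat Q c (a * x $ i + b))" for j :: 'n
    by (intro C_k_mult C_k_const Suc)
  ultimately show ?case using D differentiable_def by (auto simp: differentiable_def)
qed

text \<open>A smooth cutoff for the open box, which tends to its indicator as \<open>c\<close>
  decreases to 0. The arguments are written as \<open>1 * x $ i + _\<close> and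
  \<open>(-1) * x $ i + _\<close> to fit the affine form in \<open>C_k_flat\<close>.\<close>

definition bump :: "real \<Rightarrow> real ^ 'n \<Rightarrow> real ^ 'n \<Rightarrow> real ^ 'n \<Rightarrow> real" where
  "bump c a b x = (\<Prod>i\<in>UNIV. flat 1 c (1 * x $ i + (- a $ i)) * flat 1 c ((-1) * x $ i + b $ i))"

lemma flat_1_range: "0 < c \<Longrightarrow> 0 \<le> flat 1 c t \<and> flat 1 c t \<le> 1"
  by (auto simp: flat_def)

lemma bump_outside:
  assumes "x \<notin> box a b"
  shows "bump c a b x = 0"
proof -
  obtain i where "\<not> (a $ i < x $ i \<and> x $ i < b $ i)" using assms by (auto simp: mem_box_cart)
  then have "flat 1 c (1 * x $ i + (- a $ i)) * flat 1 c ((-1) * x $ i + b $ i) = 0" by (auto simp: flat_def)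
  then show ?thesis unfolding bump_def by (intro prod_zero) auto
qed

lemma bump_test:
  assumes "0 < c" "cbox a b \<subseteq> \<Omega>"
  shows "bump c a b \<in> test_functions \<Omega>"
proof (rule test_functionsI[of _ "cbox a b"])
  show "C_k k (bump c a b)" for k
    unfolding bump_def by (intro C_k_prod C_k_mult C_k_flat assms)
  show "bump c a b x = 0" if "x \<notin> cbox a b" for x
    using that box_subset_cbox[of a b] by (intro bump_outside) auto
qed (use assms in auto)

lemma bump_range: "0 < c \<Longrightarrow> 0 \<le> bump c a b x \<and> bump c a b x \<le> 1"
  unfolding bump_def using flat_1_range
  by (auto intro!: prod_nonneg prod_le_1 mult_nonneg_nonneg mult_le_one)

lemma bump_tendsto_indicator: "(\<lambda>n. bump (1 / real (Suc n)) a b x) \<longlonglongrightarrow> indicator (box a b) x"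
proof (cases "x \<in> box a b")
  case True
  have f: "(\<lambda>n. flat 1 (1 / real (Suc n)) t) \<longlonglongrightarrow> 1" if "t > 0" for t
  proof -
    have "(\<lambda>n. exp (- (1 / real (Suc n) / t))) \<longlonglongrightarrow> exp (- (0 / t))"
      using that by (intro tendsto_intros LIMSEQ_Suc[OF lim_1_over_n]) auto
    then show ?thesis using that by (simp add: flat_def)
  qed
  have "(\<lambda>n. bump (1 / real (Suc n)) a b x) \<longlonglongrightarrow> (\<Prod>i\<in>(UNIV :: 'a set). 1 * 1)"
    unfolding bump_def using True by (intro tendsto_prod tendsto_mult f) (auto simp: mem_box_cart)
  then show ?thesis using True by simp
qed (simp add: bump_outside)

text \<open>\<open>ennreal\<close> truncates negative values to 0, so \<open>M f\<close> and
  \<open>M (\<lambda>x. - f x)\<close> have the positive and the negative part of \<open>f\<close>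
  as densities. They agree on boxes, an intersection-stable generator, hence everywhere, which
  forces both parts to vanish.\<close>

lemma AE_zero_if_box_integrals_zero:
  fixes f :: "'a::euclidean_space \<Rightarrow> real"
  assumes f: "integrable lborel f" and zero: "\<And>a b. (\<integral>x. f x * indicator (box a b) x \<partial>lborel) = 0"
  shows "AE x in lborel. f x = 0"
proof -
  have [measurable]: "f \<in> borel_measurable borel" using f by auto
  define M where "M g = density lborel (\<lambda>x. ennreal (g x))" for g :: "'a \<Rightarrow> real"
  have "M f = M (\<lambda>x. - f x)"
  proof (rule measure_eqI_generator_eq)
    let ?E = "range (\<lambda>(a, b). box a b::'a set)"
    show "Int_stable ?E" by (auto simp: Int_stable_def box_Int_box)
    show "?E \<subseteq> Pow UNIV" "sets (M f) = sigma_sets UNIV ?E" "sets (M (\<lambda>x. - f x)) = sigma_sets UNIV ?E"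
      by (simp_all add: borel_eq_box M_def)
    let ?A = "\<lambda>n::nat. box (- (real n *\<^sub>R One)) (real n *\<^sub>R One) :: 'a set"
    show "range ?A \<subseteq> ?E" "(\<Union>i. ?A i) = UNIV" unfolding UN_box_eq_UNIV by auto
    have m: "emeasure (M f) (box a b) = emeasure (M (\<lambda>x. - f x)) (box a b) \<and> emeasure (M f) (box a b) \<noteq> \<infinity>" for a b
    proof -
      define F where "F x = f x * indicator (box a b) x" for x
      have F: "integrable lborel F"
        unfolding F_def using integrable_mult_indicator[of "box a b" lborel f] f by (simp add: mult.commute)
      have e1: "emeasure (M f) (box a b) = (\<integral>\<^sup>+x. ennreal (F x) \<partial>lborel)"
        unfolding M_def by (subst emeasure_density) (auto simp: F_def indicator_def intro!: nn_integral_cong)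
      have e2: "emeasure (M (\<lambda>x. - f x)) (box a b) = (\<integral>\<^sup>+x. ennreal (- F x) \<partial>lborel)"
        unfolding M_def by (subst emeasure_density) (auto simp: F_def indicator_def intro!: nn_integral_cong)
      have fin: "(\<integral>\<^sup>+x. ennreal (F x) \<partial>lborel) \<noteq> \<infinity>" "(\<integral>\<^sup>+x. ennreal (- F x) \<partial>lborel) \<noteq> \<infinity>"
        using F real_integrable_def by auto
      have "0 = enn2real (\<integral>\<^sup>+x. ennreal (F x) \<partial>lborel) - enn2real (\<integral>\<^sup>+x. ennreal (- F x) \<partial>lborel)"
        using zero[of a b, folded F_def] real_lebesgue_integral_def[OF F] by simp
      then show ?thesis unfolding e1 e2 using fin
        by (metis diff_eq_eq add_0 ennreal_enn2real_if infinity_ennreal_def)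
    qed
    then show "emeasure (M f) (?A i) \<noteq> \<infinity>" for i by blast
    show "emeasure (M f) X = emeasure (M (\<lambda>x. - f x)) X" if "X \<in> ?E" for X using m that by auto
  qed
  then have "AE x in lborel. ennreal (f x) = ennreal (- f x)"
    unfolding M_def by (subst (asm) sigma_finite_measure.density_unique_iff[OF sigma_finite_lborel]) auto
  then show ?thesis
  proof eventually_elim
    fix x assume "ennreal (f x) = ennreal (- f x)"
    then show "f x = 0" by (cases "f x \<ge> 0") (auto simp: ennreal_neg ennreal_eq_0_iff dest: sym)
  qed
qed

text \<open>Letting \<open>bump\<close> tend to indicators shows that \<open>g\<close> integrates to
  0 over every box whose closure lies in the domain. The box criterion applied to \<open>g\<close>
  cut off to such a box, together with a countable cover of the domain, gives the claim.\<close>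

lemma fundamental_lemma:
  fixes g :: "real ^ 'n \<Rightarrow> real"
  assumes g: "g \<in> sqint" and "open \<Omega>" and zero: "\<And>\<phi>. \<phi> \<in> test_functions \<Omega> \<Longrightarrow> (\<integral>x. g x * \<phi> x \<partial>lebesgue) = 0"
  shows "AE x in lebesgue. x \<in> \<Omega> \<longrightarrow> g x = 0"
proof -
  have ind: "(indicator S :: real ^ 'n \<Rightarrow> real) \<in> sqint" if "S \<in> lmeasurable" for S
  proof (rule sqintI)
    have "(\<lambda>x. (indicator S x :: real)\<^sup>2) = indicator S" by (auto simp: indicator_def)
    moreover have "integrable lebesgue (indicator S :: real ^ 'n \<Rightarrow> real)"
      by (rule integrable_real_indicator) (use that in \<open>auto simp only: fmeasurable_def infinity_ennreal_def top.not_eq_extremum\<close>)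
    ultimately show "integrable lebesgue (\<lambda>x. (indicator S x :: real)\<^sup>2)" by simp
  qed (use that in auto)
  have box0: "(\<integral>x. g x * indicator (box a b) x \<partial>lebesgue) = 0" if "cbox a b \<subseteq> \<Omega>" for a b
  proof -
    have "(\<lambda>n. \<integral>x. g x * bump (1 / real (Suc n)) a b x \<partial>lebesgue) \<longlonglongrightarrow> (\<integral>x. g x * indicator (box a b) x \<partial>lebesgue)"
    proof (rule integral_dominated_convergence[where w = "\<lambda>x. \<bar>g x * indicator (cbox a b) x\<bar>"])
      show "integrable lebesgue (\<lambda>x. \<bar>g x * indicator (cbox a b) x\<bar>)"
        by (intro integrable_abs sqint_mult_integrable g ind) simp
      show "AE x in lebesgue. (\<lambda>n. g x * bump (1 / real (Suc n)) a b x) \<longlonglongrightarrow> g x * indicator (box a b) x"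
        by (intro AE_I2 tendsto_intros bump_tendsto_indicator)
      fix n
      have b: "bump (1 / real (Suc n)) a b \<in> test_functions \<Omega>" using that by (intro bump_test) auto
      show "(\<lambda>x. g x * bump (1 / real (Suc n)) a b x) \<in> borel_measurable lebesgue"
        using sqint_mult_integrable[OF g test_sqint[OF b]] by (rule borel_measurable_integrable)
      show "AE x in lebesgue. norm (g x * bump (1 / real (Suc n)) a b x) \<le> \<bar>g x * indicator (cbox a b) x\<bar>"
      proof (rule AE_I2)
        fix x
        show "norm (g x * bump (1 / real (Suc n)) a b x) \<le> \<bar>g x * indicator (cbox a b) x\<bar>"
          using bump_range[of "1 / real (Suc n)" a b x] bump_outside[of x a b "1 / real (Suc n)"] box_subset_cbox[of a b]
          by (cases "x \<in> box a b") (auto simp: abs_mult indicator_def intro!: mult_left_le)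
      qed
    next
      show "(\<lambda>x. g x * indicator (box a b) x) \<in> borel_measurable lebesgue"
        using sqint_mult_integrable[OF g ind[of "box a b"]] by (auto dest: borel_measurable_integrable)
    qed
    moreover have "(\<integral>x. g x * bump (1 / real (Suc n)) a b x \<partial>lebesgue) = 0" for n
      using that by (intro zero bump_test) auto
    ultimately show ?thesis by (simp add: LIMSEQ_const_iff)
  qed
  \<comment> \<open>A Borel version of \<open>g\<close>: the box criterion is about
    \<open>lborel\<close>, whereas \<open>g\<close> is measurable only for the completion.\<close>
  obtain g' where g'[measurable]: "g' \<in> borel_measurable lborel" and ae: "AE x in lborel. g x = g' x"
    using completion_ex_borel_measurable_real[OF sqint_measurable[OF g]] by blast
  have ae': "AE x in lebesgue. g x = g' x" using ae by (rule AE_completion)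
  have cbox0: "AE x in lborel. x \<in> cbox c d \<longrightarrow> g x = 0" if cd: "cbox c d \<subseteq> \<Omega>" for c d
  proof -
    define f where "f x = g' x * indicator (box c d) x" for x
    have eq: "(\<integral>x. g' x * indicator S x \<partial>lborel) = (\<integral>x. g x * indicator S x \<partial>lebesgue)"
      if [measurable]: "S \<in> sets borel" and S: "S \<in> lmeasurable" for S
    proof -
      have "(\<integral>x. g' x * indicator S x \<partial>lborel) = (\<integral>x. g' x * indicator S x \<partial>lebesgue)"
        by (subst integral_completion) auto
      also have "\<dots> = (\<integral>x. g x * indicator S x \<partial>lebesgue)"
        using ae' sqint_mult_integrable[OF g ind[OF S]]
        by (intro integral_cong_AE) (auto intro: borel_measurable_integrable measurable_completion)
      finally show ?thesis .
    qed
    have "integrable lebesgue f \<longleftrightarrow> integrable lebesgue (\<lambda>x. g x * indicator (box c d) x)"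
      unfolding f_def using ae' sqint_mult_integrable[OF g ind[of "box c d"]]
      by (intro integrable_cong_AE) (auto intro: borel_measurable_integrable measurable_completion)
    then have "integrable lebesgue f" using sqint_mult_integrable[OF g ind[of "box c d"]] by simp
    moreover have "f \<in> borel_measurable lborel" unfolding f_def[abs_def] using g' by measurable
    ultimately have fint: "integrable lborel f" by (subst (asm) integrable_completion)
    have "AE x in lborel. f x = 0"
    proof (rule AE_zero_if_box_integrals_zero[OF fint])
      fix a b
      \<comment> \<open>The cutoff box meets any tested box in a box that still lies in the domain,
        so \<open>a\<close> and \<open>b\<close> may be arbitrary.\<close>
      obtain a' b' where ab: "box c d \<inter> box a b = box a' b'" "cbox c d \<inter> cbox a b = cbox a' b'"
        by (rule that[OF box_Int_box Int_interval])
      then have "cbox a' b' \<subseteq> \<Omega>" using cd by blast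
      have "(\<integral>x. f x * indicator (box a b) x \<partial>lborel) = (\<integral>x. g' x * indicator (box a' b') x \<partial>lborel)"
        unfolding f_def ab(1)[symmetric] by (simp add: indicator_inter_arith mult.assoc)
      also have "\<dots> = 0" using box0[OF \<open>cbox a' b' \<subseteq> \<Omega>\<close>] by (subst eq) auto
      finally show "(\<integral>x. f x * indicator (box a b) x \<partial>lborel) = 0" .
    qed
    moreover have "AE x in lborel. x \<notin> cbox c d - box c d"
    proof (rule AE_not_in)
      have "negligible (cbox c d - box c d)" by (rule negligible_frontier_interval)
      then show "cbox c d - box c d \<in> null_sets lborel" by (simp add: negligible_iff_null_sets null_sets_completion_iff)
    qed
    ultimately show ?thesis using ae by eventually_elim (auto simp: f_def indicator_def split: if_splits)
  qed
  obtain \<D> where D0: "countable \<D>" "\<D> \<subseteq> Pow \<Omega>" "\<And>X. X \<in> \<D> \<Longrightarrow> \<exists>a b. X = cbox a b" "\<Union>\<D> = \<Omega>"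
    by (rule open_countable_Union_open_cbox[OF \<open>open \<Omega>\<close>]) blast
  have "AE x in lborel. \<forall>X\<in>\<D>. x \<in> X \<longrightarrow> g x = 0"
    using D0(2,3) cbox0 by (subst AE_ball_countable[OF D0(1)]) blast
  then have "AE x in lborel. x \<in> \<Omega> \<longrightarrow> g x = 0" by eventually_elim (use D0(4) in blast)
  then show ?thesis by (rule AE_completion)
qed

section \<open>The Dirichlet space as a closed subspace of a Hilbert space\<close>

definition ext :: "'a set \<Rightarrow> ('a \<Rightarrow> real) \<Rightarrow> 'a \<Rightarrow> real" where
  "ext \<Omega> f x = indicator \<Omega> x *\<^sub>R f x"

definition L2_class :: "(real ^ 'n) set \<Rightarrow> (real ^ 'n \<Rightarrow> real) \<Rightarrow> (real ^ 'n) lsq" where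
  "L2_class \<Omega> f = cls (ext \<Omega> f)"

definition grad_class :: "(real ^ 'n) set \<Rightarrow> (real ^ 'n \<Rightarrow> real ^ 'n) \<Rightarrow> (real ^ 'n) lsq ^ 'n" where
  "grad_class \<Omega> G = (\<chi> i. L2_class \<Omega> (\<lambda>x. G x $ i))"

definition jet :: "(real ^ 'n \<Rightarrow> real) \<Rightarrow> (real ^ 'n) lsq \<times> ((real ^ 'n) lsq ^ 'n)" where
  "jet \<phi> = (cls \<phi>, \<chi> i. cls (partial_deriv i \<phi>))"

definition weak_jet :: "(real ^ 'n) set \<Rightarrow> (real ^ 'n \<Rightarrow> real) \<Rightarrow> (real ^ 'n) lsq \<times> ((real ^ 'n) lsq ^ 'n)" where
  "weak_jet \<Omega> u = (L2_class \<Omega> u, grad_class \<Omega> (weak_grad \<Omega> u))"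

text \<open>The space in graph form: the norm of the product space is the H1 norm, and a closed
  subspace of an existing Hilbert space needs no further type.\<close>

definition dirichlet_space :: "(real ^ 'n) set \<Rightarrow> ((real ^ 'n) lsq \<times> ((real ^ 'n) lsq ^ 'n)) set" where
  "dirichlet_space \<Omega> = closure (jet ` test_functions \<Omega>)"

lemma subspace_closure:
  fixes S :: "'a::real_normed_vector set"
  assumes "subspace S"
  shows "subspace (closure S)"
proof (rule subspaceI)
  show "0 \<in> closure S" using subspace_0[OF assms] closure_subset by blast
  show "x + y \<in> closure S" if xy: "x \<in> closure S" "y \<in> closure S" for x y
  proof -
    obtain f g where "\<forall>n. f n \<in> S" "f \<longlonglongrightarrow> x" "\<forall>n. g n \<in> S" "g \<longlonglongrightarrow> y"
      using xy unfolding closure_sequential by blast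
    then show ?thesis unfolding closure_sequential
      by (intro exI[of _ "\<lambda>n. f n + g n"]) (auto intro: tendsto_add subspace_add[OF assms])
  qed
  show "c *\<^sub>R x \<in> closure S" if x: "x \<in> closure S" for c x
  proof -
    obtain f where "\<forall>n. f n \<in> S" "f \<longlonglongrightarrow> x" using x unfolding closure_sequential by blast
    then show ?thesis unfolding closure_sequential
      by (intro exI[of _ "\<lambda>n. c *\<^sub>R f n"]) (auto intro: tendsto_scaleR subspace_scale[OF assms])
  qed
qed

context
  fixes \<Omega> :: "(real ^ 'n) set"
  assumes open_\<Omega>: "open \<Omega>"
begin

lemma sets_\<Omega>: "\<Omega> \<in> sets lebesgue" using open_\<Omega> by auto

lemma L2_ext:
  fixes f :: "real ^ 'n \<Rightarrow> real"
  shows "f \<in> L2 \<Omega> \<longleftrightarrow> ext \<Omega> f \<in> sqint"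
proof -
  have "(\<lambda>x. (ext \<Omega> f x)\<^sup>2) = (\<lambda>x. indicator \<Omega> x *\<^sub>R (f x)\<^sup>2)" by (auto simp: ext_def indicator_def)
  moreover have "ext \<Omega> f = (\<lambda>x. indicator \<Omega> x *\<^sub>R f x)" by (auto simp: ext_def)
  ultimately show ?thesis
    using sets_\<Omega> by (simp add: L2_def sqint_def borel_measurable_restrict_space_iff integrable_restrict_space set_integrable_def)
qed

lemma integral_lebesgue_on: "(\<integral>x. f x \<partial>lebesgue_on \<Omega>) = (\<integral>x. ext \<Omega> f x \<partial>lebesgue)"
  for f :: "real ^ 'n \<Rightarrow> real"
  using sets_\<Omega> by (simp add: integral_restrict_space set_lebesgue_integral_def ext_def)

lemma integrable_lebesgue_on: "integrable (lebesgue_on \<Omega>) f \<longleftrightarrow> integrable lebesgue (ext \<Omega> f)"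
  for f :: "real ^ 'n \<Rightarrow> real"
proof -
  have "ext \<Omega> f = (\<lambda>x. indicator \<Omega> x *\<^sub>R f x)" by (auto simp: ext_def)
  then show ?thesis using sets_\<Omega> by (simp add: integrable_restrict_space set_integrable_def)
qed

lemma ext_mult: "ext \<Omega> f x * ext \<Omega> g x = ext \<Omega> (\<lambda>x. f x * g x) x"
  by (simp add: ext_def indicator_def)

lemma inner_L2_class:
  assumes "f \<in> L2 \<Omega>" "g \<in> L2 \<Omega>"
  shows "inner (L2_class \<Omega> f) (L2_class \<Omega> g) = (\<integral>x. f x * g x \<partial>lebesgue_on \<Omega>)"
  using assms by (simp add: L2_class_def inner_cls L2_ext integral_lebesgue_on ext_mult)

lemma L2_mult_integrable:
  fixes f g :: "real ^ 'n \<Rightarrow> real"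
  assumes "f \<in> L2 \<Omega>" "g \<in> L2 \<Omega>"
  shows "integrable (lebesgue_on \<Omega>) (\<lambda>x. f x * g x)"
proof -
  have "ext \<Omega> (\<lambda>x. f x * g x) = (\<lambda>x. ext \<Omega> f x * ext \<Omega> g x)" by (auto simp: ext_mult)
  then show ?thesis using assms by (simp add: integrable_lebesgue_on sqint_mult_integrable L2_ext)
qed

lemma L2_component:
  fixes G :: "real ^ 'n \<Rightarrow> real ^ 'n"
  assumes "G \<in> L2 \<Omega>"
  shows "(\<lambda>x. G x $ i) \<in> L2 \<Omega>"
proof -
  have [measurable]: "G \<in> borel_measurable (lebesgue_on \<Omega>)" using assms by (simp add: L2_def)
  have "(\<lambda>x. inner (G x) (axis i 1)) \<in> borel_measurable (lebesgue_on \<Omega>)" by measurable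
  then have m: "(\<lambda>x. G x $ i) \<in> borel_measurable (lebesgue_on \<Omega>)" by (simp add: inner_axis)
  moreover have "integrable (lebesgue_on \<Omega>) (\<lambda>x. (norm (G x $ i))\<^sup>2)"
  proof (rule Bochner_Integration.integrable_bound)
    show "integrable (lebesgue_on \<Omega>) (\<lambda>x. (norm (G x))\<^sup>2)" using assms by (simp add: L2_def)
    show "(\<lambda>x. (norm (G x $ i))\<^sup>2) \<in> borel_measurable (lebesgue_on \<Omega>)" using m by measurable
    show "AE x in lebesgue_on \<Omega>. norm ((norm (G x $ i))\<^sup>2) \<le> norm ((norm (G x))\<^sup>2)"
    proof (rule AE_I2)
      fix x show "norm ((norm (G x $ i))\<^sup>2) \<le> norm ((norm (G x))\<^sup>2)"
        using power_mono[OF Finite_Cartesian_Product.norm_nth_le[of "G x" i], of 2] by simp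
    qed
  qed
  ultimately show ?thesis by (simp add: L2_def)
qed

lemma L2_vec:
  fixes G :: "real ^ 'n \<Rightarrow> real ^ 'n"
  assumes "\<And>i. (\<lambda>x. G x $ i) \<in> L2 \<Omega>"
  shows "G \<in> L2 \<Omega>"
proof -
  have m: "(\<lambda>x. G x $ i) \<in> borel_measurable (lebesgue_on \<Omega>)" for i using assms[of i] by (simp add: L2_def)
  have "integrable (lebesgue_on \<Omega>) (\<lambda>x. \<Sum>i\<in>UNIV. (norm (G x $ i))\<^sup>2)"
    using assms by (intro Bochner_Integration.integrable_sum) (auto simp: L2_def)
  moreover have "(\<lambda>x. \<Sum>i\<in>UNIV. (norm (G x $ i))\<^sup>2) = (\<lambda>x. (norm (G x))\<^sup>2)"
    by (auto simp: norm_vec_def L2_set_def sum_nonneg)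
  moreover have "G \<in> borel_measurable (lebesgue_on \<Omega>)"
    by (subst borel_measurable_euclidean_space) (auto simp: Basis_vec_def inner_axis m)
  ultimately show ?thesis by (simp add: L2_def)
qed

lemma inner_grad_class:
  assumes "G \<in> L2 \<Omega>" "H \<in> L2 \<Omega>"
  shows "inner (grad_class \<Omega> G) (grad_class \<Omega> H) = (\<integral>x. inner (G x) (H x) \<partial>lebesgue_on \<Omega>)"
proof -
  have "inner (grad_class \<Omega> G) (grad_class \<Omega> H) = (\<Sum>i\<in>UNIV. \<integral>x. G x $ i * H x $ i \<partial>lebesgue_on \<Omega>)"
    unfolding inner_vec_def by (simp add: grad_class_def inner_L2_class L2_component assms)
  also have "\<dots> = (\<integral>x. (\<Sum>i\<in>UNIV. G x $ i * H x $ i) \<partial>lebesgue_on \<Omega>)"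
    by (rule Bochner_Integration.integral_sum[symmetric]) (intro L2_mult_integrable L2_component assms)
  finally show ?thesis by (simp add: inner_vec_def)
qed

lemma inner_grad_integrable:
  assumes "G \<in> L2 \<Omega>" "H \<in> L2 \<Omega>"
  shows "integrable (lebesgue_on \<Omega>) (\<lambda>x. inner (G x) (H x :: real ^ 'n))"
  unfolding inner_vec_def inner_real_def by (intro Bochner_Integration.integrable_sum L2_mult_integrable L2_component assms)

lemma ext_test: "\<phi> \<in> test_functions \<Omega> \<Longrightarrow> ext \<Omega> \<phi> = \<phi>"
  using test_outside by (fastforce simp: ext_def indicator_def fun_eq_iff)

lemma L2_class_test: "\<phi> \<in> test_functions \<Omega> \<Longrightarrow> L2_class \<Omega> \<phi> = cls \<phi>"
  by (simp add: L2_class_def ext_test)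

lemma test_L2: "\<phi> \<in> test_functions \<Omega> \<Longrightarrow> \<phi> \<in> L2 \<Omega>"
  by (simp add: L2_ext ext_test test_sqint)

lemma has_weak_gradient_iff:
  assumes "u \<in> L2 \<Omega>" "G \<in> L2 \<Omega>"
  shows "has_weak_gradient \<Omega> u G \<longleftrightarrow>
    (\<forall>\<phi>\<in>test_functions \<Omega>. \<forall>i. inner (L2_class \<Omega> u) (cls (partial_deriv i \<phi>)) = - inner (grad_class \<Omega> G $ i) (cls \<phi>))"
  unfolding has_weak_gradient_def grad_class_def
  using assms by (auto simp: inner_L2_class[symmetric] test_L2 test_partial L2_component L2_class_test)

lemma L2_class_zero_outside: "AE x in lebesgue. x \<notin> \<Omega> \<longrightarrow> rep (L2_class \<Omega> f) x = 0" if "f \<in> L2 \<Omega>"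
  using rep_cls[of "ext \<Omega> f"] that unfolding L2_class_def L2_ext
  by (auto simp: ext_def elim!: AE_mp)

text \<open>Test functions control only the values in the domain, so vanishing outside is asked for
  separately.\<close>

lemma lsq_zero_if_orthogonal:
  assumes "AE x in lebesgue. x \<notin> \<Omega> \<longrightarrow> rep d x = 0" and "\<And>\<phi>. \<phi> \<in> test_functions \<Omega> \<Longrightarrow> inner d (cls \<phi>) = 0"
  shows "d = 0"
proof -
  have "AE x in lebesgue. x \<in> \<Omega> \<longrightarrow> rep d x = 0"
  proof (rule fundamental_lemma[OF rep_sqint open_\<Omega>])
    fix \<phi> assume \<phi>: "\<phi> \<in> test_functions \<Omega>"
    show "(\<integral>x. rep d x * \<phi> x \<partial>lebesgue) = 0"
      using assms(2)[OF \<phi>] inner_cls[OF rep_sqint test_sqint[OF \<phi>], of d] by (simp add: cls_rep)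
  qed
  then have "AE x in lebesgue. rep d x = 0" using assms(1) by eventually_elim blast
  then have "cls (rep d) = cls (\<lambda>x. 0)" by (subst cls_eq_iff[OF rep_sqint sqint_zero])
  then show ?thesis by (simp add: cls_rep zero_lsq_def)
qed

lemma ext_diff: "(\<lambda>x. ext \<Omega> f x - ext \<Omega> g x) = ext \<Omega> (\<lambda>x. f x - g x)"
  by (auto simp: ext_def indicator_def)

lemma L2_class_diff: "f \<in> L2 \<Omega> \<Longrightarrow> g \<in> L2 \<Omega> \<Longrightarrow> L2_class \<Omega> (\<lambda>x. f x - g x) = L2_class \<Omega> f - L2_class \<Omega> g"
  by (simp add: L2_class_def cls_diff L2_ext ext_diff)

lemma L2_diff: "f \<in> L2 \<Omega> \<Longrightarrow> g \<in> L2 \<Omega> \<Longrightarrow> (\<lambda>x. f x - g x :: real) \<in> L2 \<Omega>"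
  using sqint_diff[of "ext \<Omega> f" "ext \<Omega> g"] by (simp add: L2_ext ext_diff)

lemma weak_gradient_unique:
  assumes "u \<in> L2 \<Omega>" "G \<in> L2 \<Omega>" "H \<in> L2 \<Omega>" "has_weak_gradient \<Omega> u G" "has_weak_gradient \<Omega> u H"
  shows "grad_class \<Omega> G = grad_class \<Omega> H"
proof -
  have "grad_class \<Omega> G $ i - grad_class \<Omega> H $ i = 0" for i
  proof (rule lsq_zero_if_orthogonal)
    have eq: "grad_class \<Omega> G $ i - grad_class \<Omega> H $ i = L2_class \<Omega> (\<lambda>x. G x $ i - H x $ i)"
      by (simp add: grad_class_def L2_class_diff L2_component assms)
    show "AE x in lebesgue. x \<notin> \<Omega> \<longrightarrow> rep (grad_class \<Omega> G $ i - grad_class \<Omega> H $ i) x = 0"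
      unfolding eq by (intro L2_class_zero_outside L2_diff L2_component assms)
    fix \<phi> assume \<phi>: "\<phi> \<in> test_functions \<Omega>"
    have "- inner (grad_class \<Omega> G $ i) (cls \<phi>) = - inner (grad_class \<Omega> H $ i) (cls \<phi>)"
      using assms(4)[unfolded has_weak_gradient_iff[OF assms(1,2)], rule_format, OF \<phi>, of i]
        assms(5)[unfolded has_weak_gradient_iff[OF assms(1,3)], rule_format, OF \<phi>, of i] by simp
    then show "inner (grad_class \<Omega> G $ i - grad_class \<Omega> H $ i) (cls \<phi>) = 0" by (simp add: inner_diff_left)
  qed
  then show ?thesis by (simp add: vec_eq_iff)
qed

lemma
  assumes "u \<in> H1 \<Omega>"
  shows H1_L2: "u \<in> L2 \<Omega>" and weak_grad_L2: "weak_grad \<Omega> u \<in> L2 \<Omega>"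
    and weak_grad: "has_weak_gradient \<Omega> u (weak_grad \<Omega> u)"
proof -
  show "u \<in> L2 \<Omega>" using assms by (simp add: H1_def)
  have "\<exists>G. G \<in> L2 \<Omega> \<and> has_weak_gradient \<Omega> u G" using assms by (auto simp: H1_def)
  from someI_ex[OF this] show "weak_grad \<Omega> u \<in> L2 \<Omega>" "has_weak_gradient \<Omega> u (weak_grad \<Omega> u)"
    unfolding weak_grad_def by auto
qed

lemma weak_jet_eqI:
  assumes "u \<in> L2 \<Omega>" "G \<in> L2 \<Omega>" "has_weak_gradient \<Omega> u G"
  shows "u \<in> H1 \<Omega>" and "weak_jet \<Omega> u = (L2_class \<Omega> u, grad_class \<Omega> G)"
proof -
  show u: "u \<in> H1 \<Omega>" using assms by (auto simp: H1_def)
  show "weak_jet \<Omega> u = (L2_class \<Omega> u, grad_class \<Omega> G)"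
    using weak_gradient_unique[OF assms(1) weak_grad_L2[OF u] assms(2) weak_grad[OF u] assms(3)] by (simp add: weak_jet_def)
qed

lemma H1_norm_eq: "u \<in> H1 \<Omega> \<Longrightarrow> H1_norm \<Omega> u = norm (weak_jet \<Omega> u)"
  unfolding H1_norm_def weak_jet_def norm_Pair power2_norm_eq_inner
  by (simp add: inner_L2_class inner_grad_class H1_L2 weak_grad_L2 power2_norm_eq_inner power2_eq_square)

lemma inner_weak_jet:
  assumes "u \<in> H1 \<Omega>" "v \<in> H1 \<Omega>"
  shows "inner (fst (weak_jet \<Omega> u)) (fst (weak_jet \<Omega> v)) = (\<integral>x. u x * v x \<partial>lebesgue_on \<Omega>)"
    and "inner (snd (weak_jet \<Omega> u)) (snd (weak_jet \<Omega> v)) = (\<integral>x. inner (weak_grad \<Omega> u x) (weak_grad \<Omega> v x) \<partial>lebesgue_on \<Omega>)"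
  by (simp_all add: weak_jet_def inner_L2_class inner_grad_class H1_L2 weak_grad_L2 assms)

lemma weak_jet_diff:
  assumes u: "u \<in> H1 \<Omega>" and v: "v \<in> H1 \<Omega>"
  shows "(\<lambda>x. u x - v x) \<in> H1 \<Omega>" and "weak_jet \<Omega> (\<lambda>x. u x - v x) = weak_jet \<Omega> u - weak_jet \<Omega> v"
proof -
  let ?G = "\<lambda>x. weak_grad \<Omega> u x - weak_grad \<Omega> v x"
  have L: "(\<lambda>x. u x - v x) \<in> L2 \<Omega>" by (intro L2_diff H1_L2 assms)
  have G: "?G \<in> L2 \<Omega>" by (rule L2_vec) (simp add: L2_diff L2_component weak_grad_L2 assms)
  have gE: "grad_class \<Omega> ?G = grad_class \<Omega> (weak_grad \<Omega> u) - grad_class \<Omega> (weak_grad \<Omega> v)"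
    by (simp add: vec_eq_iff grad_class_def L2_class_diff L2_component weak_grad_L2 assms)
  have w: "has_weak_gradient \<Omega> (\<lambda>x. u x - v x) ?G"
    unfolding has_weak_gradient_iff[OF L G] gE
    using weak_grad[OF u] weak_grad[OF v] has_weak_gradient_iff[OF H1_L2[OF u] weak_grad_L2[OF u]]
      has_weak_gradient_iff[OF H1_L2[OF v] weak_grad_L2[OF v]]
    by (simp add: L2_class_diff H1_L2 assms inner_diff_left)
  show "(\<lambda>x. u x - v x) \<in> H1 \<Omega>" by (rule weak_jet_eqI[OF L G w])
  show "weak_jet \<Omega> (\<lambda>x. u x - v x) = weak_jet \<Omega> u - weak_jet \<Omega> v"
    unfolding weak_jet_eqI(2)[OF L G w] gE by (simp add: weak_jet_def L2_class_diff H1_L2 assms)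
qed

lemma
  assumes \<phi>: "\<phi> \<in> test_functions \<Omega>"
  shows test_H1: "\<phi> \<in> H1 \<Omega>" and weak_jet_test: "weak_jet \<Omega> \<phi> = jet \<phi>"
proof -
  have G: "grad \<phi> \<in> L2 \<Omega>" by (rule L2_vec) (simp add: grad_def test_L2 test_partial \<phi>)
  have gE: "grad_class \<Omega> (grad \<phi>) = (\<chi> i. cls (partial_deriv i \<phi>))"
    by (simp add: grad_class_def grad_def L2_class_test test_partial \<phi>)
  have w: "has_weak_gradient \<Omega> \<phi> (grad \<phi>)"
    unfolding has_weak_gradient_iff[OF test_L2[OF \<phi>] G] gE
    using test_integration_by_parts[OF \<phi>]
    by (simp add: L2_class_test \<phi> inner_cls test_sqint[of _ \<Omega>] test_partial)
  show "\<phi> \<in> H1 \<Omega>" by (rule weak_jet_eqI[OF test_L2[OF \<phi>] G w])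
  show "weak_jet \<Omega> \<phi> = jet \<phi>" unfolding weak_jet_eqI(2)[OF test_L2[OF \<phi>] G w] gE by (simp add: jet_def L2_class_test \<phi>)
qed

text \<open>The H1 norm of the difference of a test function and \<open>u\<close> is the distance of
  their jets, so approximability by test functions is membership in the closure.\<close>

lemma H10_iff: "u \<in> H10 \<Omega> \<longleftrightarrow> u \<in> H1 \<Omega> \<and> weak_jet \<Omega> u \<in> dirichlet_space \<Omega>"
proof -
  have "H1_norm \<Omega> (\<lambda>x. \<phi> x - u x) = norm (jet \<phi> - weak_jet \<Omega> u)" if "\<phi> \<in> test_functions \<Omega>" "u \<in> H1 \<Omega>" for \<phi>
    using weak_jet_diff[OF test_H1[OF that(1)] that(2)] by (simp add: H1_norm_eq weak_jet_test[OF that(1)])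
  then have "u \<in> H10 \<Omega> \<longleftrightarrow> u \<in> H1 \<Omega> \<and>
      (\<exists>\<phi>. (\<forall>n. \<phi> n \<in> test_functions \<Omega>) \<and> (\<lambda>n. norm (jet (\<phi> n) - weak_jet \<Omega> u)) \<longlonglongrightarrow> 0)"
    unfolding H10_def by auto
  also have "\<dots> \<longleftrightarrow> u \<in> H1 \<Omega> \<and> weak_jet \<Omega> u \<in> dirichlet_space \<Omega>"
  proof -
    have "(\<exists>\<phi>. (\<forall>n. \<phi> n \<in> test_functions \<Omega>) \<and> (\<lambda>n. norm (jet (\<phi> n) - s)) \<longlonglongrightarrow> 0) \<longleftrightarrow> s \<in> dirichlet_space \<Omega>" for s
    proof
      assume "\<exists>\<phi>. (\<forall>n. \<phi> n \<in> test_functions \<Omega>) \<and> (\<lambda>n. norm (jet (\<phi> n) - s)) \<longlonglongrightarrow> 0"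
      then obtain \<phi> where "\<And>n. \<phi> n \<in> test_functions \<Omega>" "(\<lambda>n. jet (\<phi> n)) \<longlonglongrightarrow> s"
        by (auto simp: tendsto_norm_zero_iff LIM_zero_iff)
      then show "s \<in> dirichlet_space \<Omega>" unfolding dirichlet_space_def closure_sequential by (intro exI[of _ "\<lambda>n. jet (\<phi> n)"]) auto
    next
      assume "s \<in> dirichlet_space \<Omega>"
      then obtain x where x: "\<forall>n. x n \<in> jet ` test_functions \<Omega>" "x \<longlonglongrightarrow> s"
        unfolding dirichlet_space_def closure_sequential by auto
      then have "\<forall>n. \<exists>\<phi>. \<phi> \<in> test_functions \<Omega> \<and> x n = jet \<phi>" by auto
      from choice[OF this] obtain \<phi> where \<phi>: "\<And>n. \<phi> n \<in> test_functions \<Omega>" "\<And>n. x n = jet (\<phi> n)" by blast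
      then have "x = (\<lambda>n. jet (\<phi> n))" by auto
      then have "(\<lambda>n. norm (jet (\<phi> n) - s)) \<longlonglongrightarrow> 0" using x(2) by (simp add: tendsto_norm_zero_iff LIM_zero_iff)
      then show "\<exists>\<phi>. (\<forall>n. \<phi> n \<in> test_functions \<Omega>) \<and> (\<lambda>n. norm (jet (\<phi> n) - s)) \<longlonglongrightarrow> 0" using \<phi>(1) by blast
    qed
    then show ?thesis by simp
  qed
  finally show ?thesis .
qed

lemma jet_linear:
  assumes "\<phi> \<in> test_functions \<Omega>" "\<psi> \<in> test_functions \<Omega>"
  shows "jet (\<lambda>x. \<phi> x + \<psi> x) = jet \<phi> + jet \<psi>" and "jet (\<lambda>x. c * \<phi> x) = c *\<^sub>R jet \<phi>"
proof -
  note m = test_sqint[OF assms(1)] test_sqint[OF assms(2)] test_sqint[OF test_partial[OF assms(1)]] test_sqint[OF test_partial[OF assms(2)]]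
  show "jet (\<lambda>x. \<phi> x + \<psi> x) = jet \<phi> + jet \<psi>"
    by (simp add: jet_def test_partial_add[OF assms] vec_eq_iff cls_add m)
  show "jet (\<lambda>x. c * \<phi> x) = c *\<^sub>R jet \<phi>"
    by (simp add: jet_def test_partial_scale[OF assms(1)] vec_eq_iff cls_scale m)
qed

lemma closed_dirichlet_space: "closed (dirichlet_space \<Omega>)"
  by (simp add: dirichlet_space_def)

lemma subspace_dirichlet_space: "subspace (dirichlet_space \<Omega>)"
  unfolding dirichlet_space_def
proof (rule subspace_closure, rule subspaceI)
  have "jet (\<lambda>x :: real ^ 'n. 0) = 0" using jet_linear(2)[OF test_zero test_zero, of 0] by simp
  then show "0 \<in> jet ` test_functions \<Omega>" using image_eqI[OF _ test_zero, of 0 jet] by simp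
  show "x + y \<in> jet ` test_functions \<Omega>" if "x \<in> jet ` test_functions \<Omega>" "y \<in> jet ` test_functions \<Omega>" for x y
    using that by (auto simp: jet_linear(1)[symmetric] intro!: imageI test_add)
  show "c *\<^sub>R x \<in> jet ` test_functions \<Omega>" if "x \<in> jet ` test_functions \<Omega>" for c x
    using that by (auto simp: jet_linear(2)[symmetric] intro!: imageI test_scale)
qed

text \<open>Integration by parts against a fixed test function passes to the limit, which makes the
  second component the weak gradient of the first. An almost everywhere convergent subsequence shows
  that limits vanish outside the domain, so restriction to the domain loses nothing.\<close>

lemma dirichlet_space_weak_jet:
  assumes s: "s \<in> dirichlet_space \<Omega>"
  shows "\<exists>u\<in>H10 \<Omega>. weak_jet \<Omega> u = s"
proof -
  obtain x where x: "\<forall>n. x n \<in> jet ` test_functions \<Omega>" "x \<longlonglongrightarrow> s"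
    using s unfolding dirichlet_space_def closure_sequential by auto
  then have "\<forall>n. \<exists>\<phi>. \<phi> \<in> test_functions \<Omega> \<and> x n = jet \<phi>" by auto
  from choice[OF this] obtain \<phi> where \<phi>: "\<And>n. \<phi> n \<in> test_functions \<Omega>" "\<And>n. x n = jet (\<phi> n)" by blast
  have l1: "(\<lambda>n. cls (\<phi> n)) \<longlonglongrightarrow> fst s" using tendsto_fst[OF x(2)] by (simp add: \<phi>(2) jet_def)
  have l2: "(\<lambda>n. cls (partial_deriv i (\<phi> n))) \<longlonglongrightarrow> snd s $ i" for i
    using tendsto_vec_nth[OF tendsto_snd[OF x(2)], of i] by (simp add: \<phi>(2) jet_def)
  have in_L2: "f \<in> L2 \<Omega>" and E_rep: "L2_class \<Omega> f = t"
    if f: "f = rep t" and lim: "(\<lambda>n. cls (\<psi> n)) \<longlonglongrightarrow> t" and \<psi>: "\<And>n. \<psi> n \<in> test_functions \<Omega>" for f t \<psi>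
  proof -
    have m: "(\<lambda>x. indicator \<Omega> x *\<^sub>R f x) \<in> borel_measurable lebesgue"
      using rep_sqint[of t] sets_\<Omega> unfolding f by (intro borel_measurable_scaleR) (auto dest: sqint_measurable)
    have "integrable lebesgue (\<lambda>x. indicator \<Omega> x *\<^sub>R (f x)\<^sup>2)"
      using sqint_integrable[OF rep_sqint[of t]] sets_\<Omega> unfolding f by (intro integrable_mult_indicator)
    moreover have "(\<lambda>x. indicator \<Omega> x *\<^sub>R (f x)\<^sup>2) = (\<lambda>x. (ext \<Omega> f x)\<^sup>2)" by (auto simp: ext_def indicator_def)
    moreover have "ext \<Omega> f = (\<lambda>x. indicator \<Omega> x *\<^sub>R f x)" by (auto simp: ext_def)
    ultimately show L: "f \<in> L2 \<Omega>" using m unfolding L2_ext by (intro sqintI) simp_all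
    obtain r where r: "strict_mono (r :: nat \<Rightarrow> nat)" "AE x in lebesgue. (\<lambda>k. rep (cls (\<psi> (r k))) x) \<longlonglongrightarrow> rep t x"
      using tendsto_lsq_AE_subseq[OF lim] by blast
    have "AE x in lebesgue. \<forall>k. rep (cls (\<psi> k)) x = \<psi> k x"
      unfolding AE_all_countable using rep_cls[OF test_sqint[OF \<psi>]] by blast
    with r(2) have "AE x in lebesgue. ext \<Omega> f x = rep t x"
    proof eventually_elim
      case (elim x)
      show ?case
      proof (cases "x \<in> \<Omega>")
        case False
        then have "(\<lambda>k. 0) \<longlonglongrightarrow> rep t x" using elim test_outside[OF \<psi> False] by simp
        then show ?thesis using False by (simp add: ext_def LIMSEQ_const_iff)
      qed (simp add: ext_def f)
    qed
    then show "L2_class \<Omega> f = t" unfolding L2_class_def using L[unfolded L2_ext] rep_sqint[of t] cls_eq_iff[of "ext \<Omega> f" "rep t"] by (simp add: cls_rep)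
  qed
  define u where "u = rep (fst s)"
  define G where "G x = (\<chi> i. rep (snd s $ i) x)" for x
  have u: "u \<in> L2 \<Omega>" "L2_class \<Omega> u = fst s" using in_L2[OF u_def l1 \<phi>(1)] E_rep[OF u_def l1 \<phi>(1)] by auto
  have Gi: "(\<lambda>x. G x $ i) = rep (snd s $ i)" for i by (auto simp: G_def)
  have G: "G \<in> L2 \<Omega>"
    by (rule L2_vec) (rule in_L2[OF Gi l2 test_partial[OF \<phi>(1)]])
  have gE: "grad_class \<Omega> G = snd s"
    using E_rep[OF Gi l2 test_partial[OF \<phi>(1)]] by (simp add: grad_class_def vec_eq_iff)
  have "has_weak_gradient \<Omega> u G"
    unfolding has_weak_gradient_iff[OF u(1) G] u(2) gE
  proof (intro ballI allI)
    fix \<psi> i assume \<psi>: "\<psi> \<in> test_functions \<Omega>"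
    have "(\<lambda>n. inner (cls (\<phi> n)) (cls (partial_deriv i \<psi>))) \<longlonglongrightarrow> inner (fst s) (cls (partial_deriv i \<psi>))"
      by (intro tendsto_intros l1)
    moreover have "(\<lambda>n. - inner (cls (partial_deriv i (\<phi> n))) (cls \<psi>)) \<longlonglongrightarrow> - inner (snd s $ i) (cls \<psi>)"
      by (intro tendsto_intros l2)
    moreover have "inner (cls (\<phi> n)) (cls (partial_deriv i \<psi>)) = - inner (cls (partial_deriv i (\<phi> n))) (cls \<psi>)" for n
      using test_integration_by_parts[OF \<phi>(1) \<psi>] by (simp add: inner_cls test_sqint[of _ \<Omega>] test_partial \<phi> \<psi>)
    ultimately show "inner (fst s) (cls (partial_deriv i \<psi>)) = - inner (snd s $ i) (cls \<psi>)"
      by (simp add: LIMSEQ_unique)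
  qed
  from weak_jet_eqI[OF u(1) G this] have "u \<in> H1 \<Omega>" "weak_jet \<Omega> u = s" by (simp_all add: u gE)
  then show ?thesis using s H10_iff by blast
qed

lemma vanishes_on_iff:
  assumes "u \<in> H1 \<Omega>"
  shows "vanishes_on \<Omega> u \<longleftrightarrow> fst (weak_jet \<Omega> u) = 0"
proof -
  have "fst (weak_jet \<Omega> u) = 0 \<longleftrightarrow> (AE x in lebesgue. ext \<Omega> u x = 0)"
    using H1_L2[OF assms] by (simp add: weak_jet_def L2_class_def zero_lsq_def L2_ext cls_eq_iff sqint_zero)
  also have "\<dots> \<longleftrightarrow> (AE x in lebesgue. x \<in> \<Omega> \<longrightarrow> u x = 0)" by (intro AE_cong) (simp add: ext_def indicator_def)
  also have "\<dots> \<longleftrightarrow> vanishes_on \<Omega> u" unfolding vanishes_on_def using sets_\<Omega> by (simp add: AE_restrict_space_iff)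
  finally show ?thesis by simp
qed

end

section \<open>The Sobolev inequality in dimensions three and four\<close>

text \<open>A root that sends \<open>top\<close> to \<open>top\<close>. With it the product
  inequalities hold for all measurable functions, and finiteness matters only at the very
  end.\<close>

definition eroot :: "nat \<Rightarrow> ennreal \<Rightarrow> ennreal" where
  "eroot n x = (if x = top then top else ennreal (root n (enn2real x)))"

lemma eroot_measurable[measurable]: "eroot n \<in> borel_measurable borel"
  unfolding eroot_def by measurable

lemma eroot_ennreal: "0 \<le> r \<Longrightarrow> eroot n (ennreal r) = ennreal (root n r)"
  by (simp add: eroot_def)

lemma eroot_power: "0 < n \<Longrightarrow> eroot n x ^ n = x"
  by (cases x) (auto simp: eroot_def ennreal_power top_power_ennreal)

lemma eroot_mono: "0 < n \<Longrightarrow> x \<le> y \<Longrightarrow> eroot n x \<le> eroot n y"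
  by (cases x; cases y) (auto simp: eroot_def top_unique intro!: ennreal_leI)

lemma eroot_of_power: "0 < n \<Longrightarrow> eroot n (x ^ n) = x"
  by (cases x) (auto simp: eroot_def ennreal_power top_power_ennreal real_root_power_cancel)

lemma ennreal_amgm3: "3 * (x * y * z) \<le> x ^ 3 + y ^ 3 + z ^ (3::nat)" for x y z :: ennreal
proof (cases "x = top \<or> y = top \<or> z = top")
  case True then show ?thesis by (auto simp: top_power_ennreal)
next
  case False
  then obtain a b c where abc: "x = ennreal a" "y = ennreal b" "z = ennreal c" "0 \<le> a" "0 \<le> b" "0 \<le> c"
    by (cases x; cases y; cases z) auto
  have "a ^ 3 + b ^ 3 + c ^ 3 - 3 * (a * b * c) = (a + b + c) * ((a - b)\<^sup>2 + (b - c)\<^sup>2 + (c - a)\<^sup>2) / 2"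
    by (simp add: power2_eq_square power3_eq_cube algebra_simps)
  also have "\<dots> \<ge> 0" using abc by simp
  finally have "3 * (a * b * c) \<le> a ^ 3 + b ^ 3 + c ^ 3" by simp
  then have "ennreal (3 * (a * b * c)) \<le> ennreal (a ^ 3 + b ^ 3 + c ^ 3)" by (rule ennreal_leI)
  then show ?thesis using abc by (simp add: ennreal_mult ennreal_power ennreal_plus)
qed

text \<open>The inequality of arithmetic and geometric means, applied pointwise to functions
  normalised to integral 1. A zero or infinite factor prevents normalisation and is treated
  first.\<close>

lemma nn_integral_Holder3:
  assumes [measurable]: "f \<in> borel_measurable M" "g \<in> borel_measurable M" "h \<in> borel_measurable M"
  shows "(\<integral>\<^sup>+x. eroot 3 (f x) * eroot 3 (g x) * eroot 3 (h x) \<partial>M)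
    \<le> eroot 3 (\<integral>\<^sup>+x. f x \<partial>M) * eroot 3 (\<integral>\<^sup>+x. g x \<partial>M) * eroot 3 (\<integral>\<^sup>+x. h x \<partial>M)"
proof -
  define A B C where "A = eroot 3 (\<integral>\<^sup>+x. f x \<partial>M)" and "B = eroot 3 (\<integral>\<^sup>+x. g x \<partial>M)" and "C = eroot 3 (\<integral>\<^sup>+x. h x \<partial>M)"
  have pw: "A ^ 3 = (\<integral>\<^sup>+x. f x \<partial>M)" "B ^ 3 = (\<integral>\<^sup>+x. g x \<partial>M)" "C ^ 3 = (\<integral>\<^sup>+x. h x \<partial>M)"
    by (simp_all add: A_def B_def C_def eroot_power)
  have zero: "(\<integral>\<^sup>+x. eroot 3 (f x) * eroot 3 (g x) * eroot 3 (h x) \<partial>M) = 0"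
    if "(\<integral>\<^sup>+x. k x \<partial>M) = 0" "k \<in> {f, g, h}" for k
  proof -
    have [measurable]: "k \<in> borel_measurable M" using that(2) by auto
    have "AE x in M. k x = 0" using that(1) by (simp add: nn_integral_0_iff_AE)
    then have "AE x in M. eroot 3 (f x) * eroot 3 (g x) * eroot 3 (h x) = 0"
      by eventually_elim (use that(2) in \<open>auto simp: eroot_def\<close>)
    then show ?thesis by (simp add: nn_integral_0_iff_AE)
  qed
  show ?thesis
  proof (cases "A = 0 \<or> B = 0 \<or> C = 0")
    case True
    then have "A ^ 3 = 0 \<or> B ^ 3 = 0 \<or> C ^ 3 = 0" by auto
    then show ?thesis using zero unfolding pw by auto
  next
    case nz: False
    show ?thesis
    proof (cases "A = top \<or> B = top \<or> C = top")
      case True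
      then have "A * B * C = top" using nz by (auto simp: ennreal_mult_eq_top_iff)
      then show ?thesis by (simp add: A_def B_def C_def)
    next
      case fin: False
      have nrm: "(\<integral>\<^sup>+x. k x / K ^ 3 \<partial>M) = 1" if "K ^ 3 = (\<integral>\<^sup>+x. k x \<partial>M)" "K \<noteq> 0" "K \<noteq> top" "k \<in> borel_measurable M" for k K
      proof -
        have "(\<integral>\<^sup>+x. k x / K ^ 3 \<partial>M) = K ^ 3 / K ^ 3" using that by (simp add: nn_integral_divide)
        also have "\<dots> = 1" using that(2,3) by (intro ennreal_divide_self) (auto simp: less_top[symmetric] power3_eq_cube ennreal_mult_eq_top_iff)
        finally show ?thesis .
      qed
      have pt: "3 * (eroot 3 (f x) * eroot 3 (g x) * eroot 3 (h x))
          \<le> (A * B * C) * (f x / A ^ 3 + g x / B ^ 3 + h x / C ^ 3)" for x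
      proof -
        have s: "K * (eroot 3 y / K) = eroot 3 y" "(eroot 3 y / K) ^ 3 = y / K ^ 3" if "K \<noteq> 0" "K \<noteq> top" for K y
        proof -
          have *: "K * (1 / K) = 1" using that by (simp add: ennreal_times_divide ennreal_divide_self less_top[symmetric])
          have "K * (eroot 3 y / K) = eroot 3 y * (K * (1 / K))" by (simp add: divide_ennreal_def mult_ac)
          then show "K * (eroot 3 y / K) = eroot 3 y" unfolding * by simp
          have "(eroot 3 y / K) ^ 3 * K ^ 3 = y" unfolding power_mult_distrib[symmetric]
            using \<open>K * (eroot 3 y / K) = eroot 3 y\<close> by (simp add: mult.commute eroot_power)
          then have "(eroot 3 y / K) ^ 3 * (K ^ 3 / K ^ 3) = y / K ^ 3" by (simp add: ennreal_times_divide)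
          moreover have "K ^ 3 / K ^ 3 = 1" using that by (intro ennreal_divide_self) (auto simp: less_top[symmetric] power3_eq_cube ennreal_mult_eq_top_iff)
          ultimately show "(eroot 3 y / K) ^ 3 = y / K ^ 3" by simp
        qed
        have "3 * (eroot 3 (f x) * eroot 3 (g x) * eroot 3 (h x))
            = (A * B * C) * (3 * ((eroot 3 (f x) / A) * (eroot 3 (g x) / B) * (eroot 3 (h x) / C)))"
        proof -
          have e: "eroot 3 (f x) = A * (eroot 3 (f x) / A)" "eroot 3 (g x) = B * (eroot 3 (g x) / B)"
              "eroot 3 (h x) = C * (eroot 3 (h x) / C)"
            using s(1)[of A "f x"] s(1)[of B "g x"] s(1)[of C "h x"] nz fin by auto
          have "3 * ((A * X) * (B * Y) * (C * Z)) = (A * B * C) * (3 * (X * Y * Z))" for X Y Z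
            by (simp add: mult_ac)
          from this[of "eroot 3 (f x) / A" "eroot 3 (g x) / B" "eroot 3 (h x) / C"] show ?thesis
            unfolding e[symmetric] .
        qed
        also have "\<dots> \<le> (A * B * C) * ((eroot 3 (f x) / A) ^ 3 + (eroot 3 (g x) / B) ^ 3 + (eroot 3 (h x) / C) ^ 3)"
          by (intro mult_left_mono ennreal_amgm3) simp
        finally show ?thesis using s(2) nz fin by simp
      qed
      have "3 * (\<integral>\<^sup>+x. eroot 3 (f x) * eroot 3 (g x) * eroot 3 (h x) \<partial>M)
          \<le> (\<integral>\<^sup>+x. (A * B * C) * (f x / A ^ 3 + g x / B ^ 3 + h x / C ^ 3) \<partial>M)"
        by (subst nn_integral_cmult[symmetric], measurable) (intro nn_integral_mono pt)
      also have "\<dots> = (A * B * C) * (1 + 1 + 1)"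
        using nz fin by (subst nn_integral_cmult, measurable) (simp add: nn_integral_add nrm[OF pw(1)] nrm[OF pw(2)] nrm[OF pw(3)])
      also have "\<dots> = 3 * (A * B * C)" by (simp add: mult.commute)
      finally show ?thesis unfolding A_def B_def C_def by (subst (asm) ennreal_mult_le_mult_iff) auto
    qed
  qed
qed

lemma nn_integral_Holder2:
  assumes [measurable]: "f \<in> borel_measurable M" "g \<in> borel_measurable M"
  shows "(\<integral>\<^sup>+x. eroot 2 (f x) * eroot 2 (g x) \<partial>M) \<le> eroot 2 (\<integral>\<^sup>+x. f x \<partial>M) * eroot 2 (\<integral>\<^sup>+x. g x \<partial>M)"
proof -
  have "(\<integral>\<^sup>+x. eroot 2 (f x) * eroot 2 (g x) \<partial>M)\<^sup>2 \<le> (\<integral>\<^sup>+x. f x \<partial>M) * (\<integral>\<^sup>+x. g x \<partial>M)"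
    using Cauchy_Schwarz_nn_integral[of "\<lambda>x. eroot 2 (f x)" M "\<lambda>x. eroot 2 (g x)"] by (simp add: eroot_power)
  also have "\<dots> = (eroot 2 (\<integral>\<^sup>+x. f x \<partial>M) * eroot 2 (\<integral>\<^sup>+x. g x \<partial>M))\<^sup>2"
    by (simp add: power_mult_distrib eroot_power)
  finally have "eroot 2 ((\<integral>\<^sup>+x. eroot 2 (f x) * eroot 2 (g x) \<partial>M)\<^sup>2) \<le> eroot 2 ((eroot 2 (\<integral>\<^sup>+x. f x \<partial>M) * eroot 2 (\<integral>\<^sup>+x. g x \<partial>M))\<^sup>2)"
    by (intro eroot_mono) auto
  then show ?thesis by (simp add: eroot_of_power)
qed

section \<open>Loomis-Whitney inequalities\<close>

lemma nn_integral_lborel_swap: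
  fixes f :: "real \<Rightarrow> real \<Rightarrow> ennreal"
  assumes "case_prod f \<in> borel_measurable (borel \<Otimes>\<^sub>M borel)"
  shows "(\<integral>\<^sup>+x. \<integral>\<^sup>+y. f x y \<partial>lborel \<partial>lborel) = (\<integral>\<^sup>+y. \<integral>\<^sup>+x. f x y \<partial>lborel \<partial>lborel)"
  by (rule lborel_pair.Fubini') (use assms in measurable)

lemma measurable_uncurry2:
  assumes "case_prod K \<in> borel_measurable (borel \<Otimes>\<^sub>M borel)" "p \<in> borel_measurable M" "q \<in> borel_measurable M"
  shows "(\<lambda>x. K (p x) (q x)) \<in> borel_measurable M"
  using measurable_compose[OF measurable_Pair[OF assms(2,3)] assms(1)] by simp

text \<open>The variables are integrated one at a time: the factor free of the current variable is
  pulled out, and Cauchy-Schwarz separates the other two.\<close>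

lemma Loomis_Whitney_3:
  fixes F G H :: "real \<Rightarrow> real \<Rightarrow> ennreal"
  assumes F: "case_prod F \<in> borel_measurable (borel \<Otimes>\<^sub>M borel)"
    and G: "case_prod G \<in> borel_measurable (borel \<Otimes>\<^sub>M borel)"
    and H: "case_prod H \<in> borel_measurable (borel \<Otimes>\<^sub>M borel)"
  shows "(\<integral>\<^sup>+c. \<integral>\<^sup>+b. \<integral>\<^sup>+a. eroot 2 (F b c) * eroot 2 (G a c) * eroot 2 (H a b) \<partial>lborel \<partial>lborel \<partial>lborel)
    \<le> eroot 2 (\<integral>\<^sup>+c. \<integral>\<^sup>+b. F b c \<partial>lborel \<partial>lborel) * eroot 2 (\<integral>\<^sup>+c. \<integral>\<^sup>+a. G a c \<partial>lborel \<partial>lborel)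
      * eroot 2 (\<integral>\<^sup>+b. \<integral>\<^sup>+a. H a b \<partial>lborel \<partial>lborel)"
proof -
  note [measurable (raw)] = measurable_uncurry2[OF F] measurable_uncurry2[OF G] measurable_uncurry2[OF H]
  have "(\<integral>\<^sup>+c. \<integral>\<^sup>+b. \<integral>\<^sup>+a. eroot 2 (F b c) * eroot 2 (G a c) * eroot 2 (H a b) \<partial>lborel \<partial>lborel \<partial>lborel)
     = (\<integral>\<^sup>+c. \<integral>\<^sup>+b. eroot 2 (F b c) * (\<integral>\<^sup>+a. eroot 2 (G a c) * eroot 2 (H a b) \<partial>lborel) \<partial>lborel \<partial>lborel)"
    by (simp add: nn_integral_cmult mult.assoc)
  also have "\<dots> \<le> (\<integral>\<^sup>+c. \<integral>\<^sup>+b. eroot 2 (F b c) * (eroot 2 (\<integral>\<^sup>+a. G a c \<partial>lborel) * eroot 2 (\<integral>\<^sup>+a. H a b \<partial>lborel)) \<partial>lborel \<partial>lborel)"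
    by (intro nn_integral_mono mult_left_mono nn_integral_Holder2) auto
  also have "\<dots> = (\<integral>\<^sup>+c. eroot 2 (\<integral>\<^sup>+a. G a c \<partial>lborel) * (\<integral>\<^sup>+b. eroot 2 (F b c) * eroot 2 (\<integral>\<^sup>+a. H a b \<partial>lborel) \<partial>lborel) \<partial>lborel)"
    by (subst nn_integral_cmult[symmetric]) (auto simp: mult_ac)
  also have "\<dots> \<le> (\<integral>\<^sup>+c. eroot 2 (\<integral>\<^sup>+a. G a c \<partial>lborel) * (eroot 2 (\<integral>\<^sup>+b. F b c \<partial>lborel) * eroot 2 (\<integral>\<^sup>+b. \<integral>\<^sup>+a. H a b \<partial>lborel \<partial>lborel)) \<partial>lborel)"
    by (intro nn_integral_mono mult_left_mono nn_integral_Holder2) auto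
  also have "\<dots> = eroot 2 (\<integral>\<^sup>+b. \<integral>\<^sup>+a. H a b \<partial>lborel \<partial>lborel) * (\<integral>\<^sup>+c. eroot 2 (\<integral>\<^sup>+b. F b c \<partial>lborel) * eroot 2 (\<integral>\<^sup>+a. G a c \<partial>lborel) \<partial>lborel)"
    by (subst nn_integral_cmult[symmetric]) (auto simp: mult_ac)
  also have "\<dots> \<le> eroot 2 (\<integral>\<^sup>+b. \<integral>\<^sup>+a. H a b \<partial>lborel \<partial>lborel)
     * (eroot 2 (\<integral>\<^sup>+c. \<integral>\<^sup>+b. F b c \<partial>lborel \<partial>lborel) * eroot 2 (\<integral>\<^sup>+c. \<integral>\<^sup>+a. G a c \<partial>lborel \<partial>lborel))"
    by (intro mult_left_mono nn_integral_Holder2) auto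
  finally show ?thesis by (simp add: mult_ac)
qed

text \<open>In each variable one factor is pulled out and the three-factor Hoelder inequality
  separates the rest. All four factors are line integrals of the same \<open>F\<close>, so every
  full integral is \<open>I\<close>, and four cube roots multiply to
  \<open>I * eroot 3 I\<close>.\<close>

lemma Loomis_Whitney_4:
  fixes F :: "real \<Rightarrow> real \<Rightarrow> real \<Rightarrow> real \<Rightarrow> ennreal"
  assumes F: "(\<lambda>(a, b, c, d). F a b c d) \<in> borel_measurable (borel \<Otimes>\<^sub>M borel \<Otimes>\<^sub>M borel \<Otimes>\<^sub>M borel)"
  shows "(\<integral>\<^sup>+d. \<integral>\<^sup>+c. \<integral>\<^sup>+b. \<integral>\<^sup>+a. eroot 3 (\<integral>\<^sup>+t. F t b c d \<partial>lborel) * eroot 3 (\<integral>\<^sup>+t. F a t c d \<partial>lborel)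
        * eroot 3 (\<integral>\<^sup>+t. F a b t d \<partial>lborel) * eroot 3 (\<integral>\<^sup>+t. F a b c t \<partial>lborel) \<partial>lborel \<partial>lborel \<partial>lborel \<partial>lborel)
    \<le> (\<integral>\<^sup>+d. \<integral>\<^sup>+c. \<integral>\<^sup>+b. \<integral>\<^sup>+a. F a b c d \<partial>lborel \<partial>lborel \<partial>lborel \<partial>lborel)
      * eroot 3 (\<integral>\<^sup>+d. \<integral>\<^sup>+c. \<integral>\<^sup>+b. \<integral>\<^sup>+a. F a b c d \<partial>lborel \<partial>lborel \<partial>lborel \<partial>lborel)"
proof -
  have [measurable (raw)]: "(\<lambda>x. F (p x) (q x) (r x) (s x)) \<in> borel_measurable M"
    if "p \<in> borel_measurable M" "q \<in> borel_measurable M" "r \<in> borel_measurable M" "s \<in> borel_measurable M" for p q r s and M :: "'z measure"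
    using measurable_compose[OF measurable_Pair[OF that(1) measurable_Pair[OF that(2) measurable_Pair[OF that(3,4)]]] F] by simp
  note swap = nn_integral_lborel_swap
  \<comment> \<open>The digits name the variables already integrated out, counting \<open>a\<close>,
    \<open>b\<close>, \<open>c\<close>, \<open>d\<close> as 1 to 4.\<close>
  define M1 where "M1 b c d = (\<integral>\<^sup>+a. F a b c d \<partial>lborel)" for b c d
  define M2 where "M2 a c d = (\<integral>\<^sup>+b. F a b c d \<partial>lborel)" for a c d
  define M3 where "M3 a b d = (\<integral>\<^sup>+c. F a b c d \<partial>lborel)" for a b d
  define M4 where "M4 a b c = (\<integral>\<^sup>+d. F a b c d \<partial>lborel)" for a b c
  define M12 where "M12 c d = (\<integral>\<^sup>+b. M1 b c d \<partial>lborel)" for c d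
  define M13 where "M13 b d = (\<integral>\<^sup>+a. M3 a b d \<partial>lborel)" for b d
  define M14 where "M14 b c = (\<integral>\<^sup>+a. M4 a b c \<partial>lborel)" for b c
  define M123 where "M123 d = (\<integral>\<^sup>+c. M12 c d \<partial>lborel)" for d
  define M124 where "M124 c = (\<integral>\<^sup>+b. M14 b c \<partial>lborel)" for c
  define I where "I = (\<integral>\<^sup>+d. M123 d \<partial>lborel)"
  have [measurable (raw)]: "(\<lambda>x. M1 (p x) (q x) (r x)) \<in> borel_measurable M"
    if [measurable]: "p \<in> borel_measurable M" "q \<in> borel_measurable M" "r \<in> borel_measurable M" for p q r and M :: "'z measure"
    unfolding M1_def by measurable
  have [measurable (raw)]: "(\<lambda>x. M2 (p x) (q x) (r x)) \<in> borel_measurable M"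
    if [measurable]: "p \<in> borel_measurable M" "q \<in> borel_measurable M" "r \<in> borel_measurable M" for p q r and M :: "'z measure"
    unfolding M2_def by measurable
  have [measurable (raw)]: "(\<lambda>x. M3 (p x) (q x) (r x)) \<in> borel_measurable M"
    if [measurable]: "p \<in> borel_measurable M" "q \<in> borel_measurable M" "r \<in> borel_measurable M" for p q r and M :: "'z measure"
    unfolding M3_def by measurable
  have [measurable (raw)]: "(\<lambda>x. M4 (p x) (q x) (r x)) \<in> borel_measurable M"
    if [measurable]: "p \<in> borel_measurable M" "q \<in> borel_measurable M" "r \<in> borel_measurable M" for p q r and M :: "'z measure"
    unfolding M4_def by measurable
  have [measurable (raw)]: "(\<lambda>x. M12 (p x) (q x)) \<in> borel_measurable M"
    if [measurable]: "p \<in> borel_measurable M" "q \<in> borel_measurable M" for p q and M :: "'z measure"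
    unfolding M12_def by measurable
  have [measurable (raw)]: "(\<lambda>x. M13 (p x) (q x)) \<in> borel_measurable M"
    if [measurable]: "p \<in> borel_measurable M" "q \<in> borel_measurable M" for p q and M :: "'z measure"
    unfolding M13_def by measurable
  have [measurable (raw)]: "(\<lambda>x. M14 (p x) (q x)) \<in> borel_measurable M"
    if [measurable]: "p \<in> borel_measurable M" "q \<in> borel_measurable M" for p q and M :: "'z measure"
    unfolding M14_def by measurable
  have [measurable]: "M123 \<in> borel_measurable borel" "M124 \<in> borel_measurable borel"
    unfolding M123_def M124_def by measurable
  have e2: "(\<integral>\<^sup>+a. M2 a c d \<partial>lborel) = M12 c d" for c d
    unfolding M2_def M12_def M1_def by (rule swap) measurable
  have e3: "(\<integral>\<^sup>+b. M13 b d \<partial>lborel) = M123 d" for d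
  proof -
    have "(\<integral>\<^sup>+b. M13 b d \<partial>lborel) = (\<integral>\<^sup>+b. \<integral>\<^sup>+c. \<integral>\<^sup>+a. F a b c d \<partial>lborel \<partial>lborel \<partial>lborel)"
      unfolding M13_def M3_def by (intro nn_integral_cong swap) measurable
    also have "\<dots> = M123 d" unfolding M123_def M12_def M1_def by (rule swap) measurable
    finally show ?thesis .
  qed
  have e4: "(\<integral>\<^sup>+c. M124 c \<partial>lborel) = I"
  proof -
    have "M124 c = (\<integral>\<^sup>+d. M12 c d \<partial>lborel)" for c
    proof -
      have "M124 c = (\<integral>\<^sup>+b. \<integral>\<^sup>+d. \<integral>\<^sup>+a. F a b c d \<partial>lborel \<partial>lborel \<partial>lborel)"
        unfolding M124_def M14_def M4_def by (intro nn_integral_cong swap) measurable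
      also have "\<dots> = (\<integral>\<^sup>+d. M12 c d \<partial>lborel)" unfolding M12_def M1_def by (rule swap) measurable
      finally show ?thesis .
    qed
    then show ?thesis unfolding I_def M123_def by (simp only:) (rule swap, measurable)
  qed
  have "(\<integral>\<^sup>+d. \<integral>\<^sup>+c. \<integral>\<^sup>+b. \<integral>\<^sup>+a. eroot 3 (M1 b c d) * eroot 3 (M2 a c d) * eroot 3 (M3 a b d) * eroot 3 (M4 a b c) \<partial>lborel \<partial>lborel \<partial>lborel \<partial>lborel)
     = (\<integral>\<^sup>+d. \<integral>\<^sup>+c. \<integral>\<^sup>+b. eroot 3 (M1 b c d) * (\<integral>\<^sup>+a. eroot 3 (M2 a c d) * eroot 3 (M3 a b d) * eroot 3 (M4 a b c) \<partial>lborel) \<partial>lborel \<partial>lborel \<partial>lborel)"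
    by (subst nn_integral_cmult[symmetric]) (auto simp: mult_ac)
  also have "\<dots> \<le> (\<integral>\<^sup>+d. \<integral>\<^sup>+c. \<integral>\<^sup>+b. eroot 3 (M1 b c d) * (eroot 3 (\<integral>\<^sup>+a. M2 a c d \<partial>lborel) * eroot 3 (\<integral>\<^sup>+a. M3 a b d \<partial>lborel) * eroot 3 (\<integral>\<^sup>+a. M4 a b c \<partial>lborel)) \<partial>lborel \<partial>lborel \<partial>lborel)"
    by (intro nn_integral_mono mult_left_mono nn_integral_Holder3) auto
  also have "\<dots> = (\<integral>\<^sup>+d. \<integral>\<^sup>+c. eroot 3 (M12 c d) * (\<integral>\<^sup>+b. eroot 3 (M1 b c d) * eroot 3 (M13 b d) * eroot 3 (M14 b c) \<partial>lborel) \<partial>lborel \<partial>lborel)"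
    unfolding e2 M13_def[symmetric] M14_def[symmetric] by (subst nn_integral_cmult[symmetric]) (auto simp: mult_ac)
  also have "\<dots> \<le> (\<integral>\<^sup>+d. \<integral>\<^sup>+c. eroot 3 (M12 c d) * (eroot 3 (\<integral>\<^sup>+b. M1 b c d \<partial>lborel) * eroot 3 (\<integral>\<^sup>+b. M13 b d \<partial>lborel) * eroot 3 (\<integral>\<^sup>+b. M14 b c \<partial>lborel)) \<partial>lborel \<partial>lborel)"
    by (intro nn_integral_mono mult_left_mono nn_integral_Holder3) auto
  also have "\<dots> = (\<integral>\<^sup>+d. eroot 3 (M123 d) * (\<integral>\<^sup>+c. eroot 3 (M12 c d) * eroot 3 (M12 c d) * eroot 3 (M124 c) \<partial>lborel) \<partial>lborel)"
    unfolding e3 M12_def[symmetric] M124_def[symmetric] by (subst nn_integral_cmult[symmetric]) (auto simp: mult_ac)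
  also have "\<dots> \<le> (\<integral>\<^sup>+d. eroot 3 (M123 d) * (eroot 3 (\<integral>\<^sup>+c. M12 c d \<partial>lborel) * eroot 3 (\<integral>\<^sup>+c. M12 c d \<partial>lborel) * eroot 3 (\<integral>\<^sup>+c. M124 c \<partial>lborel)) \<partial>lborel)"
    by (intro nn_integral_mono mult_left_mono nn_integral_Holder3) auto
  also have "\<dots> = (\<integral>\<^sup>+d. (eroot 3 (M123 d)) ^ 3 * eroot 3 I \<partial>lborel)"
    unfolding M123_def[symmetric] e4 by (simp add: power3_eq_cube mult_ac)
  also have "\<dots> = I * eroot 3 I" by (simp add: eroot_power nn_integral_multc I_def)
  finally show ?thesis
    unfolding I_def M123_def M12_def M1_def M2_def M3_def M4_def .
qed

section \<open>Line integrals and iterated integration along the axes\<close>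

lemma power_le_line_integral:
  fixes \<psi> :: "real \<Rightarrow> real"
  assumes d: "\<And>t. (\<psi> has_real_derivative \<psi>' t) (at t)" and cont: "continuous_on UNIV \<psi>'"
    and zero: "\<And>t. t \<le> - R \<Longrightarrow> \<psi> t = 0"
  shows "ennreal (\<bar>\<psi> s\<bar> ^ Suc k) \<le> (\<integral>\<^sup>+t. ennreal (real (Suc k) * \<bar>\<psi> t\<bar> ^ k * \<bar>\<psi>' t\<bar>) \<partial>lborel)"
proof -
  \<comment> \<open>A zero of \<psi> not to the right of \<open>s\<close>, so that the fundamental
    theorem leaves no boundary term; the minimum covers \<open>s\<close> below
    \<open>- R\<close>.\<close>
  define a where "a = min s (- R)"
  have a: "a \<le> s" "\<psi> a = 0" using zero by (auto simp: a_def)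
  let ?f = "\<lambda>t. real (Suc k) * \<psi> t ^ k * \<psi>' t"
  have c: "continuous_on UNIV \<psi>" using DERIV_isCont[OF d] by (simp add: continuous_on_eq_continuous_at)
  have "has_bochner_integral lborel (\<lambda>t. ?f t * indicator {a..s} t) (\<psi> s ^ Suc k - \<psi> a ^ Suc k)"
  proof (rule has_bochner_integral_FTC_Icc_real[OF a(1)])
    fix t
    show "DERIV (\<lambda>t. \<psi> t ^ Suc k) t :> ?f t" using DERIV_power[OF d, of "Suc k" t] by (simp add: mult_ac)
    show "isCont ?f t" using c cont
      by (intro continuous_intros) (auto simp: continuous_on_eq_continuous_at)
  qed
  then have i: "integrable lborel (\<lambda>t. ?f t * indicator {a..s} t)" "(\<integral>t. ?f t * indicator {a..s} t \<partial>lborel) = \<psi> s ^ Suc k"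
    using a(2) by (auto simp: has_bochner_integral_iff)
  have "ennreal (\<bar>\<psi> s\<bar> ^ Suc k) = ennreal (norm (\<integral>t. ?f t * indicator {a..s} t \<partial>lborel))"
    unfolding i(2) by (simp add: power_abs abs_mult)
  also have "\<dots> \<le> (\<integral>\<^sup>+t. ennreal (norm (?f t * indicator {a..s} t)) \<partial>lborel)"
    by (rule integral_norm_bound_ennreal[OF i(1)])
  also have "\<dots> \<le> (\<integral>\<^sup>+t. ennreal (real (Suc k) * \<bar>\<psi> t\<bar> ^ k * \<bar>\<psi>' t\<bar>) \<partial>lborel)"
    by (intro nn_integral_mono ennreal_leI) (auto simp: indicator_def abs_mult power_abs)
  finally show ?thesis .
qed

text \<open>The offset \<open>v\<close> collects the coordinates already fixed, so the rule can be
  iterated until no basis vector is left.\<close>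

lemma nn_integral_PiM_insert_sum:
  fixes f :: "'a::euclidean_space \<Rightarrow> ennreal"
  assumes "finite I" "b \<notin> I" and f: "f \<in> borel_measurable borel"
  shows "(\<integral>\<^sup>+x. f (v + (\<Sum>i\<in>insert b I. x i *\<^sub>R i)) \<partial>(\<Pi>\<^sub>M i\<in>insert b I. lborel))
    = (\<integral>\<^sup>+t. \<integral>\<^sup>+x. f ((t *\<^sub>R b + v) + (\<Sum>i\<in>I. x i *\<^sub>R i)) \<partial>(\<Pi>\<^sub>M i\<in>I. lborel) \<partial>lborel)"
proof -
  interpret product_sigma_finite "\<lambda>_::'a. lborel :: real measure" by standard
  have "(\<lambda>x. f (v + (\<Sum>i\<in>insert b I. x i *\<^sub>R i))) \<in> borel_measurable (\<Pi>\<^sub>M i\<in>insert b I. lborel)"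
    by (intro measurable_compose[OF _ f] borel_measurable_add borel_measurable_sum borel_measurable_scaleR
        borel_measurable_const measurable_component_singleton[of _ "insert b I" "\<lambda>_. lborel", unfolded measurable_lborel1]) auto
  from product_nn_integral_insert_rev[OF assms(1,2) this] show ?thesis
  proof (elim trans, intro nn_integral_cong)
    fix t and x :: "'a \<Rightarrow> real"
    have "(\<Sum>i\<in>I. (x(b := t)) i *\<^sub>R i) = (\<Sum>i\<in>I. x i *\<^sub>R i)"
      using assms(2) by (intro sum.cong) auto
    then show "f (v + (\<Sum>i\<in>insert b I. (x(b := t)) i *\<^sub>R i)) = f ((t *\<^sub>R b + v) + (\<Sum>i\<in>I. x i *\<^sub>R i))"
      using assms(1,2) by (simp add: algebra_simps)
  qed
qed

lemma nn_integral_lborel_PiM: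
  fixes f :: "'a::euclidean_space \<Rightarrow> ennreal"
  assumes f: "f \<in> borel_measurable borel"
  shows "(\<integral>\<^sup>+x. f x \<partial>lborel) = (\<integral>\<^sup>+x. f (0 + (\<Sum>i\<in>Basis. x i *\<^sub>R i)) \<partial>(\<Pi>\<^sub>M i\<in>Basis. lborel))"
proof -
  have "(\<lambda>x. \<Sum>i\<in>Basis. x i *\<^sub>R i) \<in> borel_measurable (\<Pi>\<^sub>M i\<in>Basis. lborel)"
    by (intro borel_measurable_sum borel_measurable_scaleR borel_measurable_const
        measurable_component_singleton[of _ Basis "\<lambda>_. lborel", unfolded measurable_lborel1]) auto
  then show ?thesis by (subst lborel_eq) (simp add: nn_integral_distr f)
qed

lemma Basis_cart: "(Basis :: (real ^ 'n) set) = (\<lambda>i. axis i 1) ` UNIV"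
  by (auto simp: Basis_vec_def)

lemma nn_integral_coordinates_3:
  fixes f :: "real ^ 'n \<Rightarrow> ennreal"
  assumes f: "f \<in> borel_measurable borel" and U: "(UNIV :: 'n set) = {i, j, k}" and d: "i \<noteq> j" "i \<noteq> k" "j \<noteq> k"
  shows "(\<integral>\<^sup>+x. f x \<partial>lborel) =
    (\<integral>\<^sup>+c. \<integral>\<^sup>+b. \<integral>\<^sup>+a. f (a *\<^sub>R axis i 1 + b *\<^sub>R axis j 1 + c *\<^sub>R axis k 1) \<partial>lborel \<partial>lborel \<partial>lborel)"
proof -
  have B: "(Basis :: (real ^ 'n) set) = {axis k 1, axis j 1, axis i 1}" unfolding Basis_cart U by auto
  \<comment> \<open>Zero gets a name so that simplification does not delete the offset that
    \<open>nn_integral_PiM_insert_sum\<close> has to match.\<close>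
  define z where "z = (0 :: real ^ 'n)"
  show ?thesis
    unfolding nn_integral_lborel_PiM[OF f, folded z_def] B
    using d by (simp add: nn_integral_PiM_insert_sum[OF _ _ f] axis_eq_axis PiM_empty nn_integral_count_space_finite
        del: sum.insert) (simp add: z_def add.assoc)
qed

lemma nn_integral_coordinates_4:
  fixes f :: "real ^ 'n \<Rightarrow> ennreal"
  assumes f: "f \<in> borel_measurable borel" and U: "(UNIV :: 'n set) = {i, j, k, l}"
    and d: "i \<noteq> j" "i \<noteq> k" "j \<noteq> k" "i \<noteq> l" "j \<noteq> l" "k \<noteq> l"
  shows "(\<integral>\<^sup>+x. f x \<partial>lborel) =
    (\<integral>\<^sup>+d. \<integral>\<^sup>+c. \<integral>\<^sup>+b. \<integral>\<^sup>+a. f (a *\<^sub>R axis i 1 + b *\<^sub>R axis j 1 + c *\<^sub>R axis k 1 + d *\<^sub>R axis l 1) \<partial>lborel \<partial>lborel \<partial>lborel \<partial>lborel)"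
proof -
  have B: "(Basis :: (real ^ 'n) set) = {axis l 1, axis k 1, axis j 1, axis i 1}" unfolding Basis_cart U by auto
  define z where "z = (0 :: real ^ 'n)"
  show ?thesis
    unfolding nn_integral_lborel_PiM[OF f, folded z_def] B
    using d by (simp add: nn_integral_PiM_insert_sum[OF _ _ f] axis_eq_axis PiM_empty nn_integral_count_space_finite
        del: sum.insert) (simp add: z_def add.assoc)
qed

lemma test_grad_continuous:
  assumes "\<phi> \<in> test_functions \<Omega>"
  shows "continuous_on A (\<lambda>x. norm (grad \<phi> x))"
  unfolding grad_def by (intro continuous_on_norm continuous_on_vec_lambda test_continuous[OF test_partial[OF assms]])

lemma test_power_le_line_integral:
  fixes \<phi> :: "real ^ 'n \<Rightarrow> real"
  assumes \<phi>: "\<phi> \<in> test_functions \<Omega>"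
  shows "ennreal (\<bar>\<phi> (y + s *\<^sub>R axis i 1)\<bar> ^ Suc k)
    \<le> (\<integral>\<^sup>+t. ennreal (real (Suc k) * \<bar>\<phi> (y + t *\<^sub>R axis i 1)\<bar> ^ k * norm (grad \<phi> (y + t *\<^sub>R axis i 1))) \<partial>lborel)"
proof -
  let ?e = "axis i 1 :: real ^ 'n"
  obtain R where R: "\<And>x. x \<in> closure {x. \<phi> x \<noteq> 0} \<Longrightarrow> norm x \<le> R"
    using compact_imp_bounded[OF test_support[OF \<phi>]] by (auto simp: bounded_iff)
  have zero: "\<phi> (y + t *\<^sub>R ?e) = 0" if "t \<le> - (\<bar>R\<bar> + norm y + 1)" for t
  proof (rule zero_outside_support[of _ \<phi>], rule notI)
    assume "y + t *\<^sub>R ?e \<in> closure {x. \<phi> x \<noteq> 0}"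
    from R[OF this] have "norm (y + t *\<^sub>R ?e) \<le> R" .
    moreover have "norm (t *\<^sub>R ?e) \<le> norm (y + t *\<^sub>R ?e) + norm y"
      using norm_triangle_ineq4[of "y + t *\<^sub>R ?e" y] by simp
    ultimately show False using that by simp
  qed
  have d: "((\<lambda>t. \<phi> (y + t *\<^sub>R ?e)) has_real_derivative partial_deriv i \<phi> (y + t *\<^sub>R ?e)) (at t)" for t
    by (rule partial_line_derivative[OF test_differentiable[OF \<phi>]])
  have c: "continuous_on UNIV (\<lambda>t. partial_deriv i \<phi> (y + t *\<^sub>R ?e))"
    by (rule continuous_on_compose2[OF test_continuous[OF test_partial[OF \<phi>], of UNIV]]) (auto intro!: continuous_intros)
  have "ennreal (\<bar>\<phi> (y + s *\<^sub>R ?e)\<bar> ^ Suc k)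
      \<le> (\<integral>\<^sup>+t. ennreal (real (Suc k) * \<bar>\<phi> (y + t *\<^sub>R ?e)\<bar> ^ k * \<bar>partial_deriv i \<phi> (y + t *\<^sub>R ?e)\<bar>) \<partial>lborel)"
    by (rule power_le_line_integral[OF d c zero])
  also have "\<dots> \<le> (\<integral>\<^sup>+t. ennreal (real (Suc k) * \<bar>\<phi> (y + t *\<^sub>R axis i 1)\<bar> ^ k * norm (grad \<phi> (y + t *\<^sub>R axis i 1))) \<partial>lborel)"
  proof (intro nn_integral_mono ennreal_leI mult_left_mono)
    fix t
    show "\<bar>partial_deriv i \<phi> (y + t *\<^sub>R ?e)\<bar> \<le> norm (grad \<phi> (y + t *\<^sub>R ?e))"
      using Finite_Cartesian_Product.norm_nth_le[of "grad \<phi> (y + t *\<^sub>R ?e)" i] by (simp add: grad_def)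
  qed simp
  finally show ?thesis .
qed

lemma norm_jet:
  assumes \<phi>: "\<phi> \<in> test_functions \<Omega>"
  shows "ennreal ((norm (jet \<phi>))\<^sup>2) = (\<integral>\<^sup>+x. ennreal ((\<phi> x)\<^sup>2) \<partial>lborel) + (\<integral>\<^sup>+x. ennreal ((norm (grad \<phi> x))\<^sup>2) \<partial>lborel)"
proof -
  note m = test_sqint[OF \<phi>] test_sqint[OF test_partial[OF \<phi>]]
  have [measurable]: "partial_deriv i \<phi> \<in> borel_measurable borel" for i by (rule test_measurable[OF test_partial[OF \<phi>]])
  have "(norm (jet \<phi>))\<^sup>2 = (norm (cls \<phi>))\<^sup>2 + (\<Sum>i\<in>UNIV. (norm (cls (partial_deriv i \<phi>)))\<^sup>2)"
    by (simp add: jet_def norm_Pair norm_vec_def L2_set_def sum_nonneg)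
  then have "ennreal ((norm (jet \<phi>))\<^sup>2) = ennreal ((norm (cls \<phi>))\<^sup>2) + (\<Sum>i\<in>UNIV. ennreal ((norm (cls (partial_deriv i \<phi>)))\<^sup>2))"
    by (simp add: sum_nonneg)
  also have "\<dots> = (\<integral>\<^sup>+x. ennreal ((\<phi> x)\<^sup>2) \<partial>lborel) + (\<Sum>i\<in>UNIV. \<integral>\<^sup>+x. ennreal ((partial_deriv i \<phi> x)\<^sup>2) \<partial>lborel)"
    by (simp add: ennreal_norm_cls[symmetric] m nn_integral_completion)
  also have "(\<Sum>i\<in>UNIV. \<integral>\<^sup>+x. ennreal ((partial_deriv i \<phi> x)\<^sup>2) \<partial>lborel) = (\<integral>\<^sup>+x. (\<Sum>i\<in>UNIV. ennreal ((partial_deriv i \<phi> x)\<^sup>2)) \<partial>lborel)"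
    by (rule nn_integral_sum[symmetric]) measurable
  also have "\<dots> = (\<integral>\<^sup>+x. ennreal ((norm (grad \<phi> x))\<^sup>2) \<partial>lborel)"
    by (intro nn_integral_cong) (simp add: grad_def norm_vec_def L2_set_def sum_nonneg)
  finally show ?thesis .
qed

text \<open>
  The line integrals of \<open>3 \<phi>\<^sup>2 |\<nabla>\<phi>|\<close> dominate \<open>|\<phi>|\<^sup>3\<close>, so \<open>\<phi>\<^sup>4 = (|\<phi>|\<^sup>3)\<^bsup>4/3\<^esup>\<close> is bounded by the product in
  the Loomis-Whitney inequality.
\<close>

lemma sobolev_4:
  fixes \<phi> :: "real ^ 'n \<Rightarrow> real"
  assumes \<phi>: "\<phi> \<in> test_functions \<Omega>" and "CARD('n) = 4"
  defines "X \<equiv> \<integral>\<^sup>+x. ennreal ((\<phi> x) ^ 4) \<partial>lborel" and "G \<equiv> \<integral>\<^sup>+x. ennreal ((norm (grad \<phi> x))\<^sup>2) \<partial>lborel"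
  shows "X ^ 3 \<le> (9 * (X * G))\<^sup>2"
proof -
  have "card (UNIV :: 'n set) = Suc (Suc (Suc (Suc 0)))" using assms(2) by simp
  then obtain i j k l where U: "(UNIV :: 'n set) = {i, j, k, l}" and d: "i \<noteq> j" "i \<noteq> k" "j \<noteq> k" "i \<noteq> l" "j \<noteq> l" "k \<noteq> l"
    unfolding card_Suc_eq by (auto simp: insert_eq_iff)
  have [measurable]: "\<phi> \<in> borel_measurable borel" by (rule test_measurable[OF \<phi>])
  have [measurable]: "(\<lambda>x. norm (grad \<phi> x)) \<in> borel_measurable borel"
    by (rule borel_measurable_continuous_onI[OF test_grad_continuous[OF \<phi>]])
  define f where "f x = ennreal (3 * \<bar>\<phi> x\<bar>\<^sup>2 * norm (grad \<phi> x))" for x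
  have [measurable]: "f \<in> borel_measurable borel" unfolding f_def[abs_def] by measurable
  define v where "v a b c d = a *\<^sub>R axis i 1 + b *\<^sub>R axis j 1 + c *\<^sub>R axis k 1 + d *\<^sub>R (axis l 1 :: real ^ 'n)" for a b c d :: real
  define F where "F a b c d = f (v a b c d)" for a b c d
  have F: "(\<lambda>(a, b, c, d). F a b c d) \<in> borel_measurable (borel \<Otimes>\<^sub>M borel \<Otimes>\<^sub>M borel \<Otimes>\<^sub>M borel)"
    unfolding F_def v_def by measurable
  define I where "I = (\<integral>\<^sup>+x. f x \<partial>lborel)"
  have I: "I = (\<integral>\<^sup>+d. \<integral>\<^sup>+c. \<integral>\<^sup>+b. \<integral>\<^sup>+a. F a b c d \<partial>lborel \<partial>lborel \<partial>lborel \<partial>lborel)"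
    unfolding I_def F_def v_def by (rule nn_integral_coordinates_4[OF _ U d]) measurable
  have line: "ennreal \<bar>\<phi> x\<bar> \<le> eroot 3 (\<integral>\<^sup>+t. f (y + t *\<^sub>R axis n 1) \<partial>lborel)" if "x = y + s *\<^sub>R axis n 1" for x y s n
  proof -
    have "ennreal \<bar>\<phi> x\<bar> = eroot 3 (ennreal (\<bar>\<phi> x\<bar> ^ 3))" by (simp add: eroot_of_power ennreal_power[symmetric])
    also have "ennreal (\<bar>\<phi> x\<bar> ^ 3) \<le> (\<integral>\<^sup>+t. f (y + t *\<^sub>R axis n 1) \<partial>lborel)"
      using test_power_le_line_integral[OF \<phi>, of y s n 2] unfolding that f_def by (simp add: numeral_3_eq_3)
    finally show ?thesis by (simp add: eroot_mono)
  qed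
  have pt: "ennreal ((\<phi> (v a b c d)) ^ 4) \<le> eroot 3 (\<integral>\<^sup>+t. F t b c d \<partial>lborel) * eroot 3 (\<integral>\<^sup>+t. F a t c d \<partial>lborel)
        * eroot 3 (\<integral>\<^sup>+t. F a b t d \<partial>lborel) * eroot 3 (\<integral>\<^sup>+t. F a b c t \<partial>lborel)" for a b c d
  proof -
    let ?p = "ennreal \<bar>\<phi> (v a b c d)\<bar>"
    have "ennreal ((\<phi> (v a b c d)) ^ 4) = ?p * ?p * ?p * ?p"
    proof -
      have "ennreal ((\<phi> (v a b c d)) ^ 4) = ?p ^ 4" by (simp add: ennreal_power power_even_abs)
      then show ?thesis by (simp add: power4_eq_xxxx)
    qed
    also have "\<dots> \<le> eroot 3 (\<integral>\<^sup>+t. F t b c d \<partial>lborel) * eroot 3 (\<integral>\<^sup>+t. F a t c d \<partial>lborel)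
        * eroot 3 (\<integral>\<^sup>+t. F a b t d \<partial>lborel) * eroot 3 (\<integral>\<^sup>+t. F a b c t \<partial>lborel)"
    proof (intro mult_mono)
      show "?p \<le> eroot 3 (\<integral>\<^sup>+t. F t b c d \<partial>lborel)"
        using line[of "v a b c d" "b *\<^sub>R axis j 1 + c *\<^sub>R axis k 1 + d *\<^sub>R axis l 1" a i] by (simp add: F_def v_def add_ac)
      show "?p \<le> eroot 3 (\<integral>\<^sup>+t. F a t c d \<partial>lborel)"
        using line[of "v a b c d" "a *\<^sub>R axis i 1 + c *\<^sub>R axis k 1 + d *\<^sub>R axis l 1" b j] by (simp add: F_def v_def add_ac)
      show "?p \<le> eroot 3 (\<integral>\<^sup>+t. F a b t d \<partial>lborel)"
        using line[of "v a b c d" "a *\<^sub>R axis i 1 + b *\<^sub>R axis j 1 + d *\<^sub>R axis l 1" c k] by (simp add: F_def v_def add_ac)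
      show "?p \<le> eroot 3 (\<integral>\<^sup>+t. F a b c t \<partial>lborel)"
        using line[of "v a b c d" "a *\<^sub>R axis i 1 + b *\<^sub>R axis j 1 + c *\<^sub>R axis k 1" d l] by (simp add: F_def v_def add_ac)
    qed auto
    finally show ?thesis .
  qed
  have "X = (\<integral>\<^sup>+d. \<integral>\<^sup>+c. \<integral>\<^sup>+b. \<integral>\<^sup>+a. ennreal ((\<phi> (v a b c d)) ^ 4) \<partial>lborel \<partial>lborel \<partial>lborel \<partial>lborel)"
    unfolding X_def v_def by (rule nn_integral_coordinates_4[OF _ U d]) measurable
  also have "\<dots> \<le> I * eroot 3 I"
    unfolding I by (rule order_trans[OF _ Loomis_Whitney_4[OF F]]) (intro nn_integral_mono pt)
  \<comment> \<open>Cubing removes the root and leaves the fourth power of \<open>I\<close>.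
    Cauchy-Schwarz then brings back \<open>X\<close>, which is cancelled only after it is known to
    be finite and nonzero.\<close>
  finally have "X ^ 3 \<le> (I * eroot 3 I) ^ 3" by (rule power_mono) simp
  also have "\<dots> = I ^ 3 * I" by (simp add: power_mult_distrib eroot_power)
  also have "\<dots> = (I\<^sup>2)\<^sup>2" by (simp add: power2_eq_square power3_eq_cube mult_ac)
  also have "I\<^sup>2 \<le> 9 * (X * G)"
  proof -
    have "I = (\<integral>\<^sup>+x. ennreal ((\<phi> x)\<^sup>2) * ennreal (3 * norm (grad \<phi> x)) \<partial>lborel)"
      unfolding I_def f_def by (intro nn_integral_cong) (simp add: ennreal_mult[symmetric] mult_ac)
    then have "I\<^sup>2 \<le> (\<integral>\<^sup>+x. (ennreal ((\<phi> x)\<^sup>2))\<^sup>2 \<partial>lborel) * (\<integral>\<^sup>+x. (ennreal (3 * norm (grad \<phi> x)))\<^sup>2 \<partial>lborel)"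
      by (simp only:) (rule Cauchy_Schwarz_nn_integral; measurable)
    also have "(\<integral>\<^sup>+x. (ennreal ((\<phi> x)\<^sup>2))\<^sup>2 \<partial>lborel) = X"
      unfolding X_def by (intro nn_integral_cong) (simp add: ennreal_power power_mult[symmetric])
    also have "(\<integral>\<^sup>+x. (ennreal (3 * norm (grad \<phi> x)))\<^sup>2 \<partial>lborel) = (\<integral>\<^sup>+x. 9 * ennreal ((norm (grad \<phi> x))\<^sup>2) \<partial>lborel)"
      by (intro nn_integral_cong) (simp add: ennreal_power power_mult_distrib ennreal_mult)
    also have "\<dots> = 9 * G" unfolding G_def by (rule nn_integral_cmult) measurable
    finally show ?thesis by (simp add: mult_ac)
  qed
  finally show ?thesis by (simp add: power_mono)
qed

text \<open>
  Writing \<open>\<phi>\<^sup>8 = \<phi>\<^sup>2 \<phi>\<^sup>3 \<phi>\<^sup>3\<close> and bounding \<open>\<phi>\<^sup>2\<close> by line integrals in one direction and \<open>|\<phi>|\<^sup>3\<close> in the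
  other two gives the \<open>L\<^sup>4\<close> bound directly, without passing through \<open>L\<^sup>6\<close>.
\<close>

lemma sobolev_3:
  fixes \<phi> :: "real ^ 'n \<Rightarrow> real"
  assumes \<phi>: "\<phi> \<in> test_functions \<Omega>" and "CARD('n) = 3"
  defines "X \<equiv> \<integral>\<^sup>+x. ennreal ((\<phi> x) ^ 4) \<partial>lborel" and "G \<equiv> \<integral>\<^sup>+x. ennreal ((norm (grad \<phi> x))\<^sup>2) \<partial>lborel"
    and "Q \<equiv> \<integral>\<^sup>+x. ennreal ((\<phi> x)\<^sup>2) \<partial>lborel"
  shows "X ^ 4 \<le> (4 * (Q * G)) * (9 * (X * G))\<^sup>2"
proof -
  have "card (UNIV :: 'n set) = Suc (Suc (Suc 0))" using assms(2) by simp
  then obtain i j k where U: "(UNIV :: 'n set) = {i, j, k}" and d: "i \<noteq> j" "i \<noteq> k" "j \<noteq> k"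
    unfolding card_Suc_eq by (auto simp: insert_eq_iff)
  have [measurable]: "\<phi> \<in> borel_measurable borel" by (rule test_measurable[OF \<phi>])
  have [measurable]: "(\<lambda>x. norm (grad \<phi> x)) \<in> borel_measurable borel"
    by (rule borel_measurable_continuous_onI[OF test_grad_continuous[OF \<phi>]])
  \<comment> \<open>\<open>f n\<close> dominates the derivative of the power n + 1 of the absolute
    value of \<phi> along every axis. The case n = 1 serves one direction, n = 2 the other
    two.\<close>
  define f where "f n x = ennreal (real (Suc n) * \<bar>\<phi> x\<bar> ^ n * norm (grad \<phi> x))" for n x
  have [measurable]: "f n \<in> borel_measurable borel" for n unfolding f_def[abs_def] by measurable
  define v where "v a b c = a *\<^sub>R axis i 1 + b *\<^sub>R axis j 1 + c *\<^sub>R (axis k 1 :: real ^ 'n)" for a b c :: real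
  define I where "I n = (\<integral>\<^sup>+x. f n x \<partial>lborel)" for n
  have I: "I n = (\<integral>\<^sup>+c. \<integral>\<^sup>+b. \<integral>\<^sup>+a. f n (v a b c) \<partial>lborel \<partial>lborel \<partial>lborel)" for n
    unfolding I_def v_def by (rule nn_integral_coordinates_3[OF _ U d]) measurable
  define F H K where "F b c = (\<integral>\<^sup>+a. f 1 (v a b c) \<partial>lborel)" and "H a c = (\<integral>\<^sup>+b. f 2 (v a b c) \<partial>lborel)"
    and "K a b = (\<integral>\<^sup>+c. f 2 (v a b c) \<partial>lborel)" for a b c
  have FHK: "case_prod F \<in> borel_measurable (borel \<Otimes>\<^sub>M borel)" "case_prod H \<in> borel_measurable (borel \<Otimes>\<^sub>M borel)"
      "case_prod K \<in> borel_measurable (borel \<Otimes>\<^sub>M borel)"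
    unfolding F_def[abs_def] H_def[abs_def] K_def[abs_def] v_def by measurable
  have swap: "(\<integral>\<^sup>+x. \<integral>\<^sup>+y. g x y \<partial>lborel \<partial>lborel) = (\<integral>\<^sup>+y. \<integral>\<^sup>+x. g x y \<partial>lborel \<partial>lborel)"
    if "case_prod g \<in> borel_measurable (borel \<Otimes>\<^sub>M borel)" for g :: "real \<Rightarrow> real \<Rightarrow> ennreal"
    by (rule nn_integral_lborel_swap[OF that])
  have IF: "(\<integral>\<^sup>+c. \<integral>\<^sup>+b. F b c \<partial>lborel \<partial>lborel) = I 1" unfolding F_def I ..
  have IH: "(\<integral>\<^sup>+c. \<integral>\<^sup>+a. H a c \<partial>lborel \<partial>lborel) = I 2"
    unfolding H_def I by (intro nn_integral_cong swap) (unfold v_def, measurable)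
  have IK: "(\<integral>\<^sup>+b. \<integral>\<^sup>+a. K a b \<partial>lborel \<partial>lborel) = I 2"
  proof -
    have "(\<integral>\<^sup>+b. \<integral>\<^sup>+a. K a b \<partial>lborel \<partial>lborel) = (\<integral>\<^sup>+b. \<integral>\<^sup>+c. \<integral>\<^sup>+a. f 2 (v a b c) \<partial>lborel \<partial>lborel \<partial>lborel)"
      unfolding K_def by (intro nn_integral_cong swap) (unfold v_def, measurable)
    also have "\<dots> = I 2" unfolding I by (rule swap) (unfold v_def, measurable)
    finally show ?thesis .
  qed
  have line: "ennreal (\<bar>\<phi> x\<bar> ^ Suc n) \<le> (\<integral>\<^sup>+t. f n (y + t *\<^sub>R axis m 1) \<partial>lborel)" if "x = y + s *\<^sub>R axis m 1" for x y s m n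
    using test_power_le_line_integral[OF \<phi>, of y s m n] unfolding that f_def by simp
  have pt: "ennreal ((\<phi> (v a b c)) ^ 4) \<le> eroot 2 (F b c) * eroot 2 (H a c) * eroot 2 (K a b)" for a b c
  proof -
    let ?p = "\<bar>\<phi> (v a b c)\<bar>"
    have "ennreal ((\<phi> (v a b c)) ^ 4) = ennreal (root 2 (?p ^ 2) * root 2 (?p ^ 3) * root 2 (?p ^ 3))"
    proof -
      have "root 2 (?p ^ 3) * root 2 (?p ^ 3) = ?p ^ 3"
        using real_root_pow_pos2[of 2 "?p ^ 3"] by (simp add: power2_eq_square)
      moreover have "root 2 (?p ^ 2) = ?p" by (rule real_root_power_cancel) auto
      ultimately have "root 2 (?p ^ 2) * root 2 (?p ^ 3) * root 2 (?p ^ 3) = ?p * ?p ^ 3" by (simp add: mult.assoc)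
      also have "\<dots> = ?p ^ 4" by (simp add: power4_eq_xxxx power3_eq_cube mult.assoc)
      also have "\<dots> = \<phi> (v a b c) ^ 4" by (simp add: power_even_abs)
      finally show ?thesis by simp
    qed
    also have "\<dots> = eroot 2 (ennreal (?p ^ 2)) * eroot 2 (ennreal (?p ^ 3)) * eroot 2 (ennreal (?p ^ 3))"
      by (simp add: eroot_ennreal ennreal_mult)
    also have "\<dots> \<le> eroot 2 (F b c) * eroot 2 (H a c) * eroot 2 (K a b)"
    proof (intro mult_mono eroot_mono)
      show "ennreal (?p ^ 2) \<le> F b c"
        using line[of "v a b c" "b *\<^sub>R axis j 1 + c *\<^sub>R axis k 1" a i 1] by (simp add: F_def v_def add_ac numeral_2_eq_2)
      show "ennreal (?p ^ 3) \<le> H a c"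
        using line[of "v a b c" "a *\<^sub>R axis i 1 + c *\<^sub>R axis k 1" b j 2] by (simp add: H_def v_def add_ac numeral_3_eq_3)
      show "ennreal (?p ^ 3) \<le> K a b"
        using line[of "v a b c" "a *\<^sub>R axis i 1 + b *\<^sub>R axis j 1" c k 2] by (simp add: K_def v_def add_ac numeral_3_eq_3)
    qed auto
    finally show ?thesis .
  qed
  have "X = (\<integral>\<^sup>+c. \<integral>\<^sup>+b. \<integral>\<^sup>+a. ennreal ((\<phi> (v a b c)) ^ 4) \<partial>lborel \<partial>lborel \<partial>lborel)"
    unfolding X_def v_def by (rule nn_integral_coordinates_3[OF _ U d]) measurable
  also have "\<dots> \<le> eroot 2 (I 1) * eroot 2 (I 2) * eroot 2 (I 2)"
    unfolding IF[symmetric] by (subst (1) IH[symmetric], subst IK[symmetric])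
      (rule order_trans[OF _ Loomis_Whitney_3[OF FHK]], intro nn_integral_mono pt)
  finally have "X ^ 4 \<le> (eroot 2 (I 1) * eroot 2 (I 2) * eroot 2 (I 2)) ^ 4" by (rule power_mono) simp
  also have "\<dots> = ((eroot 2 (I 1))\<^sup>2)\<^sup>2 * (((eroot 2 (I 2))\<^sup>2)\<^sup>2)\<^sup>2" by (simp add: power_mult_distrib power4_eq_xxxx power2_eq_square mult_ac)
  also have "\<dots> = (I 1)\<^sup>2 * ((I 2)\<^sup>2)\<^sup>2" by (simp add: eroot_power)
  also have "\<dots> \<le> (4 * (Q * G)) * (9 * (X * G))\<^sup>2"
  proof (intro mult_mono power_mono)
    have "I 1 = (\<integral>\<^sup>+x. ennreal \<bar>\<phi> x\<bar> * ennreal (2 * norm (grad \<phi> x)) \<partial>lborel)"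
      unfolding I_def f_def by (intro nn_integral_cong) (simp add: ennreal_mult[symmetric] mult_ac)
    then have "(I 1)\<^sup>2 \<le> (\<integral>\<^sup>+x. (ennreal \<bar>\<phi> x\<bar>)\<^sup>2 \<partial>lborel) * (\<integral>\<^sup>+x. (ennreal (2 * norm (grad \<phi> x)))\<^sup>2 \<partial>lborel)"
      by (simp only:) (rule Cauchy_Schwarz_nn_integral; measurable)
    also have "(\<integral>\<^sup>+x. (ennreal \<bar>\<phi> x\<bar>)\<^sup>2 \<partial>lborel) = Q"
      unfolding Q_def by (intro nn_integral_cong) (simp add: ennreal_power)
    also have "(\<integral>\<^sup>+x. (ennreal (2 * norm (grad \<phi> x)))\<^sup>2 \<partial>lborel) = (\<integral>\<^sup>+x. 4 * ennreal ((norm (grad \<phi> x))\<^sup>2) \<partial>lborel)"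
      by (intro nn_integral_cong) (simp add: ennreal_power power_mult_distrib ennreal_mult)
    also have "\<dots> = 4 * G" unfolding G_def by (rule nn_integral_cmult) measurable
    finally show "(I 1)\<^sup>2 \<le> 4 * (Q * G)" by (simp add: mult_ac)
    have "I 2 = (\<integral>\<^sup>+x. ennreal ((\<phi> x)\<^sup>2) * ennreal (3 * norm (grad \<phi> x)) \<partial>lborel)"
      unfolding I_def f_def by (intro nn_integral_cong) (simp add: ennreal_mult[symmetric] mult_ac)
    then have "(I 2)\<^sup>2 \<le> (\<integral>\<^sup>+x. (ennreal ((\<phi> x)\<^sup>2))\<^sup>2 \<partial>lborel) * (\<integral>\<^sup>+x. (ennreal (3 * norm (grad \<phi> x)))\<^sup>2 \<partial>lborel)"
      by (simp only:) (rule Cauchy_Schwarz_nn_integral; measurable)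
    also have "(\<integral>\<^sup>+x. (ennreal ((\<phi> x)\<^sup>2))\<^sup>2 \<partial>lborel) = X"
      unfolding X_def by (intro nn_integral_cong) (simp add: ennreal_power power_mult[symmetric])
    also have "(\<integral>\<^sup>+x. (ennreal (3 * norm (grad \<phi> x)))\<^sup>2 \<partial>lborel) = (\<integral>\<^sup>+x. 9 * ennreal ((norm (grad \<phi> x))\<^sup>2) \<partial>lborel)"
      by (intro nn_integral_cong) (simp add: ennreal_power power_mult_distrib ennreal_mult)
    also have "\<dots> = 9 * G" unfolding G_def by (rule nn_integral_cmult) measurable
    finally show "(I 2)\<^sup>2 \<le> 9 * (X * G)" by (simp add: mult_ac)
  qed auto
  finally show ?thesis .
qed

text \<open>Both dimensional inequalities contain the fourth-power integral on either side. It is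
  finite for a test function, so its square can be cancelled: this leaves
  \<open>x \<le> 81 * g\<^sup>2\<close> in dimension four and
  \<open>x\<^sup>2 \<le> 324 * (q * g ^ 3)\<close> in dimension three, whence
  \<open>x \<le> 18 * S\<^sup>2\<close>; 81 covers both.\<close>

proposition sobolev_test:
  fixes \<phi> :: "real ^ 'n \<Rightarrow> real"
  assumes \<phi>: "\<phi> \<in> test_functions \<Omega>" and N: "CARD('n) \<in> {3, 4}"
  shows "(\<integral>\<^sup>+x. ennreal ((\<phi> x) ^ 4) \<partial>lborel) \<le> ennreal (81 * (norm (jet \<phi>)) ^ 4)"
proof -
  define X where "X = (\<integral>\<^sup>+x. ennreal ((\<phi> x) ^ 4) \<partial>lborel)"
  define Q where "Q = (\<integral>\<^sup>+x. ennreal ((\<phi> x)\<^sup>2) \<partial>lborel)"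
  define G where "G = (\<integral>\<^sup>+x. ennreal ((norm (grad \<phi> x))\<^sup>2) \<partial>lborel)"
  define S where "S = (norm (jet \<phi>))\<^sup>2"
  have "integrable lborel (\<lambda>x. \<phi> x * \<phi> x * (\<phi> x * \<phi> x))"
    by (intro test_integrable(1)[of _ \<Omega>] test_mult \<phi>)
  also have "(\<lambda>x. \<phi> x * \<phi> x * (\<phi> x * \<phi> x)) = (\<lambda>x. \<phi> x ^ 4)" by (simp add: power4_eq_xxxx mult.assoc)
  finally have "X = ennreal (\<integral>x. \<phi> x ^ 4 \<partial>lborel)"
    unfolding X_def by (rule nn_integral_eq_integral) simp
  then obtain x where x: "X = ennreal x" "0 \<le> x" by (metis ennreal_cases ennreal_neq_top)
  have QG: "ennreal S = Q + G" using norm_jet[OF \<phi>] by (simp add: S_def Q_def G_def)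
  then have "Q \<noteq> top" "G \<noteq> top" by (metis ennreal_neq_top add_top_left_ennreal add_top_right_ennreal top_add add_top)+
  then obtain q g where q: "Q = ennreal q" "0 \<le> q" and g: "G = ennreal g" "0 \<le> g" by (cases Q; cases G) auto
  have S: "S = q + g" using QG q g by (simp add: S_def ennreal_plus[symmetric] del: ennreal_plus)
  have "x \<le> 81 * S\<^sup>2"
  proof (cases "x = 0")
    case False
    then have x0: "x > 0" using x by simp
    consider "CARD('n) = 4" | "CARD('n) = 3" using N by auto
    then show ?thesis
    proof cases
      case 1
      have "ennreal (x ^ 3) \<le> ennreal ((9 * (x * g))\<^sup>2)"
      proof -
        have "9 * (X * G) = ennreal (9 * (x * g))" using x g by (simp add: ennreal_mult)
        then have "(9 * (X * G))\<^sup>2 = ennreal ((9 * (x * g))\<^sup>2)" using x g by (simp only:) (simp add: ennreal_power)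
        then show ?thesis using sobolev_4[OF \<phi> 1, folded X_def G_def] x by (simp only:) (simp add: ennreal_power)
      qed
      then have "x ^ 3 \<le> (9 * (x * g))\<^sup>2" by (simp add: ennreal_le_iff)
      then have "x * x\<^sup>2 \<le> (81 * g\<^sup>2) * x\<^sup>2" by (simp add: power_mult_distrib power2_eq_square power3_eq_cube mult_ac)
      then have "x \<le> 81 * g\<^sup>2" using x0 by (simp add: mult_le_cancel_right)
      also have "\<dots> \<le> 81 * S\<^sup>2" using q g by (intro mult_left_mono power_mono) (auto simp: S)
      finally show ?thesis .
    next
      case 2
      have "ennreal (x ^ 4) \<le> ennreal ((4 * (q * g)) * (9 * (x * g))\<^sup>2)"
      proof -
        have "9 * (X * G) = ennreal (9 * (x * g))" using x g by (simp add: ennreal_mult)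
        then have B: "(9 * (X * G))\<^sup>2 = ennreal ((9 * (x * g))\<^sup>2)" using x g by (simp only:) (simp add: ennreal_power)
        have A: "4 * (Q * G) = ennreal (4 * (q * g))" using q g by (simp add: ennreal_mult)
        have "(4 * (Q * G)) * (9 * (X * G))\<^sup>2 = ennreal ((4 * (q * g)) * (9 * (x * g))\<^sup>2)"
          unfolding A B by (rule ennreal_mult'[symmetric]) (use q g in simp)
        then show ?thesis using sobolev_3[OF \<phi> 2, folded X_def G_def Q_def] x by (simp only:) (simp add: ennreal_power)
      qed
      then have "x ^ 4 \<le> (4 * (q * g)) * (9 * (x * g))\<^sup>2" using q g x by (simp add: ennreal_le_iff)
      then have "x\<^sup>2 * x\<^sup>2 \<le> (324 * (q * g ^ 3)) * x\<^sup>2" by (simp add: power_mult_distrib power2_eq_square power3_eq_cube power4_eq_xxxx mult_ac)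
      then have "x\<^sup>2 \<le> 324 * (q * g ^ 3)" by (rule mult_right_le_imp_le) (use x0 in simp)
      also have "\<dots> \<le> 324 * (S * S ^ 3)" using q g by (intro mult_left_mono mult_mono power_mono) (auto simp: S)
      also have "\<dots> = (18 * S\<^sup>2)\<^sup>2" by (simp add: power2_eq_square power3_eq_cube)
      finally have "x \<le> 18 * S\<^sup>2" by (rule power2_le_imp_le) simp
      also have "\<dots> \<le> 81 * S\<^sup>2" by simp
      finally show ?thesis .
    qed
  qed simp
  then have "X \<le> ennreal (81 * S\<^sup>2)" unfolding x(1) by (rule ennreal_leI)
  then show ?thesis by (simp add: X_def S_def power_mult[symmetric])
qed

section \<open>Compactness of the embedding\<close>

text \<open>The increment is the integral of the derivative along the segment; Cauchy-Schwarz on the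
  unit interval, Fubini and translation invariance give the bound.\<close>

lemma translation_estimate:
  fixes \<phi> :: "real ^ 'n \<Rightarrow> real"
  assumes \<phi>: "\<phi> \<in> test_functions \<Omega>"
  shows "(\<integral>\<^sup>+x. ennreal ((\<phi> (x + h) - \<phi> x)\<^sup>2) \<partial>lborel)
    \<le> ennreal ((norm h)\<^sup>2) * (\<integral>\<^sup>+x. ennreal ((norm (grad \<phi> x))\<^sup>2) \<partial>lborel)"
proof -
  have [measurable]: "\<phi> \<in> borel_measurable borel" by (rule test_measurable[OF \<phi>])
  have [measurable]: "(\<lambda>x. norm (grad \<phi> x)) \<in> borel_measurable borel"
    by (rule borel_measurable_continuous_onI[OF test_grad_continuous[OF \<phi>]])
  define g where "g x t = ennreal ((norm h * norm (grad \<phi> (x + t *\<^sub>R h)))\<^sup>2)" for x t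
  have "ennreal ((\<phi> (x + h) - \<phi> x)\<^sup>2) \<le> (\<integral>\<^sup>+t. g x t * indicator {0..1} t \<partial>lborel)" for x
  proof -
    let ?f = "\<lambda>t. inner (grad \<phi> (x + t *\<^sub>R h)) h"
    have gc: "continuous_on UNIV (\<lambda>x. grad \<phi> x)"
      unfolding grad_def by (intro continuous_on_vec_lambda test_continuous[OF test_partial[OF \<phi>]])
    have fc: "continuous_on UNIV ?f"
      by (intro continuous_on_inner continuous_on_const continuous_on_compose2[OF gc]) (auto intro!: continuous_intros)
    have "has_bochner_integral lborel (\<lambda>t. ?f t * indicator {0..1} t) (\<phi> (x + 1 *\<^sub>R h) - \<phi> (x + 0 *\<^sub>R h))"
    proof (rule has_bochner_integral_FTC_Icc_real)
      show "DERIV (\<lambda>t. \<phi> (x + t *\<^sub>R h)) t :> ?f t" for t by (rule line_derivative[OF test_differentiable[OF \<phi>]])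
      show "isCont ?f t" for t using fc by (simp add: continuous_on_eq_continuous_at)
    qed simp
    then have i: "integrable lborel (\<lambda>t. ?f t * indicator {0..1} t)" "(\<integral>t. ?f t * indicator {0..1} t \<partial>lborel) = \<phi> (x + h) - \<phi> x"
      by (auto simp: has_bochner_integral_iff)
    have "ennreal \<bar>\<phi> (x + h) - \<phi> x\<bar> \<le> (\<integral>\<^sup>+t. ennreal (norm (?f t * indicator {0..1} t)) \<partial>lborel)"
      using integral_norm_bound_ennreal[OF i(1)] unfolding i(2) by simp
    \<comment> \<open>The indicator is repeated so that Cauchy-Schwarz can give one copy to each
      factor; the second factor then integrates to 1.\<close>
    also have "\<dots> \<le> (\<integral>\<^sup>+t. ennreal (norm h * norm (grad \<phi> (x + t *\<^sub>R h))) * indicator {0..1} t * indicator {0..1} t \<partial>lborel)"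
    proof (intro nn_integral_mono)
      fix t
      show "ennreal (norm (?f t * indicator {0..1} t)) \<le> ennreal (norm h * norm (grad \<phi> (x + t *\<^sub>R h))) * indicator {0..1} t * indicator {0..1} t"
        using Cauchy_Schwarz_ineq2[of "grad \<phi> (x + t *\<^sub>R h)" h]
        by (cases "t \<in> {0..1}") (auto simp: mult.commute intro!: ennreal_leI)
    qed
    finally have "(ennreal \<bar>\<phi> (x + h) - \<phi> x\<bar>)\<^sup>2 \<le> (\<integral>\<^sup>+t. ennreal (norm h * norm (grad \<phi> (x + t *\<^sub>R h))) * indicator {0..1} t * indicator {0..1} t \<partial>lborel)\<^sup>2"
      by (rule power_mono) simp
    also have "\<dots> \<le> (\<integral>\<^sup>+t. (ennreal (norm h * norm (grad \<phi> (x + t *\<^sub>R h))) * indicator {0..1} t)\<^sup>2 \<partial>lborel) * (\<integral>\<^sup>+t. (indicator {0..1::real} t)\<^sup>2 \<partial>lborel)"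
      by (rule Cauchy_Schwarz_nn_integral; measurable)
    also have "(\<integral>\<^sup>+t. (indicator {0..1::real} t)\<^sup>2 \<partial>lborel) = (\<integral>\<^sup>+t. indicator {0..1::real} t \<partial>lborel)"
      by (intro nn_integral_cong) (simp add: indicator_def)
    also have "\<dots> = 1" by simp
    also have "(\<integral>\<^sup>+t. (ennreal (norm h * norm (grad \<phi> (x + t *\<^sub>R h))) * indicator {0..1} t)\<^sup>2 \<partial>lborel) = (\<integral>\<^sup>+t. g x t * indicator {0..1} t \<partial>lborel)"
      unfolding g_def by (intro nn_integral_cong) (simp add: indicator_def ennreal_power)
    finally show ?thesis by (simp add: ennreal_power)
  qed
  then have "(\<integral>\<^sup>+x. ennreal ((\<phi> (x + h) - \<phi> x)\<^sup>2) \<partial>lborel) \<le> (\<integral>\<^sup>+x. \<integral>\<^sup>+t. g x t * indicator {0..1} t \<partial>lborel \<partial>lborel)"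
    by (rule nn_integral_mono)
  also have "\<dots> = (\<integral>\<^sup>+t. \<integral>\<^sup>+x. g x t * indicator {0..1} t \<partial>lborel \<partial>lborel)"
    by (rule lborel_pair.Fubini') (unfold g_def, measurable)
  also have "\<dots> = (\<integral>\<^sup>+t. ennreal ((norm h)\<^sup>2) * (\<integral>\<^sup>+x. ennreal ((norm (grad \<phi> x))\<^sup>2) \<partial>lborel) * indicator {0..1::real} t \<partial>lborel)"
  proof (intro nn_integral_cong)
    fix t :: real
    have "(\<integral>\<^sup>+x. g x t \<partial>lborel) = (\<integral>\<^sup>+x. ennreal ((norm h)\<^sup>2) * ennreal ((norm (grad \<phi> (t *\<^sub>R h + x)))\<^sup>2) \<partial>lborel)"
      unfolding g_def by (intro nn_integral_cong) (simp add: power_mult_distrib ennreal_mult add.commute)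
    also have "\<dots> = ennreal ((norm h)\<^sup>2) * (\<integral>\<^sup>+x. ennreal ((norm (grad \<phi> (t *\<^sub>R h + x)))\<^sup>2) \<partial>lborel)"
      by (rule nn_integral_cmult) measurable
    also have "(\<integral>\<^sup>+x. ennreal ((norm (grad \<phi> (t *\<^sub>R h + x)))\<^sup>2) \<partial>lborel) = (\<integral>\<^sup>+x. ennreal ((norm (grad \<phi> x))\<^sup>2) \<partial>distr lborel borel ((+) (t *\<^sub>R h)))"
      by (subst nn_integral_distr) auto
    also have "\<dots> = (\<integral>\<^sup>+x. ennreal ((norm (grad \<phi> x))\<^sup>2) \<partial>lborel)" by (simp add: lborel_distr_plus)
    finally have e: "(\<integral>\<^sup>+x. g x t \<partial>lborel) = ennreal ((norm h)\<^sup>2) * (\<integral>\<^sup>+x. ennreal ((norm (grad \<phi> x))\<^sup>2) \<partial>lborel)" .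
    show "(\<integral>\<^sup>+x. g x t * indicator {0..1} t \<partial>lborel) = ennreal ((norm h)\<^sup>2) * (\<integral>\<^sup>+x. ennreal ((norm (grad \<phi> x))\<^sup>2) \<partial>lborel) * indicator {0..1} t"
      unfolding e[symmetric] by (rule nn_integral_multc) (unfold g_def, measurable)
  qed
  also have "\<dots> = ennreal ((norm h)\<^sup>2) * (\<integral>\<^sup>+x. ennreal ((norm (grad \<phi> x))\<^sup>2) \<partial>lborel)"
    by (subst nn_integral_cmult_indicator) auto
  finally show ?thesis .
qed

text \<open>Half-open cubes: with the floor function every point lies in exactly one of
  them.\<close>

definition cell :: "real \<Rightarrow> ('n \<Rightarrow> int) \<Rightarrow> (real ^ 'n) set" where
  "cell \<delta> k = {x. \<forall>i. \<lfloor>x $ i / \<delta>\<rfloor> = k i}"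

lemma cell_bounds:
  assumes "0 < \<delta>" "x \<in> cell \<delta> k"
  shows "\<delta> * of_int (k i) \<le> x $ i" "x $ i < \<delta> * (of_int (k i) + 1)"
proof -
  have "\<lfloor>x $ i / \<delta>\<rfloor> = k i" using assms by (simp add: cell_def)
  then have "of_int (k i) \<le> x $ i / \<delta>" "x $ i / \<delta> < of_int (k i) + 1" by linarith+
  then show "\<delta> * of_int (k i) \<le> x $ i" "x $ i < \<delta> * (of_int (k i) + 1)"
    using assms(1) by (simp_all add: field_simps)
qed

text \<open>The cell lies between an open and a closed box of equal volume.\<close>

lemma emeasure_cell:
  fixes k :: "'n::finite \<Rightarrow> int"
  assumes \<delta>: "0 < \<delta>"
  shows "cell \<delta> k \<in> sets borel" and "emeasure lborel (cell \<delta> k) = ennreal (\<delta> ^ CARD('n))"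
proof -
  have "cell \<delta> k = (\<Inter>i. {x \<in> space borel. \<lfloor>x $ i / \<delta>\<rfloor> = k i})" by (auto simp: cell_def)
  also have "\<dots> \<in> sets borel"
  proof (intro sets.finite_INT)
    fix i
    have [measurable]: "(\<lambda>x :: real ^ 'n. x $ i) \<in> borel_measurable borel"
      by (intro borel_measurable_continuous_onI continuous_intros)
    show "{x \<in> space borel. \<lfloor>(x :: real ^ 'n) $ i / \<delta>\<rfloor> = k i} \<in> sets borel" by measurable
  qed auto
  finally show S[measurable]: "cell \<delta> k \<in> sets borel" .
  define l u :: "real ^ 'n" where "l = (\<chi> i. \<delta> * of_int (k i))" and "u = (\<chi> i. \<delta> * (of_int (k i) + 1))"
  have ul: "(u - l) \<bullet> b = \<delta>" if "b \<in> Basis" for b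
    using that by (auto simp: Basis_vec_def inner_axis u_def l_def algebra_simps)
  have le: "l \<bullet> b \<le> u \<bullet> b" if "b \<in> Basis" for b
    using ul[OF that] \<delta> by (simp add: inner_diff_left)
  have "emeasure lborel (box l u) = ennreal (\<delta> ^ CARD('n))" "emeasure lborel (cbox l u) = ennreal (\<delta> ^ CARD('n))"
    using le ul by (simp_all add: emeasure_lborel_box emeasure_lborel_cbox prod_constant)
  moreover have "box l u \<subseteq> cell \<delta> k"
  proof
    fix x assume x: "x \<in> box l u"
    have "\<lfloor>x $ i / \<delta>\<rfloor> = k i" for i
    proof -
      have "\<delta> * of_int (k i) < x $ i" "x $ i < \<delta> * (of_int (k i) + 1)" using x by (auto simp: mem_box_cart l_def u_def)
      then have "of_int (k i) \<le> x $ i / \<delta>" "x $ i / \<delta> < of_int (k i) + 1" using \<delta> by (simp_all add: field_simps)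
      then show ?thesis by linarith
    qed
    then show "x \<in> cell \<delta> k" by (simp add: cell_def)
  qed
  moreover have "cell \<delta> k \<subseteq> cbox l u"
  proof
    fix x :: "real ^ 'n" assume x: "x \<in> cell \<delta> k"
    show "x \<in> cbox l u"
      using cell_bounds(1)[OF \<delta> x] less_imp_le[OF cell_bounds(2)[OF \<delta> x]] by (simp add: mem_box_cart l_def u_def)
  qed
  ultimately show "emeasure lborel (cell \<delta> k) = ennreal (\<delta> ^ CARD('n))"
    using emeasure_mono[of "box l u" "cell \<delta> k" lborel] emeasure_mono[of "cell \<delta> k" "cbox l u" lborel] S
    by (intro antisym) auto
qed

text \<open>The integral of the squared deviation from any constant \<open>c\<close> over
  \<open>Q\<close> is \<open>v + m * (c - a)\<^sup>2\<close>, hence at least the second summand.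
  Taking \<open>c = f x\<close> and integrating over \<open>x\<close> produces
  \<open>m * v\<close>.\<close>

lemma variance_le_double_integral:
  fixes f :: "'a::euclidean_space \<Rightarrow> real"
  assumes Qs[measurable]: "Q \<in> sets lborel" and Qm: "emeasure lborel Q = ennreal m" "0 < m"
    and f: "integrable lborel (\<lambda>x. f x * indicator Q x)" and f2: "integrable lborel (\<lambda>x. (f x)\<^sup>2 * indicator Q x)"
    and [measurable]: "f \<in> borel_measurable borel"
  defines "a \<equiv> (\<integral>x. f x * indicator Q x \<partial>lborel) / m"
  defines "v \<equiv> (\<integral>x. (f x)\<^sup>2 * indicator Q x \<partial>lborel) - m * a\<^sup>2"
  shows "0 \<le> v" and "ennreal (m * v) \<le> (\<integral>\<^sup>+x. \<integral>\<^sup>+y. ennreal ((f y - f x)\<^sup>2) * indicator Q y * indicator Q x \<partial>lborel \<partial>lborel)"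
proof -
  have ind: "integrable lborel (indicator Q :: 'a \<Rightarrow> real)" using Qs Qm by (intro integrable_real_indicator) auto
  have mQ: "measure lborel Q = m" using Qm by (simp add: measure_def)
  have eq: "integrable lborel (\<lambda>y. (f y - c)\<^sup>2 * indicator Q y) \<and> (\<integral>y. (f y - c)\<^sup>2 * indicator Q y \<partial>lborel) = v + m * (c - a)\<^sup>2" for c
  proof -
    have e: "(f y - c)\<^sup>2 * indicator Q y = ((f y)\<^sup>2 * indicator Q y - (2 * c) * (f y * indicator Q y)) + c\<^sup>2 * indicator Q y" for y
      by (simp add: power2_diff algebra_simps)
    have i: "integrable lborel (\<lambda>y. ((f y)\<^sup>2 * indicator Q y - (2 * c) * (f y * indicator Q y)) + c\<^sup>2 * indicator Q y)"
      by (intro Bochner_Integration.integrable_add Bochner_Integration.integrable_diff integrable_mult_right f f2 ind)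
    have "(\<integral>y. ((f y)\<^sup>2 * indicator Q y - (2 * c) * (f y * indicator Q y)) + c\<^sup>2 * indicator Q y \<partial>lborel)
       = (\<integral>y. (f y)\<^sup>2 * indicator Q y \<partial>lborel) - (2 * c) * (\<integral>y. f y * indicator Q y \<partial>lborel) + c\<^sup>2 * m"
      using f f2 ind by (simp add: mQ)
    also have "(\<integral>y. f y * indicator Q y \<partial>lborel) = m * a" using Qm by (simp add: a_def)
    also have "(\<integral>y. (f y)\<^sup>2 * indicator Q y \<partial>lborel) - (2 * c) * (m * a) + c\<^sup>2 * m = v + m * (c - a)\<^sup>2"
      by (simp add: v_def power2_diff algebra_simps)
    finally show ?thesis unfolding e using i by simp
  qed
  have va: "(\<integral>y. (f y - a)\<^sup>2 * indicator Q y \<partial>lborel) = v" using eq[of a] by simp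
  show v0: "0 \<le> v" unfolding va[symmetric] by (rule Bochner_Integration.integral_nonneg) auto
  have nn: "(\<integral>\<^sup>+y. ennreal ((f y - c)\<^sup>2) * indicator Q y \<partial>lborel) = ennreal (v + m * (c - a)\<^sup>2)" for c
  proof -
    have "(\<integral>\<^sup>+y. ennreal ((f y - c)\<^sup>2) * indicator Q y \<partial>lborel) = (\<integral>\<^sup>+y. ennreal ((f y - c)\<^sup>2 * indicator Q y) \<partial>lborel)"
      by (intro nn_integral_cong) (simp add: indicator_def)
    also have "\<dots> = ennreal (v + m * (c - a)\<^sup>2)" using eq[of c] by (subst nn_integral_eq_integral) auto
    finally show ?thesis .
  qed
  have "ennreal (m * v) = ennreal m * (\<integral>\<^sup>+x. ennreal ((f x - a)\<^sup>2) * indicator Q x \<partial>lborel)"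
    using nn[of a] v0 Qm by (simp add: ennreal_mult)
  also have "\<dots> = (\<integral>\<^sup>+x. ennreal m * (ennreal ((f x - a)\<^sup>2) * indicator Q x) \<partial>lborel)"
    by (rule nn_integral_cmult[symmetric]) measurable
  also have "\<dots> \<le> (\<integral>\<^sup>+x. (\<integral>\<^sup>+y. ennreal ((f y - f x)\<^sup>2) * indicator Q y \<partial>lborel) * indicator Q x \<partial>lborel)"
  proof (intro nn_integral_mono)
    fix x
    have "ennreal m * ennreal ((f x - a)\<^sup>2) \<le> ennreal (v + m * (f x - a)\<^sup>2)"
      using v0 Qm by (subst ennreal_mult[symmetric]) (auto intro!: ennreal_leI)
    then show "ennreal m * (ennreal ((f x - a)\<^sup>2) * indicator Q x) \<le> (\<integral>\<^sup>+y. ennreal ((f y - f x)\<^sup>2) * indicator Q y \<partial>lborel) * indicator Q x"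
      unfolding nn mult.assoc[symmetric] by (rule mult_right_mono) simp
  qed
  also have "\<dots> = (\<integral>\<^sup>+x. \<integral>\<^sup>+y. ennreal ((f y - f x)\<^sup>2) * indicator Q y * indicator Q x \<partial>lborel \<partial>lborel)"
    by (intro nn_integral_cong nn_integral_multc[symmetric]) measurable
  finally show "ennreal (m * v) \<le> (\<integral>\<^sup>+x. \<integral>\<^sup>+y. ennreal ((f y - f x)\<^sup>2) * indicator Q y * indicator Q x \<partial>lborel \<partial>lborel)" .
qed

text \<open>On a mesh of cells the squared norm is the sum of squared averages and variances.
  Finitely many cells meet the bounded domain, so the averages are finitely many functionals, and
  the variances are controlled by translations of length comparable to the mesh size.\<close>

proposition rellich_test:
  fixes \<Omega> :: "(real ^ 'n) set"
  assumes "bounded \<Omega>" and \<epsilon>: "0 < \<epsilon>"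
  shows "\<exists>E. finite E \<and> (\<forall>\<phi>\<in>test_functions \<Omega>.
    (norm (cls \<phi>))\<^sup>2 \<le> \<epsilon> * (norm (jet \<phi>))\<^sup>2 + (\<Sum>e\<in>E. (inner (cls \<phi>) e)\<^sup>2))"
proof -
  let ?N = "real CARD('n)"
  \<comment> \<open>Shifts within a cell have norm at most \<open>?N * \<delta>\<close> and lie in a
    cube of volume \<open>2 ^ CARD('n) * m\<close>. After division by \<open>m\<close> the constant
    is \<open>2 ^ CARD('n) * (?N * \<delta>)\<^sup>2\<close>, which is set equal to
    \<epsilon>.\<close>
  define \<delta> where "\<delta> = sqrt (\<epsilon> / (2 ^ CARD('n) * ?N\<^sup>2))"
  have \<delta>: "\<delta> > 0" "2 ^ CARD('n) * (?N * \<delta>)\<^sup>2 = \<epsilon>"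
    using \<epsilon> by (auto simp: \<delta>_def power_mult_distrib)
  define m where "m = \<delta> ^ CARD('n)"
  have m: "m > 0" using \<delta> by (simp add: m_def)
  obtain R where R: "\<And>x. x \<in> \<Omega> \<Longrightarrow> norm x \<le> R" using assms(1) by (auto simp: bounded_iff)
  define b where "b = \<lceil>R / \<delta>\<rceil> + 1"
  define A where "A = {k :: 'n \<Rightarrow> int. \<forall>i. k i \<in> {- b..b}}"
  have A: "finite A"
  proof -
    have "A = PiE UNIV (\<lambda>_. {- b..b})" by (auto simp: A_def)
    then show ?thesis by (simp add: finite_PiE)
  qed
  have cover: "(\<lambda>i. \<lfloor>x $ i / \<delta>\<rfloor>) \<in> A" if "x \<in> \<Omega>" for x
  proof -
    have "\<lfloor>x $ i / \<delta>\<rfloor> \<in> {- b..b}" for i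
    proof -
      have "\<bar>x $ i\<bar> \<le> R" using R[OF that] component_le_norm_cart[of x i] by linarith
      then have "\<bar>x $ i / \<delta>\<bar> \<le> R / \<delta>" using \<delta> by (simp add: abs_divide divide_right_mono)
      then show ?thesis unfolding b_def by (simp, linarith)
    qed
    then show ?thesis by (simp add: A_def)
  qed
  note Qm = emeasure_cell[where 'n = 'n, OF \<delta>(1)]
  have [measurable]: "cell \<delta> k \<in> sets borel" for k :: "'n \<Rightarrow> int" by (rule Qm)
  have cell_iff: "x \<in> cell \<delta> k \<longleftrightarrow> k = (\<lambda>i. \<lfloor>x $ i / \<delta>\<rfloor>)" for x and k :: "'n \<Rightarrow> int"
    unfolding cell_def mem_Collect_eq fun_eq_iff by metis
  have one: "(\<Sum>k\<in>A. indicator (cell \<delta> k) x * c) = c" if "x \<in> \<Omega>" for x and c :: real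
  proof -
    have "(\<Sum>k\<in>A. indicator (cell \<delta> k) x * c) = (\<Sum>k\<in>A. if k = (\<lambda>i. \<lfloor>x $ i / \<delta>\<rfloor>) then c else 0)"
      by (intro sum.cong) (auto simp: cell_iff indicator_def)
    then show ?thesis using A cover[OF that] by simp
  qed
  have ind: "(\<lambda>x. indicator (cell \<delta> k) x / sqrt m) \<in> sqint" for k :: "'n \<Rightarrow> int"
  proof (rule sqintI)
    have "integrable lborel (indicator (cell \<delta> k) :: real ^ 'n \<Rightarrow> real)"
      using Qm by (intro integrable_real_indicator) auto
    then have "integrable lebesgue (\<lambda>x :: real ^ 'n. (1 / m) * indicator (cell \<delta> k) x)"
      by (intro integrable_mult_right) (simp add: integrable_completion)
    moreover have "(\<lambda>x :: real ^ 'n. (indicator (cell \<delta> k) x / sqrt m)\<^sup>2) = (\<lambda>x. (1 / m) * indicator (cell \<delta> k) x)"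
      using m by (auto simp: indicator_def power_divide)
    ultimately show "integrable lebesgue (\<lambda>x :: real ^ 'n. (indicator (cell \<delta> k) x / sqrt m)\<^sup>2)" by simp
  qed (auto intro!: measurable_completion)
  define e where "e k = cls (\<lambda>x :: real ^ 'n. indicator (cell \<delta> k) x / sqrt m)" for k
  have main: "(norm (cls \<phi>))\<^sup>2 \<le> \<epsilon> * (norm (jet \<phi>))\<^sup>2 + (\<Sum>k\<in>A. (inner (cls \<phi>) (e k))\<^sup>2)"
    if \<phi>: "\<phi> \<in> test_functions \<Omega>" for \<phi>
  proof -
    have [measurable]: "\<phi> \<in> borel_measurable borel" by (rule test_measurable[OF \<phi>])
    have i1: "integrable lborel (\<lambda>x. \<phi> x * indicator (cell \<delta> k) x)" for k
      using integrable_mult_indicator[of "cell \<delta> k" lborel \<phi>] test_integrable(1)[OF \<phi>] by (simp add: mult.commute)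
    have i2: "integrable lborel (\<lambda>x. (\<phi> x)\<^sup>2 * indicator (cell \<delta> k) x)" for k
      using integrable_mult_indicator[of "cell \<delta> k" lborel "\<lambda>x. (\<phi> x)\<^sup>2"] test_integrable(1)[OF test_mult[OF \<phi> \<phi>]]
      by (simp add: mult.commute power2_eq_square)
    define a where "a k = (\<integral>x. \<phi> x * indicator (cell \<delta> k) x \<partial>lborel) / m" for k
    define v where "v k = (\<integral>x. (\<phi> x)\<^sup>2 * indicator (cell \<delta> k) x \<partial>lborel) - m * (a k)\<^sup>2" for k
    have v0: "0 \<le> v k" and vle: "ennreal (m * v k) \<le> (\<integral>\<^sup>+x. \<integral>\<^sup>+y. ennreal ((\<phi> y - \<phi> x)\<^sup>2) * indicator (cell \<delta> k) y * indicator (cell \<delta> k) x \<partial>lborel \<partial>lborel)" for k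
      using variance_le_double_integral[of "cell \<delta> k" m \<phi>] Qm m i1 i2 unfolding v_def a_def m_def by auto
    have "(norm (cls \<phi>))\<^sup>2 = (\<integral>x. (\<phi> x)\<^sup>2 \<partial>lborel)"
      by (simp add: norm_cls test_sqint[OF \<phi>] integral_completion)
    also have "(\<lambda>x. (\<phi> x)\<^sup>2) = (\<lambda>x. \<Sum>k\<in>A. (\<phi> x)\<^sup>2 * indicator (cell \<delta> k) x)"
    proof
      fix x show "(\<phi> x)\<^sup>2 = (\<Sum>k\<in>A. (\<phi> x)\<^sup>2 * indicator (cell \<delta> k) x)"
        using one[of x "(\<phi> x)\<^sup>2"] test_outside[OF \<phi>, of x] by (cases "x \<in> \<Omega>") (simp_all add: mult.commute)
    qed
    also have "(\<integral>x. (\<Sum>k\<in>A. (\<phi> x)\<^sup>2 * indicator (cell \<delta> k) x) \<partial>lborel) = (\<Sum>k\<in>A. v k + m * (a k)\<^sup>2)"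
      by (subst Bochner_Integration.integral_sum) (auto simp: i2 v_def)
    finally have nrm: "(norm (cls \<phi>))\<^sup>2 = (\<Sum>k\<in>A. v k) + (\<Sum>k\<in>A. m * (a k)\<^sup>2)" by (simp add: sum.distrib)
    have ak: "m * (a k)\<^sup>2 = (inner (cls \<phi>) (e k))\<^sup>2" for k
    proof -
      have "inner (cls \<phi>) (e k) = (\<integral>x. \<phi> x * (indicator (cell \<delta> k) x / sqrt m) \<partial>lebesgue)"
        unfolding e_def by (rule inner_cls[OF test_sqint[OF \<phi>] ind])
      also have "\<dots> = (\<integral>x. \<phi> x * (indicator (cell \<delta> k) x / sqrt m) \<partial>lborel)" by (rule integral_completion) measurable
      also have "\<dots> = (\<integral>x. \<phi> x * indicator (cell \<delta> k) x \<partial>lborel) / sqrt m" by simp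
      also have "\<dots> = sqrt m * a k" using m by (simp add: a_def field_simps)
      finally show ?thesis using m by (simp add: power_mult_distrib)
    qed
    define G where "G = (\<integral>\<^sup>+x. ennreal ((norm (grad \<phi> x))\<^sup>2) \<partial>lborel)"
    \<comment> \<open>Contains every difference of two points of one cell.\<close>
    define C where "C = cbox (\<chi> i. - \<delta>) ((\<chi> i. \<delta>) :: real ^ 'n)"
    have C_meas[measurable]: "C \<in> sets borel" by (simp add: C_def)
    have Cm: "emeasure lborel C = ennreal (2 ^ CARD('n) * m)"
    proof -
      have "((\<chi> i. \<delta>) - (\<chi> i. - \<delta>)) \<bullet> b = 2 * \<delta>" "(\<chi> i. - \<delta>) \<bullet> b \<le> (\<chi> i. \<delta>) \<bullet> b" if "b \<in> Basis" for b :: "real ^ 'n"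
        using that \<delta> by (auto simp: Basis_vec_def inner_axis)
      then show ?thesis unfolding C_def by (simp add: emeasure_lborel_cbox prod_constant m_def power_mult_distrib)
    qed
    have Cn: "norm h \<le> ?N * \<delta>" if "h \<in> C" for h
    proof -
      have "norm h \<le> (\<Sum>i\<in>UNIV. \<bar>h $ i\<bar>)" by (rule norm_le_l1_cart)
      also have "\<dots> \<le> (\<Sum>i\<in>(UNIV :: 'n set). \<delta>)" using that by (intro sum_mono) (auto simp: C_def mem_box_cart abs_le_iff intro: minus_le_iff[THEN iffD1])
      finally show ?thesis by simp
    qed
    have "ennreal (m * (\<Sum>k\<in>A. v k)) = (\<Sum>k\<in>A. ennreal (m * v k))"
      unfolding sum_distrib_left using m v0 by (subst sum_ennreal) auto
    also have "\<dots> \<le> (\<Sum>k\<in>A. \<integral>\<^sup>+x. \<integral>\<^sup>+y. ennreal ((\<phi> y - \<phi> x)\<^sup>2) * indicator (cell \<delta> k) y * indicator (cell \<delta> k) x \<partial>lborel \<partial>lborel)"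
      by (intro sum_mono vle)
    also have "\<dots> = (\<integral>\<^sup>+x. (\<Sum>k\<in>A. \<integral>\<^sup>+y. ennreal ((\<phi> y - \<phi> x)\<^sup>2) * indicator (cell \<delta> k) y * indicator (cell \<delta> k) x \<partial>lborel) \<partial>lborel)"
      by (rule nn_integral_sum[symmetric]) measurable
    also have "\<dots> = (\<integral>\<^sup>+x. \<integral>\<^sup>+y. (\<Sum>k\<in>A. ennreal ((\<phi> y - \<phi> x)\<^sup>2) * indicator (cell \<delta> k) y * indicator (cell \<delta> k) x) \<partial>lborel \<partial>lborel)"
      by (intro nn_integral_cong nn_integral_sum[symmetric]) measurable
    also have "\<dots> \<le> (\<integral>\<^sup>+x. \<integral>\<^sup>+y. ennreal ((\<phi> y - \<phi> x)\<^sup>2) * indicator C (y - x) \<partial>lborel \<partial>lborel)"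
    proof (intro nn_integral_mono)
      fix x y :: "real ^ 'n"
      \<comment> \<open>Only the cell of \<open>x\<close> contributes, so the sum over cells has at
        most one nonzero term and no cell count enters the constant.\<close>
      define kx where "kx = (\<lambda>i. \<lfloor>x $ i / \<delta>\<rfloor>)"
      have "(\<Sum>k\<in>A. ennreal ((\<phi> y - \<phi> x)\<^sup>2) * indicator (cell \<delta> k) y * indicator (cell \<delta> k) x)
          \<le> (\<Sum>k\<in>A. if k = kx then ennreal ((\<phi> y - \<phi> x)\<^sup>2) * indicator C (y - x) else 0)"
      proof (rule sum_mono)
        fix k
        show "ennreal ((\<phi> y - \<phi> x)\<^sup>2) * indicator (cell \<delta> k) y * indicator (cell \<delta> k) x
            \<le> (if k = kx then ennreal ((\<phi> y - \<phi> x)\<^sup>2) * indicator C (y - x) else 0)"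
        proof (cases "x \<in> cell \<delta> k \<and> y \<in> cell \<delta> k")
          case True
          then have "k = kx" by (simp add: cell_iff kx_def)
          moreover have "y - x \<in> C"
          proof -
            have "- \<delta> \<le> y $ i - x $ i \<and> y $ i - x $ i \<le> \<delta>" for i
              using cell_bounds[OF \<delta>(1), of x k i] cell_bounds[OF \<delta>(1), of y k i] True by (simp add: algebra_simps)
            then show ?thesis by (simp add: C_def mem_box_cart)
          qed
          ultimately show ?thesis using True by simp
        qed auto
      qed
      also have "\<dots> \<le> ennreal ((\<phi> y - \<phi> x)\<^sup>2) * indicator C (y - x)" using A by simp
      finally show "(\<Sum>k\<in>A. ennreal ((\<phi> y - \<phi> x)\<^sup>2) * indicator (cell \<delta> k) y * indicator (cell \<delta> k) x)
          \<le> ennreal ((\<phi> y - \<phi> x)\<^sup>2) * indicator C (y - x)" .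
    qed
    also have "\<dots> = (\<integral>\<^sup>+x. \<integral>\<^sup>+h. ennreal ((\<phi> (x + h) - \<phi> x)\<^sup>2) * indicator C h \<partial>lborel \<partial>lborel)"
    proof (rule nn_integral_cong)
      fix x :: "real ^ 'n"
      have "(\<integral>\<^sup>+y. ennreal ((\<phi> y - \<phi> x)\<^sup>2) * indicator C (y - x) \<partial>lborel)
        = (\<integral>\<^sup>+y. ennreal ((\<phi> y - \<phi> x)\<^sup>2) * indicator C (y - x) \<partial>distr lborel borel ((+) x))" by (simp add: lborel_distr_plus)
      also have "\<dots> = (\<integral>\<^sup>+h. ennreal ((\<phi> (x + h) - \<phi> x)\<^sup>2) * indicator C (x + h - x) \<partial>lborel)"
        by (rule nn_integral_distr) measurable
      finally show "(\<integral>\<^sup>+y. ennreal ((\<phi> y - \<phi> x)\<^sup>2) * indicator C (y - x) \<partial>lborel)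
        = (\<integral>\<^sup>+h. ennreal ((\<phi> (x + h) - \<phi> x)\<^sup>2) * indicator C h \<partial>lborel)" by simp
    qed
    also have "\<dots> = (\<integral>\<^sup>+h. \<integral>\<^sup>+x. ennreal ((\<phi> (x + h) - \<phi> x)\<^sup>2) * indicator C h \<partial>lborel \<partial>lborel)"
      by (rule lborel_pair.Fubini') measurable
    also have "\<dots> \<le> (\<integral>\<^sup>+h. (ennreal ((?N * \<delta>)\<^sup>2) * G) * indicator C h \<partial>lborel)"
    proof (intro nn_integral_mono)
      fix h :: "real ^ 'n"
      show "(\<integral>\<^sup>+x. ennreal ((\<phi> (x + h) - \<phi> x)\<^sup>2) * indicator C h \<partial>lborel) \<le> (ennreal ((?N * \<delta>)\<^sup>2) * G) * indicator C h"
      proof (cases "h \<in> C")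
        case True
        have "ennreal ((norm h)\<^sup>2) * G \<le> ennreal ((?N * \<delta>)\<^sup>2) * G"
          using Cn[OF True] by (intro mult_right_mono ennreal_leI power_mono) auto
        then show ?thesis using True order_trans[OF translation_estimate[OF \<phi>, of h], folded G_def] by simp
      qed simp
    qed
    also have "\<dots> = (ennreal ((?N * \<delta>)\<^sup>2) * G) * ennreal (2 ^ CARD('n) * m)"
      by (subst nn_integral_cmult_indicator) (auto simp: Cm)
    also have "\<dots> \<le> (ennreal ((?N * \<delta>)\<^sup>2) * ennreal ((norm (jet \<phi>))\<^sup>2)) * ennreal (2 ^ CARD('n) * m)"
      unfolding norm_jet[OF \<phi>] G_def by (intro mult_right_mono mult_left_mono) auto
    also have "\<dots> = ennreal (m * (\<epsilon> * (norm (jet \<phi>))\<^sup>2))"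
    proof -
      have eq: "(?N * \<delta>)\<^sup>2 * (norm (jet \<phi>))\<^sup>2 * (2 ^ CARD('n) * m) = m * (\<epsilon> * (norm (jet \<phi>))\<^sup>2)"
        unfolding \<delta>(2)[symmetric] by (simp only: mult_ac)
      have gen: "ennreal x * ennreal y * ennreal z = ennreal (x * y * z)" if "0 \<le> x" "0 \<le> y" "0 \<le> z" for x y z
        using that by (simp add: ennreal_mult)
      have c0: "0 \<le> 2 ^ CARD('n) * m" using m by simp
      show ?thesis unfolding gen[OF zero_le_power2 zero_le_power2 c0] eq ..
    qed
    finally have "m * (\<Sum>k\<in>A. v k) \<le> m * (\<epsilon> * (norm (jet \<phi>))\<^sup>2)" using m \<epsilon> by (subst (asm) ennreal_le_iff) auto
    then have "(\<Sum>k\<in>A. v k) \<le> \<epsilon> * (norm (jet \<phi>))\<^sup>2" using m by simp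
    then show ?thesis unfolding nrm ak by simp
  qed
  show ?thesis
  proof (intro exI[of _ "(\<lambda>k. e k) ` A"] conjI ballI)
    fix \<phi> assume \<phi>: "\<phi> \<in> test_functions \<Omega>"
    \<comment> \<open>The functionals are summed over a set of vectors, so distinct cells must yield
      distinct vectors; they are orthonormal.\<close>
    have "inj_on e A"
    proof (rule inj_onI, rule ccontr)
      fix k k' assume "e k = e k'" "k \<noteq> k'"
      then have "inner (e k) (e k) = inner (e k) (e k')" by simp
      moreover have "inner (e k) (e k') = 0"
      proof -
        have z: "(\<lambda>x. indicator (cell \<delta> k) x / sqrt m * (indicator (cell \<delta> k') x / sqrt m)) = (\<lambda>_. 0)"
          using \<open>k \<noteq> k'\<close> by (auto simp: indicator_def cell_iff)
        show ?thesis unfolding e_def inner_cls[OF ind ind] z by simp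
      qed
      moreover have "inner (e k) (e k) = 1"
      proof -
        have "inner (e k) (e k) = (\<integral>x. (1 / m) * indicator (cell \<delta> k) x \<partial>lebesgue)"
          unfolding e_def inner_cls[OF ind ind] using m by (intro Bochner_Integration.integral_cong) (auto simp: indicator_def)
        also have "\<dots> = (1 / m) * measure lborel (cell \<delta> k)" by simp
        also have "\<dots> = 1" using Qm[of k] m \<delta>(1) by (simp add: measure_def m_def)
        finally show ?thesis .
      qed
      ultimately show False by simp
    qed
    then show "(norm (cls \<phi>))\<^sup>2 \<le> \<epsilon> * (norm (jet \<phi>))\<^sup>2 + (\<Sum>e\<in>e ` A. (inner (cls \<phi>) e)\<^sup>2)"
      using main[OF \<phi>] by (simp add: sum.reindex)
  qed (use A in simp)
qed

section \<open>The system in the Dirichlet space\<close>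

lemma rep_add: "AE x in lebesgue. rep (a + b) x = rep a x + rep b x"
  unfolding plus_lsq_def by (rule rep_cls[OF sqint_add[OF rep_sqint rep_sqint]])

lemma rep_scale: "AE x in lebesgue. rep (c *\<^sub>R a) x = c * rep a x"
  unfolding scaleR_lsq_def by (rule rep_cls[OF sqint_scale[OF rep_sqint]])

lemma sqint_mult_of_power4:
  assumes [measurable]: "f \<in> borel_measurable lebesgue" "g \<in> borel_measurable lebesgue"
    and f: "integrable lebesgue (\<lambda>x. (f x) ^ 4)" and g: "integrable lebesgue (\<lambda>x. (g x) ^ 4)"
  shows "(\<lambda>x. f x * g x) \<in> sqint"
proof (rule sqintI)
  show "integrable lebesgue (\<lambda>x. (f x * g x)\<^sup>2)"
  proof (rule Bochner_Integration.integrable_bound)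
    show "integrable lebesgue (\<lambda>x. (f x) ^ 4 + (g x) ^ 4)" using f g by simp
    show "AE x in lebesgue. norm ((f x * g x)\<^sup>2) \<le> norm ((f x) ^ 4 + (g x) ^ 4)"
    proof (rule AE_I2)
      fix x
      have "2 * ((f x)\<^sup>2 * (g x)\<^sup>2) \<le> ((f x)\<^sup>2)\<^sup>2 + ((g x)\<^sup>2)\<^sup>2"
        using sum_squares_bound[of "(f x)\<^sup>2" "(g x)\<^sup>2"] by simp
      moreover have "0 \<le> (f x)\<^sup>2 * (g x)\<^sup>2" by simp
      moreover have "(f x * g x)\<^sup>2 = (f x)\<^sup>2 * (g x)\<^sup>2" "((f x)\<^sup>2)\<^sup>2 = (f x) ^ 4" "((g x)\<^sup>2)\<^sup>2 = (g x) ^ 4"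
        by (simp_all add: power_mult_distrib power_mult[symmetric])
      ultimately have "(f x * g x)\<^sup>2 \<le> (f x) ^ 4 + (g x) ^ 4" by linarith
      then show "norm ((f x * g x)\<^sup>2) \<le> norm ((f x) ^ 4 + (g x) ^ 4)" by simp
    qed
  qed measurable
qed measurable

locale low_dimensional_domain =
  fixes \<Omega> :: "(real ^ 'n) set"
  assumes open_domain: "open \<Omega>" and bounded_domain: "bounded \<Omega>" and dimension: "CARD('n) \<in> {3, 4}"
begin

abbreviation "D \<equiv> dirichlet_space \<Omega>"
abbreviation "Pr \<equiv> orth_proj D"

lemmas D_closed = closed_dirichlet_space[OF open_domain]
lemmas D_subspace = subspace_dirichlet_space[OF open_domain]
lemmas Pr_in = orth_proj_in[OF D_closed D_subspace]
lemmas Pr_ident = orth_proj_ident[OF D_closed D_subspace]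
lemmas Pr_linear = bounded_linear_orth_proj[OF D_closed D_subspace]

text \<open>
  Composing with the projection \<open>Pr\<close> poses the problem on the whole product space, which is a type:
  orthogonally to \<open>D\<close> the equation only says that the solution has no such component.
\<close>

definition emb :: "(real ^ 'n) lsq \<times> ((real ^ 'n) lsq ^ 'n) \<Rightarrow> (real ^ 'n) lsq" where
  "emb u = fst (Pr u)"

definition prd :: "(real ^ 'n) lsq \<times> ((real ^ 'n) lsq ^ 'n) \<Rightarrow> (real ^ 'n) lsq \<times> ((real ^ 'n) lsq ^ 'n) \<Rightarrow> (real ^ 'n) lsq" where
  "prd a b = cls (\<lambda>x. rep (emb a) x * rep (emb b) x)"

lemma bounded_linear_emb: "bounded_linear emb"
  unfolding emb_def by (rule bounded_linear_compose[OF bounded_linear_fst Pr_linear])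

text \<open>The estimate for test functions is a closed condition on jets, hence holds on all of
  \<open>D\<close>; the projection \<open>Pr\<close> does not increase norms.\<close>

lemma emb_almost_finite_rank:
  assumes "0 < \<epsilon>"
  shows "\<exists>E. finite E \<and> (\<forall>u. (norm (emb u))\<^sup>2 \<le> \<epsilon> * (norm u)\<^sup>2 + (\<Sum>e\<in>E. (inner (emb u) e)\<^sup>2))"
proof -
  obtain E where E: "finite E" "\<And>\<phi>. \<phi> \<in> test_functions \<Omega> \<Longrightarrow>
      (norm (cls \<phi>))\<^sup>2 \<le> \<epsilon> * (norm (jet \<phi>))\<^sup>2 + (\<Sum>e\<in>E. (inner (cls \<phi>) e)\<^sup>2)"
    using rellich_test[OF bounded_domain assms] by blast
  let ?C = "{s :: (real ^ 'n) lsq \<times> ((real ^ 'n) lsq ^ 'n). (norm (fst s))\<^sup>2 \<le> \<epsilon> * (norm s)\<^sup>2 + (\<Sum>e\<in>E. (inner (fst s) e)\<^sup>2)}"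
  have "closed ?C" by (intro closed_Collect_le continuous_intros)
  then have "D \<subseteq> ?C" unfolding dirichlet_space_def by (intro closure_minimal) (use E in \<open>auto simp: jet_def\<close>)
  have "(norm (emb u))\<^sup>2 \<le> \<epsilon> * (norm u)\<^sup>2 + (\<Sum>e\<in>E. (inner (emb u) e)\<^sup>2)" for u
  proof -
    have "(norm (emb u))\<^sup>2 \<le> \<epsilon> * (norm (Pr u))\<^sup>2 + (\<Sum>e\<in>E. (inner (emb u) e)\<^sup>2)"
      using \<open>D \<subseteq> ?C\<close> Pr_in[of u] by (auto simp: emb_def)
    also have "\<epsilon> * (norm (Pr u))\<^sup>2 \<le> \<epsilon> * (norm u)\<^sup>2"
      using assms norm_orth_proj_le[OF D_closed D_subspace, of u] by (intro mult_left_mono power_mono) auto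
    finally show ?thesis by simp
  qed
  then show ?thesis using E(1) by blast
qed

text \<open>Fatou's lemma along test functions whose jets converge in norm and whose values converge
  almost everywhere.\<close>

lemma sobolev_dirichlet_space:
  assumes s: "s \<in> D"
  shows "(\<integral>\<^sup>+x. ennreal ((rep (fst s) x) ^ 4) \<partial>lebesgue) \<le> ennreal (81 * (norm s) ^ 4)"
proof -
  obtain x where x: "\<forall>n. x n \<in> jet ` test_functions \<Omega>" "x \<longlonglongrightarrow> s"
    using s unfolding dirichlet_space_def closure_sequential by auto
  then have "\<forall>n. \<exists>\<phi>. \<phi> \<in> test_functions \<Omega> \<and> x n = jet \<phi>" by auto
  from choice[OF this] obtain \<phi> where \<phi>: "\<And>n. \<phi> n \<in> test_functions \<Omega>" "\<And>n. x n = jet (\<phi> n)" by blast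
  have "(\<lambda>n. cls (\<phi> n)) \<longlonglongrightarrow> fst s" using tendsto_fst[OF x(2)] by (simp add: \<phi>(2) jet_def)
  from tendsto_lsq_AE_subseq[OF this] obtain r where r: "strict_mono (r :: nat \<Rightarrow> nat)"
    "AE x in lebesgue. (\<lambda>k. rep (cls (\<phi> (r k))) x) \<longlonglongrightarrow> rep (fst s) x" by blast
  have "AE x in lebesgue. \<forall>k. rep (cls (\<phi> k)) x = \<phi> k x"
    unfolding AE_all_countable using rep_cls[OF test_sqint[OF \<phi>(1)]] by blast
  with r(2) have ae: "AE x in lebesgue. ennreal ((rep (fst s) x) ^ 4) = liminf (\<lambda>k. ennreal ((\<phi> (r k) x) ^ 4))"
  proof eventually_elim
    case (elim x)
    then have "(\<lambda>k. \<phi> (r k) x) \<longlonglongrightarrow> rep (fst s) x" by simp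
    then have "(\<lambda>k. ennreal ((\<phi> (r k) x) ^ 4)) \<longlonglongrightarrow> ennreal ((rep (fst s) x) ^ 4)"
      by (intro tendsto_ennrealI tendsto_intros)
    from lim_imp_Liminf[OF _ this] show ?case by simp
  qed
  have bd: "(\<integral>\<^sup>+x. ennreal ((\<phi> (r k) x) ^ 4) \<partial>lebesgue) \<le> ennreal (81 * (norm (jet (\<phi> (r k)))) ^ 4)" for k
    using sobolev_test[OF \<phi>(1) dimension] by (simp add: nn_integral_completion)
  have [measurable]: "\<phi> k \<in> borel_measurable lebesgue" for k using sqint_measurable[OF test_sqint[OF \<phi>(1)]] .
  have "(\<integral>\<^sup>+x. ennreal ((rep (fst s) x) ^ 4) \<partial>lebesgue) = (\<integral>\<^sup>+x. liminf (\<lambda>k. ennreal ((\<phi> (r k) x) ^ 4)) \<partial>lebesgue)"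
    by (rule nn_integral_cong_AE[OF ae])
  also have "\<dots> \<le> liminf (\<lambda>k. \<integral>\<^sup>+x. ennreal ((\<phi> (r k) x) ^ 4) \<partial>lebesgue)" by (rule nn_integral_liminf) measurable
  also have "\<dots> \<le> liminf (\<lambda>k. ennreal (81 * (norm (jet (\<phi> (r k)))) ^ 4))"
    by (intro Liminf_mono always_eventually allI bd)
  also have "\<dots> = ennreal (81 * (norm s) ^ 4)"
  proof (rule lim_imp_Liminf)
    have "(\<lambda>k. jet (\<phi> (r k))) \<longlonglongrightarrow> s" using LIMSEQ_subseq_LIMSEQ[OF x(2) r(1)] by (simp add: comp_def \<phi>(2))
    then show "(\<lambda>k. ennreal (81 * (norm (jet (\<phi> (r k)))) ^ 4)) \<longlonglongrightarrow> ennreal (81 * (norm s) ^ 4)"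
      by (intro tendsto_ennrealI tendsto_intros)
  qed simp
  finally show ?thesis .
qed

lemma emb_power4: "integrable lebesgue (\<lambda>x. (rep (emb a) x) ^ 4)"
    "(\<integral>x. (rep (emb a) x) ^ 4 \<partial>lebesgue) \<le> 81 * (norm a) ^ 4"
proof -
  have [measurable]: "rep (emb a) \<in> borel_measurable lebesgue" by (rule sqint_measurable[OF rep_sqint])
  have b: "(\<integral>\<^sup>+x. ennreal ((rep (emb a) x) ^ 4) \<partial>lebesgue) \<le> ennreal (81 * (norm a) ^ 4)"
  proof -
    have "ennreal (81 * (norm (Pr a)) ^ 4) \<le> ennreal (81 * (norm a) ^ 4)"
      by (intro ennreal_leI mult_left_mono power_mono norm_orth_proj_le[OF D_closed D_subspace]) auto
    then show ?thesis using sobolev_dirichlet_space[OF Pr_in, of a] unfolding emb_def by (rule order_trans[rotated])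
  qed
  show i: "integrable lebesgue (\<lambda>x. (rep (emb a) x) ^ 4)"
    using le_less_trans[OF b] by (auto simp: integrable_iff_bounded)
  show "(\<integral>x. (rep (emb a) x) ^ 4 \<partial>lebesgue) \<le> 81 * (norm a) ^ 4"
    using b nn_integral_eq_integral[OF i] by simp
qed

lemma prd_sqint: "(\<lambda>x. rep (emb a) x * rep (emb b) x) \<in> sqint"
  by (intro sqint_mult_of_power4 emb_power4 sqint_measurable[OF rep_sqint])

lemma prd_commute: "prd a b = prd b a"
  by (simp add: prd_def mult.commute)

lemma prd_exchange: "inner (prd a b) (prd c d) = inner (prd a c) (prd b d)"
  unfolding prd_def by (simp add: inner_cls prd_sqint mult_ac)

text \<open>Regrouping the four factors turns the squared norm of \<open>prd a b\<close> into
  \<open>inner (prd a a) (prd b b)\<close>, so Cauchy-Schwarz reduces the bound to the diagonal.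
  There it is the Sobolev inequality, and 9 is the root of 81.\<close>

lemma bounded_bilinear_prd: "bounded_bilinear prd"
proof
  interpret emb: bounded_linear emb by (rule bounded_linear_emb)
  show al: "prd (a + a') b = prd a b + prd a' b" for a a' b
  proof -
    have "prd a b + prd a' b = cls (\<lambda>x. rep (emb a) x * rep (emb b) x + rep (emb a') x * rep (emb b) x)"
      unfolding prd_def by (rule cls_add[OF prd_sqint prd_sqint])
    then show ?thesis
      using rep_add[of "emb a" "emb a'"] unfolding prd_def
      by (simp only:) (subst cls_eq_iff[OF prd_sqint sqint_add[OF prd_sqint prd_sqint]], auto simp: emb.add distrib_right elim!: AE_mp)
  qed
  show "prd a (b + b') = prd a b + prd a b'" for a b b'
    using al[of b b' a] by (simp add: prd_commute)
  show sl: "prd (r *\<^sub>R a) b = r *\<^sub>R prd a b" for r a b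
  proof -
    have "r *\<^sub>R prd a b = cls (\<lambda>x. r * (rep (emb a) x * rep (emb b) x))"
      unfolding prd_def by (rule cls_scale[OF prd_sqint])
    then show ?thesis
      using rep_scale[of r "emb a"] unfolding prd_def
      by (simp only:) (subst cls_eq_iff[OF prd_sqint sqint_scale[OF prd_sqint]], auto simp: emb.scaleR elim!: AE_mp)
  qed
  show "prd a (r *\<^sub>R b) = r *\<^sub>R prd a b" for r a b
    using sl[of r b a] by (simp add: prd_commute)
  have diag: "norm (prd a a) \<le> 9 * (norm a)\<^sup>2" for a
  proof (rule power2_le_imp_le)
    have "(norm (prd a a))\<^sup>2 = (\<integral>x. (rep (emb a) x) ^ 4 \<partial>lebesgue)"
      unfolding prd_def norm_cls[OF prd_sqint] by (simp add: power2_eq_square power4_eq_xxxx mult.assoc)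
    also have "\<dots> \<le> 81 * (norm a) ^ 4" by (rule emb_power4)
    also have "\<dots> = (9 * (norm a)\<^sup>2)\<^sup>2" by (simp add: power_mult_distrib power_mult[symmetric])
    finally show "(norm (prd a a))\<^sup>2 \<le> (9 * (norm a)\<^sup>2)\<^sup>2" .
  qed simp
  have "norm (prd a b) \<le> norm a * norm b * 9" for a b
  proof (rule power2_le_imp_le)
    have "(norm (prd a b))\<^sup>2 = inner (prd a a) (prd b b)"
      unfolding power2_norm_eq_inner by (subst prd_commute[of a b], subst prd_exchange) (simp add: prd_exchange[of b a a b] prd_commute[of b a] prd_exchange[of a b a b])
    also have "\<dots> \<le> norm (prd a a) * norm (prd b b)" by (rule norm_cauchy_schwarz)
    also have "\<dots> \<le> (9 * (norm a)\<^sup>2) * (9 * (norm b)\<^sup>2)" by (intro mult_mono diag) auto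
    also have "\<dots> = (norm a * norm b * 9)\<^sup>2" by (simp add: power_mult_distrib)
    finally show "(norm (prd a b))\<^sup>2 \<le> (norm a * norm b * 9)\<^sup>2" .
  qed simp
  then show "\<exists>K. \<forall>a b. norm (prd a b) \<le> norm a * norm b * K" by blast
qed

sublocale quartic_form emb prd
  by (intro quartic_form.intro compact_map.intro quartic_form_axioms.intro)
    (fact bounded_linear_emb emb_almost_finite_rank bounded_bilinear_prd prd_commute)+

lemma emb_Pr: "emb (Pr u) = emb u"
  by (simp add: emb_def Pr_ident Pr_in)

lemma emb_D: "u \<in> D \<Longrightarrow> emb u = fst u"
  by (simp add: emb_def Pr_ident)

lemma prd_Pr: "prd a (Pr b) = prd a b"
  by (simp add: prd_def emb_Pr)

lemma inner_D_Pr: "u \<in> D \<Longrightarrow> inner u (Pr \<phi>) = inner u \<phi>"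
  using orth_proj_orth[OF D_closed D_subspace, of u \<phi>] by (simp add: inner_diff_left inner_commute[of u])

lemma in_D_if_orthogonal:
  assumes "\<And>\<phi>. inner u (\<phi> - Pr \<phi>) = 0"
  shows "u \<in> D"
proof -
  have "inner (u - Pr u) (u - Pr u) = inner u (u - Pr u) - inner (u - Pr u) (Pr u)"
    by (simp add: inner_diff_left inner_diff_right inner_commute)
  also have "\<dots> = 0" using assms[of u] orth_proj_orth[OF D_closed D_subspace Pr_in[of u], of u] by simp
  finally have "u = Pr u" by simp
  then show ?thesis using Pr_in[of u] by simp
qed

section \<open>Translation between weak solutions and the abstract equation\<close>

lemma H10_H1: "u \<in> H10 \<Omega> \<Longrightarrow> u \<in> H1 \<Omega>" and weak_jet_in_D: "u \<in> H10 \<Omega> \<Longrightarrow> weak_jet \<Omega> u \<in> D"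
  by (simp_all add: H10_iff[OF open_domain])

lemma D_imp_H10: "s \<in> D \<Longrightarrow> \<exists>u\<in>H10 \<Omega>. weak_jet \<Omega> u = s"
  by (rule dirichlet_space_weak_jet[OF open_domain])

text \<open>The inner product of jets contains the L2 product besides that of the gradients, which
  shifts the eigenvalue by 1. A vector of \<open>V (1 + l)\<close> belongs to \<open>D\<close>,
  since it is orthogonal to everything that \<open>emb\<close> annihilates.\<close>

lemma eigenvalue_iff: "dirichlet_eigenvalue \<Omega> l \<longleftrightarrow> V (1 + l) \<noteq> {0}"
proof
  assume "dirichlet_eigenvalue \<Omega> l"
  then obtain u where u: "u \<in> H10 \<Omega>" "\<not> vanishes_on \<Omega> u"
    and eq: "\<And>\<phi>. \<phi> \<in> H10 \<Omega> \<Longrightarrow> (\<integral>x. inner (weak_grad \<Omega> u x) (weak_grad \<Omega> \<phi> x) \<partial>lebesgue_on \<Omega>) = l * (\<integral>x. u x * \<phi> x \<partial>lebesgue_on \<Omega>)"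
    unfolding dirichlet_eigenvalue_def by blast
  have "inner (weak_jet \<Omega> u) \<phi> = (1 + l) * inner (emb (weak_jet \<Omega> u)) (emb \<phi>)" for \<phi>
  proof -
    obtain v where v: "v \<in> H10 \<Omega>" "weak_jet \<Omega> v = Pr \<phi>" using D_imp_H10[OF Pr_in] by blast
    have "inner (weak_jet \<Omega> u) \<phi> = inner (weak_jet \<Omega> u) (weak_jet \<Omega> v)"
      using inner_D_Pr[OF weak_jet_in_D[OF u(1)]] v by simp
    also have "\<dots> = (1 + l) * inner (fst (weak_jet \<Omega> u)) (fst (weak_jet \<Omega> v))"
      using eq[OF v(1)] inner_weak_jet[OF open_domain H10_H1[OF u(1)] H10_H1[OF v(1)]]
      by (simp add: inner_prod_def algebra_simps)
    also have "\<dots> = (1 + l) * inner (emb (weak_jet \<Omega> u)) (emb \<phi>)"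
      using emb_D[OF weak_jet_in_D[OF u(1)]] v(2) by (simp add: emb_def)
    finally show ?thesis .
  qed
  then have "weak_jet \<Omega> u \<in> V (1 + l)" unfolding V_iff by blast
  moreover have "weak_jet \<Omega> u \<noteq> 0" using u vanishes_on_iff[OF open_domain H10_H1[OF u(1)]] by auto
  ultimately show "V (1 + l) \<noteq> {0}" by blast
next
  assume "V (1 + l) \<noteq> {0}"
  then obtain v where v: "v \<in> V (1 + l)" "v \<noteq> 0" using subspace_0[OF subspace_V] by blast
  have eq: "inner v \<phi> = (1 + l) * inner (emb v) (emb \<phi>)" for \<phi> using v(1) unfolding V_iff by blast
  have vD: "v \<in> D"
    by (rule in_D_if_orthogonal) (simp add: eq iota.diff emb_Pr)
  then obtain u where u: "u \<in> H10 \<Omega>" "weak_jet \<Omega> u = v" using D_imp_H10 by blast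
  have "emb v \<noteq> 0" using norm_V[OF v(1)] v(2) by auto
  then have "\<not> vanishes_on \<Omega> u" using u vanishes_on_iff[OF open_domain H10_H1[OF u(1)]] emb_D[OF vD] by simp
  moreover have "(\<integral>x. inner (weak_grad \<Omega> u x) (weak_grad \<Omega> \<phi> x) \<partial>lebesgue_on \<Omega>) = l * (\<integral>x. u x * \<phi> x \<partial>lebesgue_on \<Omega>)"
    if \<phi>: "\<phi> \<in> H10 \<Omega>" for \<phi>
    using eq[of "weak_jet \<Omega> \<phi>"] u emb_D[OF vD] emb_D[OF weak_jet_in_D[OF \<phi>]]
      inner_weak_jet[OF open_domain H10_H1[OF u(1)] H10_H1[OF \<phi>]]
    by (simp add: inner_prod_def algebra_simps)
  ultimately show "dirichlet_eigenvalue \<Omega> l" unfolding dirichlet_eigenvalue_def using u(1) by blast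
qed

lemma prd_weak_jet:
  assumes "u \<in> H10 \<Omega>" "v \<in> H10 \<Omega>"
  shows "(\<lambda>x. u x * v x) \<in> L2 \<Omega>" and "prd (weak_jet \<Omega> u) (weak_jet \<Omega> v) = L2_class \<Omega> (\<lambda>x. u x * v x)"
proof -
  have ae: "AE x in lebesgue. rep (emb (weak_jet \<Omega> w)) x = ext \<Omega> w x" if "w \<in> H10 \<Omega>" for w
  proof -
    have "emb (weak_jet \<Omega> w) = cls (ext \<Omega> w)"
      unfolding emb_D[OF weak_jet_in_D[OF that]] by (simp add: weak_jet_def L2_class_def)
    then show ?thesis
      using rep_cls[of "ext \<Omega> w"] H1_L2[OF open_domain H10_H1[OF that]] by (simp add: L2_ext[OF open_domain])
  qed
  have eq: "AE x in lebesgue. rep (emb (weak_jet \<Omega> u)) x * rep (emb (weak_jet \<Omega> v)) x = ext \<Omega> (\<lambda>x. u x * v x) x"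
    using ae[OF assms(1)] ae[OF assms(2)] by eventually_elim (simp add: ext_mult[OF open_domain])
  have m: "ext \<Omega> w \<in> borel_measurable lebesgue" if "w \<in> H10 \<Omega>" for w
    using H1_L2[OF open_domain H10_H1[OF that]] by (simp add: L2_ext[OF open_domain] sqint_measurable)
  have m': "ext \<Omega> (\<lambda>x. u x * v x) \<in> borel_measurable lebesgue"
  proof -
    have "(\<lambda>x. ext \<Omega> u x * ext \<Omega> v x) \<in> borel_measurable lebesgue" using m assms by measurable
    then show ?thesis by (simp add: ext_mult[OF open_domain])
  qed
  have s: "ext \<Omega> (\<lambda>x. u x * v x) \<in> sqint"
  proof (rule sqintI[OF m'])
    have "integrable lebesgue (\<lambda>x. (rep (emb (weak_jet \<Omega> u)) x * rep (emb (weak_jet \<Omega> v)) x)\<^sup>2)"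
      by (rule sqint_integrable[OF prd_sqint])
    moreover have "AE x in lebesgue. (rep (emb (weak_jet \<Omega> u)) x * rep (emb (weak_jet \<Omega> v)) x)\<^sup>2 = (ext \<Omega> (\<lambda>x. u x * v x) x)\<^sup>2"
      using eq by eventually_elim simp
    ultimately show "integrable lebesgue (\<lambda>x. (ext \<Omega> (\<lambda>x. u x * v x) x)\<^sup>2)"
      using m' sqint_measurable[OF prd_sqint] by (subst (asm) integrable_cong_AE) auto
  qed
  then show "(\<lambda>x. u x * v x) \<in> L2 \<Omega>" by (simp add: L2_ext[OF open_domain])
  show "prd (weak_jet \<Omega> u) (weak_jet \<Omega> v) = L2_class \<Omega> (\<lambda>x. u x * v x)"
    unfolding prd_def L2_class_def using eq by (subst cls_eq_iff[OF prd_sqint s])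
qed

text \<open>With \<mu> on the diagonal the self-interaction is the term k = i of one coupling
  sum.\<close>

definition coeff :: "('m::finite \<Rightarrow> real) \<Rightarrow> ('m \<Rightarrow> 'm \<Rightarrow> real) \<Rightarrow> 'm \<Rightarrow> 'm \<Rightarrow> real" where
  "coeff \<mu> \<beta> k i = (if k = i then \<mu> i else \<beta> k i)"

text \<open>Completing the gradient pairing to the full inner product turns the coefficient
  \<open>c\<close> into \<open>1 - c\<close>. Grouping the square of \<open>u k\<close> against
  \<open>u i\<close> times \<phi> makes each quartic integral a pairing of two L2 functions.\<close>

lemma weak_form:
  fixes u :: "'m::finite \<Rightarrow> real ^ 'n \<Rightarrow> real"
  assumes u: "\<And>i. u i \<in> H10 \<Omega>" and \<phi>: "\<phi> \<in> H10 \<Omega>"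
  defines "U \<equiv> \<lambda>i. weak_jet \<Omega> (u i)" and "\<Phi> \<equiv> weak_jet \<Omega> \<phi>"
  shows "(\<integral>x. inner (weak_grad \<Omega> (u i) x) (weak_grad \<Omega> \<phi> x) + c * u i x * \<phi> x \<partial>lebesgue_on \<Omega>)
      = inner (U i) \<Phi> - (1 - c) * inner (emb (U i)) (emb \<Phi>)"
    and "(\<integral>x. (\<mu> i * (u i x) ^ 3 + (\<Sum>k\<in>UNIV - {i}. \<beta> k i * (u k x)\<^sup>2 * u i x)) * \<phi> x \<partial>lebesgue_on \<Omega>)
      = (\<Sum>k\<in>UNIV. coeff \<mu> \<beta> k i * inner (prd (U k) (U k)) (prd (U i) \<Phi>))"
proof -
  note h1 = H10_H1[OF u[of i]] H10_H1[OF \<phi>]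
  have ig: "integrable (lebesgue_on \<Omega>) (\<lambda>x. inner (weak_grad \<Omega> (u i) x) (weak_grad \<Omega> \<phi> x))"
    by (intro inner_grad_integrable[OF open_domain] weak_grad_L2[OF open_domain] h1)
  have iu: "integrable (lebesgue_on \<Omega>) (\<lambda>x. u i x * \<phi> x)"
    by (intro L2_mult_integrable[OF open_domain] H1_L2[OF open_domain] h1)
  have "(\<integral>x. inner (weak_grad \<Omega> (u i) x) (weak_grad \<Omega> \<phi> x) + c * u i x * \<phi> x \<partial>lebesgue_on \<Omega>)
      = (\<integral>x. inner (weak_grad \<Omega> (u i) x) (weak_grad \<Omega> \<phi> x) \<partial>lebesgue_on \<Omega>) + c * (\<integral>x. u i x * \<phi> x \<partial>lebesgue_on \<Omega>)"
    using ig iu by (simp add: mult.assoc)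
  also have "\<dots> = inner (snd (U i)) (snd \<Phi>) + c * inner (fst (U i)) (fst \<Phi>)"
    by (simp add: U_def \<Phi>_def inner_weak_jet[OF open_domain h1])
  also have "\<dots> = inner (U i) \<Phi> - (1 - c) * inner (emb (U i)) (emb \<Phi>)"
    by (simp add: inner_prod_def U_def \<Phi>_def emb_D weak_jet_in_D u \<phi> algebra_simps)
  finally show "(\<integral>x. inner (weak_grad \<Omega> (u i) x) (weak_grad \<Omega> \<phi> x) + c * u i x * \<phi> x \<partial>lebesgue_on \<Omega>)
      = inner (U i) \<Phi> - (1 - c) * inner (emb (U i)) (emb \<Phi>)" .
  have iq: "integrable (lebesgue_on \<Omega>) (\<lambda>x. u k x * u k x * (u i x * \<phi> x))" for k
    by (intro L2_mult_integrable[OF open_domain] prd_weak_jet u \<phi>)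
  have q: "inner (prd (U k) (U k)) (prd (U i) \<Phi>) = (\<integral>x. u k x * u k x * (u i x * \<phi> x) \<partial>lebesgue_on \<Omega>)" for k
    unfolding U_def \<Phi>_def by (simp add: prd_weak_jet u \<phi> inner_L2_class[OF open_domain])
  have "(\<mu> i * (u i x) ^ 3 + (\<Sum>k\<in>UNIV - {i}. \<beta> k i * (u k x)\<^sup>2 * u i x)) * \<phi> x
      = (\<Sum>k\<in>UNIV. coeff \<mu> \<beta> k i * (u k x * u k x * (u i x * \<phi> x)))" for x
  proof -
    have "(\<Sum>k\<in>UNIV. coeff \<mu> \<beta> k i * (u k x * u k x * (u i x * \<phi> x)))
        = coeff \<mu> \<beta> i i * (u i x * u i x * (u i x * \<phi> x)) + (\<Sum>k\<in>UNIV - {i}. coeff \<mu> \<beta> k i * (u k x * u k x * (u i x * \<phi> x)))"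
      by (rule sum.remove) auto
    also have "(\<Sum>k\<in>UNIV - {i}. coeff \<mu> \<beta> k i * (u k x * u k x * (u i x * \<phi> x)))
        = (\<Sum>k\<in>UNIV - {i}. \<beta> k i * (u k x)\<^sup>2 * u i x) * \<phi> x"
      unfolding sum_distrib_right by (intro sum.cong) (auto simp: coeff_def power2_eq_square)
    finally show ?thesis by (simp add: coeff_def power3_eq_cube algebra_simps)
  qed
  then show "(\<integral>x. (\<mu> i * (u i x) ^ 3 + (\<Sum>k\<in>UNIV - {i}. \<beta> k i * (u k x)\<^sup>2 * u i x)) * \<phi> x \<partial>lebesgue_on \<Omega>)
      = (\<Sum>k\<in>UNIV. coeff \<mu> \<beta> k i * inner (prd (U k) (U k)) (prd (U i) \<Phi>))"
    using iq by (simp add: q)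
qed

text \<open>Testing with \<phi> or with its projection \<open>Pr \<phi>\<close> is the same, because
  the solution lies in \<open>D\<close> and both \<open>emb\<close> and \<open>prd\<close> factor
  through \<open>Pr\<close>; the elements of \<open>D\<close> are the jets of H10 functions.\<close>

lemma solves_system_iff:
  fixes u :: "'m::finite \<Rightarrow> real ^ 'n \<Rightarrow> real"
  assumes u: "\<And>i. u i \<in> H10 \<Omega>"
  shows "solves_system \<Omega> \<mu> \<beta> l u \<longleftrightarrow> solution (coeff \<mu> \<beta>) (\<lambda>i. 1 - l $ i) (\<lambda>i. weak_jet \<Omega> (u i))"
proof -
  let ?U = "\<lambda>i. weak_jet \<Omega> (u i)"
  let ?P = "\<lambda>i \<phi>. inner (?U i) \<phi> - (1 - l $ i) * inner (emb (?U i)) (emb \<phi>)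
      = (\<Sum>k\<in>UNIV. coeff \<mu> \<beta> k i * inner (prd (?U k) (?U k)) (prd (?U i) \<phi>))"
  have "solves_system \<Omega> \<mu> \<beta> l u \<longleftrightarrow> (\<forall>i. \<forall>\<phi>\<in>H10 \<Omega>. ?P i (weak_jet \<Omega> \<phi>))"
    unfolding solves_system_def using u by (simp add: weak_form)
  also have "\<dots> \<longleftrightarrow> (\<forall>i. \<forall>\<phi>. ?P i \<phi>)"
  proof (intro iffI allI)
    fix i \<phi> assume a: "\<forall>i. \<forall>\<phi>\<in>H10 \<Omega>. ?P i (weak_jet \<Omega> \<phi>)"
    obtain v where v: "v \<in> H10 \<Omega>" "weak_jet \<Omega> v = Pr \<phi>" using D_imp_H10[OF Pr_in] by blast
    have "?P i (Pr \<phi>)" using a[rule_format, OF v(1), of i] unfolding v(2) .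
    then show "?P i \<phi>" by (simp add: inner_D_Pr weak_jet_in_D u emb_Pr prd_Pr)
  qed blast
  finally show ?thesis unfolding solution_def by simp
qed

text \<open>Testing with \<open>\<phi> - Pr \<phi>\<close> kills every term except the inner
  product.\<close>

lemma solution_in_D:
  assumes "solution \<beta> \<tau> U"
  shows "U i \<in> D"
proof (rule in_D_if_orthogonal)
  fix \<phi>
  show "inner (U i) (\<phi> - Pr \<phi>) = 0"
    using assms[unfolded solution_def, rule_format, of i "\<phi> - Pr \<phi>"]
    by (simp add: iota.diff emb_Pr p.diff_right prd_Pr)
qed

lemma H1_norm_weak_jet: "u \<in> H10 \<Omega> \<Longrightarrow> H1_norm \<Omega> u = norm (weak_jet \<Omega> u)"
  by (rule H1_norm_eq[OF open_domain H10_H1])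

proposition nontrivial_bifurcation_point_iff:
  fixes \<mu> :: "'m::finite \<Rightarrow> real" and \<beta> :: "'m \<Rightarrow> 'm \<Rightarrow> real"
  assumes sym: "\<And>i j. i \<noteq> j \<Longrightarrow> \<beta> i j = \<beta> j i"
  shows "nontrivial_bifurcation_point \<Omega> \<mu> \<beta> lstar \<longleftrightarrow> (\<forall>i. dirichlet_eigenvalue \<Omega> (lstar $ i))"
proof
  assume "nontrivial_bifurcation_point \<Omega> \<mu> \<beta> lstar"
  then obtain l u where sol: "\<And>n. solves_system \<Omega> \<mu> \<beta> (l n) (u n)"
    and l: "\<And>i. (\<lambda>n. - (l n $ i)) \<longlonglongrightarrow> lstar $ i" and un: "(\<lambda>n. H1_vec_norm \<Omega> (u n)) \<longlonglongrightarrow> 0"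
    and nz: "\<And>n i. \<not> vanishes_on \<Omega> (u n i)"
    unfolding nontrivial_bifurcation_point_def bifurcation_sequence_def by blast
  have u: "u n i \<in> H10 \<Omega>" for n i using sol[of n] by (simp add: solves_system_def)
  show "\<forall>i. dirichlet_eigenvalue \<Omega> (lstar $ i)"
  proof (rule ccontr)
    assume "\<not> ?thesis"
    then obtain i where "V (1 + lstar $ i) = {0}" by (auto simp: eigenvalue_iff)
    from no_small_solution[OF this, of "coeff \<mu> \<beta>"] obtain \<delta> where \<delta>: "\<delta> > 0"
      "\<And>U \<tau> i'. solution (coeff \<mu> \<beta>) \<tau> U \<Longrightarrow> \<bar>\<tau> i' - (1 + lstar $ i)\<bar> < \<delta> \<Longrightarrow> (\<And>k. norm (U k) < \<delta>) \<Longrightarrow> U i' = 0"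
      by blast
    have "eventually (\<lambda>n. H1_vec_norm \<Omega> (u n) < \<delta>) sequentially" using order_tendstoD(2)[OF un] \<delta> by simp
    moreover have "eventually (\<lambda>n. dist (- (l n $ i)) (lstar $ i) < \<delta>) sequentially" using tendstoD[OF l] \<delta> by simp
    ultimately have "eventually (\<lambda>n. H1_vec_norm \<Omega> (u n) < \<delta> \<and> dist (- (l n $ i)) (lstar $ i) < \<delta>) sequentially"
      by eventually_elim simp
    then obtain n where n: "H1_vec_norm \<Omega> (u n) < \<delta>" "dist (- (l n $ i)) (lstar $ i) < \<delta>"
      unfolding eventually_sequentially by blast
    have small: "norm (weak_jet \<Omega> (u n k)) < \<delta>" for k
    proof -
      have "norm (weak_jet \<Omega> (u n k)) = sqrt ((H1_norm \<Omega> (u n k))\<^sup>2)" by (simp add: H1_norm_weak_jet u)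
      also have "\<dots> \<le> H1_vec_norm \<Omega> (u n)"
        unfolding H1_vec_norm_def by (intro real_sqrt_le_mono member_le_sum) auto
      finally show ?thesis using n by simp
    qed
    have "weak_jet \<Omega> (u n i) = 0"
    proof (rule \<delta>(2)[of "\<lambda>i. 1 - l n $ i" "\<lambda>i. weak_jet \<Omega> (u n i)" i])
      show "solution (coeff \<mu> \<beta>) (\<lambda>i. 1 - l n $ i) (\<lambda>i. weak_jet \<Omega> (u n i))"
        using sol[of n] solves_system_iff[of "u n"] u by blast
      show "\<bar>(1 - l n $ i) - (1 + lstar $ i)\<bar> < \<delta>" using n(2) by (simp add: dist_real_def)
      show "norm (weak_jet \<Omega> (u n k)) < \<delta>" for k by (rule small)
    qed
    then show False using nz[of n i] vanishes_on_iff[OF open_domain H10_H1[OF u[of n i]]] by simp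
  qed
next
  assume ev: "\<forall>i. dirichlet_eigenvalue \<Omega> (lstar $ i)"
  define \<kappa> where "\<kappa> i = 1 + lstar $ i" for i
  have ne: "Sph (\<kappa> i) \<noteq> {}" for i
  proof -
    have "V (\<kappa> i) \<noteq> {0}" using ev by (simp add: eigenvalue_iff \<kappa>_def)
    then obtain v where "v \<in> V (\<kappa> i)" "v \<noteq> 0" using subspace_0[OF subspace_V] by blast
    then show ?thesis by (rule Sph_nonempty)
  qed
  interpret bifurcation_problem emb prd "coeff \<mu> \<beta>" \<kappa>
    by unfold_locales (use sym ne in \<open>auto simp: coeff_def\<close>)
  have "\<exists>U \<tau>. solution (coeff \<mu> \<beta>) \<tau> U \<and> (\<forall>i. emb (U i) \<noteq> 0 \<and> norm (U i) < 1 / real (Suc n) \<and> \<bar>\<tau> i - \<kappa> i\<bar> < 1 / real (Suc n))" for n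
    by (rule bifurcation) simp
  then have "\<forall>n. \<exists>U \<tau>. solution (coeff \<mu> \<beta>) \<tau> U \<and> (\<forall>i. emb (U i) \<noteq> 0 \<and> norm (U i) < 1 / real (Suc n) \<and> \<bar>\<tau> i - \<kappa> i\<bar> < 1 / real (Suc n))" by blast
  from choice[OF this] obtain U where
    "\<forall>n. \<exists>\<tau>. solution (coeff \<mu> \<beta>) \<tau> (U n) \<and> (\<forall>i. emb (U n i) \<noteq> 0 \<and> norm (U n i) < 1 / real (Suc n) \<and> \<bar>\<tau> i - \<kappa> i\<bar> < 1 / real (Suc n))" by blast
  from choice[OF this] obtain \<tau> where sol: "\<And>n. solution (coeff \<mu> \<beta>) (\<tau> n) (U n)" and nz: "\<And>n i. emb (U n i) \<noteq> 0"
    and small: "\<And>n i. norm (U n i) < 1 / real (Suc n)" and \<tau>: "\<And>n i. \<bar>\<tau> n i - \<kappa> i\<bar> < 1 / real (Suc n)"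
    by blast
  \<comment> \<open>The abstract solutions lie in \<open>D\<close>, so they are weak jets of actual
    functions.\<close>
  define u where "u n i = (SOME u. u \<in> H10 \<Omega> \<and> weak_jet \<Omega> u = U n i)" for n i
  have "\<exists>u. u \<in> H10 \<Omega> \<and> weak_jet \<Omega> u = U n i" for n i using D_imp_H10[OF solution_in_D[OF sol]] by blast
  from someI_ex[OF this] have u: "u n i \<in> H10 \<Omega>" "weak_jet \<Omega> (u n i) = U n i" for n i unfolding u_def by auto
  define l where "l n = (\<chi> i. 1 - \<tau> n i)" for n
  have s: "solves_system \<Omega> \<mu> \<beta> (l n) (u n)" for n
    using sol[of n] by (simp add: solves_system_iff u l_def)
  have v: "\<not> vanishes_on \<Omega> (u n i)" for n i
    using nz[of n i] emb_D[OF solution_in_D[OF sol]] vanishes_on_iff[OF open_domain H10_H1[OF u(1)]] by (simp add: u(2))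
  have inv: "(\<lambda>n. 1 / real (Suc n)) \<longlonglongrightarrow> 0" by (rule LIMSEQ_Suc[OF lim_1_over_n])
  have lim: "(\<lambda>n. - (l n $ i)) \<longlonglongrightarrow> lstar $ i" for i
  proof -
    have "(\<lambda>n. \<tau> n i - \<kappa> i) \<longlonglongrightarrow> 0"
      by (rule Lim_null_comparison[OF _ inv]) (use \<tau> in \<open>auto intro!: always_eventually less_imp_le\<close>)
    then have "(\<lambda>n. (\<tau> n i - \<kappa> i) + lstar $ i) \<longlonglongrightarrow> 0 + lstar $ i" by (intro tendsto_intros)
    then show ?thesis by (simp add: l_def \<kappa>_def)
  qed
  have H0: "(\<lambda>n. H1_norm \<Omega> (u n i)) \<longlonglongrightarrow> 0" for i
    by (rule Lim_null_comparison[OF _ inv])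
       (use small in \<open>auto simp: H1_norm_weak_jet u intro!: always_eventually less_imp_le\<close>)
  have "(\<lambda>n. sqrt (\<Sum>i\<in>UNIV. (H1_norm \<Omega> (u n i))\<^sup>2)) \<longlonglongrightarrow> sqrt (\<Sum>i\<in>(UNIV :: 'm set). 0\<^sup>2)"
    by (intro tendsto_intros H0)
  then have "(\<lambda>n. H1_vec_norm \<Omega> (u n)) \<longlonglongrightarrow> 0" by (simp add: H1_vec_norm_def)
  then have "bifurcation_sequence \<Omega> \<mu> \<beta> lstar l u"
    unfolding bifurcation_sequence_def using s v lim by blast
  then show "nontrivial_bifurcation_point \<Omega> \<mu> \<beta> lstar"
    unfolding nontrivial_bifurcation_point_def using v by blast
qed

end

theorem theorem1p9:
  fixes \<Omega> :: "(real ^ 'n) set"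
    and \<mu> :: "'m::finite \<Rightarrow> real"
    and \<beta> :: "'m \<Rightarrow> 'm \<Rightarrow> real"
  assumes "CARD('n) \<in> {3, 4}"
    and "bounded_regular_domain \<Omega>"
    and "\<And>i. \<mu> i \<noteq> 0"
    and "\<And>i j. i \<noteq> j \<Longrightarrow> \<beta> i j = \<beta> j i \<and> \<beta> i j \<noteq> 0"
  shows "{lstar :: real ^ 'm. nontrivial_bifurcation_point \<Omega> \<mu> \<beta> lstar}
       = {l :: real ^ 'm. \<forall>i. dirichlet_eigenvalue \<Omega> (l $ i)}"
proof -
  interpret low_dimensional_domain \<Omega>
    using assms(1,2) by unfold_locales (auto simp: bounded_regular_domain_def)
  show ?thesis using nontrivial_bifurcation_point_iff[of \<beta> \<mu>] assms(4) by blast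
qed

end
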